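(* Let $p$ be a prime, $\rho_1,\rho_2\in(0,1)$ with $\rho_1\neq\rho_2$, $c\in\mathbb{R}$, $M=\begin{bmatrix}\rho_1^{-1} & c\\ 0 & \rho_2^{-1}\end{bmatrix}$, and let $D=\{d_0,d_1,\dots,d_{p-1}\}\subset\mathbb{Z}^2$ be a set of $p$ distinct vectors with $d_0=(0,0)^*$, $d_1=(d_{1,1},0)^*$, $d_{1,1}\neq0$, such that $\mathcal{Z}(\widehat{\delta}_D)=\bigcup_{j=1}^{p-1}\left(\frac{j\bm{a}}{p}+\mathbb{Z}^2\right)$ for some $\bm{a}=(a_1,a_2)^*\in\mathcal{E}_p$. Let $\mu_{M,D}$ be the associated self-affine measure, put $c''=\frac{c}{\rho_1^{-1}-\rho_2^{-1}}$, and let $E_{\bm{a}}=\left\{\frac{h}{l}: la_2-ha_1\in\mathbb{Z}\setminus p\mathbb{Z},\ \gcd(h,l)=1\right\}\cup\{0\}$. Suppose $c''=\frac{c_1}{c_2}\in E_{\bm{a}}$, where $c_1,c_2$ are integers with $\gcd(c_1,c_2)=1$ and $c_2\in p^{\ell}(\mathbb{Z}\setminus p\mathbb{Z})$ for some integer $\ell\ge0$. Then $\mu_{M,D}$ is a spectral measure if and only if $\rho_1^{-1},\rho_2^{-1}\in p\mathbb{Z}$ and $p^{\ell+1}\mid(\rho_1^{-1}-\rho_2^{-1})$.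
   Context: In the definition of $E_{\bm a}$, $h,l$ are integers with $l\neq0$. $v^*$ denotes the (conjugate) transpose, so $(i_1,i_2)^*$ is a column vector. $\mathcal{E}_p=\{(i_1,i_2)^*: i_1,i_2\in\{1,\dots,p-1\}\}$. For a finite set $E\subset\mathbb{R}^2$, $\delta_E=\frac{1}{\#E}\sum_{e\in E}\delta_e$, where $\delta_e$ is the Dirac measure at $e$. For a compactly supported Borel probability measure $\mu$ on $\mathbb{R}^2$, $\widehat{\mu}(\xi)=\int e^{-2\pi i\langle\xi,x\rangle}\,d\mu(x)$, $\xi\in\mathbb{R}^2$; $\mathcal{Z}(f)$ is the set of zeros of $f$ in $\mathbb{R}^2$. The self-affine measure $\mu_{M,D}$ is the unique Borel probability measure satisfying $\mu=\frac{1}{\#D}\sum_{d\in D}\mu\circ\varphi_d^{-1}$ with $\varphi_d(x)=M^{-1}(x+d)$. A compactly supported Borel probability measure $\mu$ is a spectral measure if there is a countable $\Lambda\subset\mathbb{R}^2$ (a spectrum of $\mu$) such that $\{e^{-2\pi i\langle\lambda,x\rangle}:\lambda\in\Lambda\}$ is an orthonormal basis of $L^2(\mu)$. *)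

theory Defs
  imports "HOL-Analysis.Analysis" "HOL-Probability.Probability"
    "HOL-Computational_Algebra.Primes"
begin

definition real_vec :: "int ^ 'n \<Rightarrow> real ^ 'n" where
  "real_vec v = (\<chi> i. real_of_int (v $ i))"

text \<open>The subset \<open>m \<int>\<close> of the reals.\<close>

definition int_multiples :: "int \<Rightarrow> real set" where
  "int_multiples m = {real_of_int (m * k) | k. True}"

definition fourier_exp :: "'a::euclidean_space \<Rightarrow> 'a \<Rightarrow> complex" where
  "fourier_exp \<xi> x = exp (- 2 * complex_of_real pi * \<i> * complex_of_real (\<xi> \<bullet> x))"

definition fourier_transform :: "'a::euclidean_space measure \<Rightarrow> 'a \<Rightarrow> complex" where
  "fourier_transform \<mu> \<xi> = (LINT x|\<mu>. fourier_exp \<xi> x)"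

definition zero_set :: "('a \<Rightarrow> complex) \<Rightarrow> 'a set" where
  "zero_set f = {\<xi>. f \<xi> = 0}"

text \<open>The Borel measure \<open>(\<Sum>e\<in>E. N e) / card E\<close>, for finite nonempty \<open>E\<close>.\<close>

definition average_measure ::
  "'b set \<Rightarrow> ('b \<Rightarrow> 'a measure) \<Rightarrow> 'a::topological_space measure" where
  "average_measure E N =
     measure_of UNIV (sets borel) (\<lambda>A. (\<Sum>e\<in>E. emeasure (N e) A) / of_nat (card E))"

lemma sets_average_measure [simp]: "sets (average_measure E N) = sets borel"
  and space_average_measure [simp]: "space (average_measure E N) = UNIV"
  unfolding average_measure_def
  by (metis sets.sets_measure_of_eq sets_measure_of_conv space_borel)
     (simp add: space_measure_of_conv)

lemma emeasure_average_measure: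
  assumes "\<And>e. e \<in> E \<Longrightarrow> sets (N e) = sets borel" and "A \<in> sets borel"
  shows "emeasure (average_measure E N) A = (\<Sum>e\<in>E. emeasure (N e) A) / of_nat (card E)"
proof (rule emeasure_measure_of[OF average_measure_def])
  show "countably_additive (sets (average_measure E N))
      (\<lambda>A. (\<Sum>e\<in>E. emeasure (N e) A) / of_nat (card E))"
  proof (rule countably_additiveI)
    fix B :: "nat \<Rightarrow> 'b set"
    assume B: "range B \<subseteq> sets (average_measure E N)" "disjoint_family B"
    have "(\<Sum>i. (\<Sum>e\<in>E. emeasure (N e) (B i)) / of_nat (card E))
        = (\<Sum>i. \<Sum>e\<in>E. emeasure (N e) (B i)) / of_nat (card E)"
      by simp
    also have "(\<Sum>i. \<Sum>e\<in>E. emeasure (N e) (B i)) = (\<Sum>e\<in>E. \<Sum>i. emeasure (N e) (B i))"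
      by (intro suminf_sum) auto
    also have "\<dots> = (\<Sum>e\<in>E. emeasure (N e) (\<Union>i. B i))"
      using B assms(1) by (intro sum.cong refl suminf_emeasure) auto
    finally show "(\<Sum>i. (\<Sum>e\<in>E. emeasure (N e) (B i)) / of_nat (card E))
        = (\<Sum>e\<in>E. emeasure (N e) (\<Union>i. B i)) / of_nat (card E)" .
  qed
qed (use assms in \<open>auto simp: positive_def\<close>)

text \<open>\<open>return borel e\<close> is the Dirac measure at \<open>e\<close>.\<close>

definition delta_measure :: "'a::euclidean_space set \<Rightarrow> 'a measure" where
  "delta_measure E = average_measure E (return borel)"

definition affine_map :: "real ^ 'n ^ 'n \<Rightarrow> real ^ 'n \<Rightarrow> real ^ 'n \<Rightarrow> real ^ 'n" where
  "affine_map M d x = matrix_inv M *v (x + d)"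

text \<open>The measure \<open>\<mu>\<close> is determined by this property when \<open>M\<close> is expanding and \<open>D\<close> is finite
  and nonempty.\<close>

definition self_affine_measure ::
  "real ^ 'n ^ 'n \<Rightarrow> (real ^ 'n) set \<Rightarrow> (real ^ 'n) measure \<Rightarrow> bool" where
  "self_affine_measure M D \<mu> \<longleftrightarrow>
     prob_space \<mu> \<and> sets \<mu> = sets borel \<and>
     \<mu> = average_measure D (\<lambda>d. distr \<mu> borel (affine_map M d))"

definition L2_functions :: "'a measure \<Rightarrow> ('a \<Rightarrow> complex) set" where
  "L2_functions \<mu> = {f \<in> borel_measurable \<mu>. integrable \<mu> (\<lambda>x. (cmod (f x))\<^sup>2)}"

text \<open>Elements of \<open>L\<^sup>2(\<mu>)\<close> are represented by functions rather than by their classes modulo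
  equality almost everywhere; the conditions below are invariant under that equality.
  A basis is an orthonormal family whose finite linear combinations are dense.\<close>

definition orthonormal_basis_L2 :: "'a measure \<Rightarrow> 'i set \<Rightarrow> ('i \<Rightarrow> 'a \<Rightarrow> complex) \<Rightarrow> bool" where
  "orthonormal_basis_L2 \<mu> I e \<longleftrightarrow>
     (\<forall>i\<in>I. e i \<in> L2_functions \<mu>) \<and>
     (\<forall>i\<in>I. \<forall>j\<in>I. (LINT x|\<mu>. e i x * cnj (e j x)) = (if i = j then 1 else 0)) \<and>
     (\<forall>f\<in>L2_functions \<mu>. \<forall>\<epsilon>>0. \<exists>S c. finite S \<and> S \<subseteq> I \<and>
        (LINT x|\<mu>. (cmod (f x - (\<Sum>i\<in>S. c i * e i x)))\<^sup>2) < \<epsilon>)"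

definition compactly_supported :: "'a::topological_space measure \<Rightarrow> bool" where
  "compactly_supported \<mu> \<longleftrightarrow> (\<exists>K. compact K \<and> emeasure \<mu> (- K) = 0)"

definition spectral_measure :: "'a::euclidean_space measure \<Rightarrow> bool" where
  "spectral_measure \<mu> \<longleftrightarrow>
     prob_space \<mu> \<and> sets \<mu> = sets borel \<and> compactly_supported \<mu> \<and>
     (\<exists>\<Lambda>. countable \<Lambda> \<and> orthonormal_basis_L2 \<mu> \<Lambda> fourier_exp)"

definition residue_vectors :: "nat \<Rightarrow> (int ^ 2) set" where
  "residue_vectors p = {a. \<forall>i. a $ i \<in> {1..int p - 1}}"

definition E_set :: "nat \<Rightarrow> int ^ 2 \<Rightarrow> real set" where
  "E_set p a = {real_of_int h / real_of_int l | h l.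
       l \<noteq> 0 \<and> \<not> int p dvd (l * a $ 2 - h * a $ 1) \<and> coprime h l} \<union> {0}"

end

theory Submission
  imports Defs "HOL-Computational_Algebra.Polynomial"
begin

text \<open>Write \<open>f\<close> and \<open>g\<close> for the Fourier transforms of the uniform measure on the digits and of \<open>\<mu>\<close>, and \<open>P\<close> for the
transposed inverse of the matrix. Self-affinity reads \<open>g x = f (P x) * g (P x)\<close>, so \<open>g x\<close> is the product of
all \<open>f (P ^ k x)\<close> with \<open>k \<ge> 1\<close>, and a zero of \<open>g\<close> belongs to the level \<open>k\<close> of a vanishing factor. A set \<open>\<Lambda>\<close> is a
spectrum if and only if \<open>g\<close> vanishes at all differences and the squares of \<open>\<bar>g (\<xi> + l)\<bar>\<close> over \<open>l \<in> \<Lambda>\<close> sum to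
one for every \<open>\<xi>\<close> (\<open>orthonormal_basis_iff_parseval\<close>). Both implications work with this criterion. In the
coordinates \<open>x\<^sub>1\<close> and \<open>x\<^sub>2 - \<kappa> * x\<^sub>1\<close> with \<open>\<kappa> = c / (r1 - r2)\<close>, \<open>P\<close> divides by \<open>r1\<close> and \<open>r2\<close>. By the hypotheses on the zeros
of \<open>f\<close> and on \<open>\<kappa>\<close>, suitable multiples of both coordinates are integers prime to \<open>p\<close> on the zeros of \<open>f\<close>.

\<^bold>\<open>Necessity.\<close> Every level occurs among the differences of a spectrum: otherwise a factor could be deleted from
the product, and Bessel's inequality for the larger remaining product would be violated (\<open>level_occurs\<close>).
In one coordinate, differences of level \<open>k\<close> have the form \<open>r ^ k * \<alpha>\<close> with \<open>\<alpha>\<close> prime to \<open>p\<close>. A valuation of the real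
numbers above \<open>p\<close> shows that \<open>r\<close> has positive valuation: a unit would bound the number of points, and a
negative valuation would contradict \<open>r > 1\<close>. The levels then form an ultrametric in which any two points
are linked by pairs of level one. Hence all differences are integral multiples of \<open>r\<close>, and a pair of level two
makes \<open>r = a / b\<close> rational with \<open>p\<close> dividing \<open>a\<close> (\<open>levels_force_rational_ratio\<close>). If \<open>b \<ge> 2\<close>, points separated
at level \<open>n\<close> are \<open>a ^ n / b\<close> apart, which is exponentially large on the scale \<open>(a / b) ^ n\<close> of that
level, and \<open>g\<close> decays there; the deficit in Parseval's identity then stays bounded away from zero
(\<open>noninteger_ratio_incomplete\<close>). So both ratios are multiples of \<open>p\<close>. Finally, linking a pair of level two by pairs
of level one makes a vector integral whose second coordinate has \<open>p ^ (l + 1)\<close> in the denominator unless that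
power divides \<open>r1 - r2\<close> (\<open>necessity\<close>).

\<^bold>\<open>Sufficiency.\<close> The divisibility makes a lattice of suitable shape invariant, so that digit expansions in powers of the
transposed matrix give orthogonal frequencies. They are built as a growing tree. Each new node is translated
by a period of \<open>f\<close> to a place where the tail of its product is bounded below. Such places exist because
zeros of high level are too sparse to fill a coset (\<open>g_nonvanishing\<close>). As the modulus of a tail only grows with the
index, the bound persists, and Parseval's identity for the partial products passes to the limit
(\<open>tree_complete\<close>).\<close>

section \<open>A valuation ring of the reals above the prime\<close>
definition is_subring :: "'a::field set \<Rightarrow> bool" where
  "is_subring A \<longleftrightarrow> 1 \<in> A \<and> (\<forall>x\<in>A. \<forall>y\<in>A. x - y \<in> A \<and> x * y \<in> A)"

lemma is_subringD:
  assumes "is_subring A"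
  shows "1 \<in> A" "0 \<in> A" "x \<in> A \<Longrightarrow> y \<in> A \<Longrightarrow> x - y \<in> A" "x \<in> A \<Longrightarrow> y \<in> A \<Longrightarrow> x * y \<in> A"
    "x \<in> A \<Longrightarrow> - x \<in> A" "x \<in> A \<Longrightarrow> y \<in> A \<Longrightarrow> x + y \<in> A"
proof -
  show one: "1 \<in> A" and diff: "\<And>x y. x \<in> A \<Longrightarrow> y \<in> A \<Longrightarrow> x - y \<in> A"
    and "x \<in> A \<Longrightarrow> y \<in> A \<Longrightarrow> x * y \<in> A"
    using assms by (auto simp: is_subring_def)
  show z: "0 \<in> A" using diff[OF one one] by simp
  show m: "\<And>x. x \<in> A \<Longrightarrow> - x \<in> A" using diff[OF z] by simp
  show "x \<in> A \<Longrightarrow> y \<in> A \<Longrightarrow> x + y \<in> A" using diff[of x "- y"] m by simp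
qed

lemma is_subring_sum:
  assumes "is_subring A" "\<And>i. i \<in> I \<Longrightarrow> h i \<in> A"
  shows "sum h I \<in> A"
  using assms(2) by (induction I rule: infinite_finite_induct) (auto intro: is_subringD[OF assms(1)])

lemma is_subring_power: "is_subring A \<Longrightarrow> x \<in> A \<Longrightarrow> x ^ n \<in> A"
  by (induction n) (auto intro: is_subringD)

lemma is_subring_of_nat: "is_subring A \<Longrightarrow> of_nat n \<in> A"
  by (induction n) (auto intro: is_subringD)

lemma is_subring_of_int: "is_subring A \<Longrightarrow> of_int n \<in> A"
  by (cases n) (auto intro!: is_subringD(5) is_subring_of_nat simp del: of_nat_Suc
      simp: of_nat_Suc[symmetric])

definition adjoin :: "'a::field set \<Rightarrow> 'a \<Rightarrow> 'a set" where
  "adjoin A x = {poly q x | q. \<forall>i. coeff q i \<in> A}"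

lemma is_subring_adjoin:
  assumes A: "is_subring A"
  shows "is_subring (adjoin A x)"
  unfolding is_subring_def
proof (intro conjI ballI)
  show "1 \<in> adjoin A x"
    unfolding adjoin_def using is_subringD[OF A] by (auto intro!: exI[of _ 1])
next
  fix u v assume "u \<in> adjoin A x" "v \<in> adjoin A x"
  then obtain q s where q: "u = poly q x" "\<forall>i. coeff q i \<in> A" and s: "v = poly s x" "\<forall>i. coeff s i \<in> A"
    by (auto simp: adjoin_def)
  show "u - v \<in> adjoin A x"
    unfolding adjoin_def using q s by (auto intro!: exI[of _ "q - s"] is_subringD[OF A])
  show "u * v \<in> adjoin A x"
    unfolding adjoin_def using q s
    by (auto intro!: exI[of _ "q * s"] is_subring_sum[OF A] is_subringD(4)[OF A] simp: coeff_mult)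
qed

lemma adjoin_extends:
  assumes A: "is_subring A"
  shows "A \<subseteq> adjoin A x" and "x \<in> adjoin A x"
proof -
  show "A \<subseteq> adjoin A x"
  proof
    fix a assume "a \<in> A"
    then show "a \<in> adjoin A x"
      unfolding adjoin_def using is_subringD[OF A]
      by (auto intro!: exI[of _ "[:a:]"] simp: coeff_pCons split: nat.split)
  qed
  show "x \<in> adjoin A x"
    unfolding adjoin_def using is_subringD[OF A]
    by (auto intro!: exI[of _ "[:0, 1:]"] simp: coeff_pCons split: nat.split)
qed

text \<open>A subring of the reals that is maximal among those without \<open>1 / p\<close> is a valuation ring, so a real
number that is not yet known to be algebraic still has a well-defined divisibility by \<open>p\<close>.
Zorn's lemma provides one.\<close>
locale maximal_p_subring =
  fixes p :: nat and A :: "real set"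
  assumes prime_p: "prime p"
    and subring: "is_subring A"
    and inv_p: "1 / real p \<notin> A"
    and maximal: "\<And>B. is_subring B \<Longrightarrow> A \<subseteq> B \<Longrightarrow> 1 / real p \<notin> B \<Longrightarrow> B = A"

lemma exists_maximal_p_subring:
  assumes "prime p"
  shows "\<exists>A. maximal_p_subring p A"
proof -
  let ?S = "{A::real set. is_subring A \<and> 1 / real p \<notin> A}"
  have "\<exists>M\<in>?S. \<forall>X\<in>?S. M \<subseteq> X \<longrightarrow> X = M"
  proof (rule subset_Zorn_nonempty)
    have "1 / real p \<notin> \<int>"
    proof
      assume "1 / real p \<in> \<int>"
      then obtain k :: int where k: "1 / real p = of_int k" by (auto elim: Ints_cases)
      have "p \<ge> 2" using assms by (rule prime_ge_2_nat)
      then have "0 < 1 / real p" "1 / real p < 1" by auto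
      then show False unfolding k by simp
    qed
    moreover have "is_subring (\<int> :: real set)" by (auto simp: is_subring_def)
    ultimately show "?S \<noteq> {}" by blast
  next
    fix C assume C: "C \<noteq> {}" "subset.chain ?S C"
    have mem: "is_subring X \<and> 1 / real p \<notin> X" if "X \<in> C" for X
      using C(2) that by (auto simp: subset.chain_def)
    have "is_subring (\<Union>C)"
      unfolding is_subring_def
    proof (intro conjI ballI)
      show "1 \<in> \<Union>C" using C(1) mem is_subringD(1) by blast
      fix x y assume "x \<in> \<Union>C" "y \<in> \<Union>C"
      then obtain X Y where XY: "x \<in> X" "X \<in> C" "y \<in> Y" "Y \<in> C" by blast
      then have "X \<subseteq> Y \<or> Y \<subseteq> X" using C(2) by (auto simp: subset.chain_def)
      then obtain Z where "Z \<in> C" "x \<in> Z" "y \<in> Z" using XY by blast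
      then show "x - y \<in> \<Union>C" "x * y \<in> \<Union>C" using mem is_subringD(3,4) by blast+
    qed
    then show "\<Union>C \<in> ?S" using mem by auto
  qed
  then obtain A where "A \<in> ?S" "\<forall>X\<in>?S. A \<subseteq> X \<longrightarrow> X = A" by blast
  then have "maximal_p_subring p A" using assms by unfold_locales auto
  then show ?thesis ..
qed

context maximal_p_subring
begin

lemmas ringI = is_subringD[OF subring] is_subring_power[OF subring] is_subring_of_int[OF subring]
  is_subring_of_nat[OF subring]

lemma p_pos: "real p > 0"
  using prime_gt_0_nat[OF prime_p] by simp

lemma adjoin_contains_inv_p:
  assumes "x \<notin> A"
  shows "\<exists>q. (\<forall>i. coeff q i \<in> A) \<and> poly q x = 1 / real p"
proof -
  have "adjoin A x \<noteq> A" using adjoin_extends(2)[OF subring, of x] assms by auto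
  then have "1 / real p \<in> adjoin A x"
    using maximal[OF is_subring_adjoin[OF subring] adjoin_extends(1)[OF subring]] by blast
  then show ?thesis by (auto simp: adjoin_def)
qed

text \<open>If the inverse of \<open>u = 1 + p * a\<close> were missing, adjoining it would produce \<open>1 / p\<close> as a polynomial in
\<open>1 / u\<close>. Clearing denominators puts \<open>u ^ n / p\<close> into \<open>A\<close>, and \<open>u ^ n\<close> is again of the form
\<open>1 + p * b\<close>, so \<open>1 / p\<close> is in \<open>A\<close> already.\<close>
lemma one_plus_multiple_unit:
  assumes a: "a \<in> A"
  shows "1 + real p * a \<noteq> 0" "1 / (1 + real p * a) \<in> A"
proof -
  let ?u = "1 + real p * a"
  show u0: "?u \<noteq> 0"
  proof
    assume "?u = 0"
    then have "1 / real p = - a" using p_pos by (simp add: field_simps)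
    then show False using inv_p ringI(5)[OF a] by simp
  qed
  show "1 / ?u \<in> A"
  proof (rule ccontr)
    assume "1 / ?u \<notin> A"
    then obtain q where q: "\<And>i. coeff q i \<in> A" "poly q (1 / ?u) = 1 / real p"
      using adjoin_contains_inv_p by blast
    define n where "n = degree q"
    have uA: "?u \<in> A" using a by (auto intro!: ringI)
    have "?u ^ n / real p = ?u ^ n * poly q (1 / ?u)" using q by simp
    also have "\<dots> = (\<Sum>i\<le>n. coeff q i * ?u ^ (n - i))"
      unfolding poly_altdef n_def[symmetric] sum_distrib_left
      using u0 by (intro sum.cong) (auto simp: power_diff field_simps)
    also have "\<dots> \<in> A" by (intro is_subring_sum[OF subring] ringI q uA)
    finally have 1: "?u ^ n / real p \<in> A" .
    have "\<exists>b\<in>A. ?u ^ k = 1 + real p * b" for k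
    proof (induction k)
      case 0 then show ?case using ringI(2) by (intro bexI[of _ 0]) auto
    next
      case (Suc k)
      then obtain b where "b \<in> A" "?u ^ k = 1 + real p * b" by blast
      then show ?case using a
        by (intro bexI[of _ "a + b + real p * a * b"]) (auto intro!: ringI simp: algebra_simps)
    qed
    then obtain b where b: "b \<in> A" "?u ^ n = 1 + real p * b" by blast
    have "1 / real p = ?u ^ n / real p - b" using b p_pos by (simp add: field_simps)
    then show False using inv_p ringI(3)[OF 1 b(1)] by simp
  qed
qed

definition span_below :: "nat \<Rightarrow> real \<Rightarrow> real set" where
  "span_below n x = {\<Sum>i<n. a i * x ^ i | a. \<forall>i. a i \<in> A}"

lemma inv_p_in_span_below:
  assumes "x \<notin> A"
  shows "\<exists>n. 1 / real p \<in> span_below n x"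
proof -
  obtain q where q: "\<And>i. coeff q i \<in> A" "poly q x = 1 / real p"
    using adjoin_contains_inv_p[OF assms] by blast
  have "1 / real p = (\<Sum>i<Suc (degree q). coeff q i * x ^ i)"
    using q(2) unfolding poly_altdef by (simp only: lessThan_Suc_atMost)
  then show ?thesis unfolding span_below_def using q(1) by blast
qed

text \<open>An expression of \<open>1 / p\<close> through \<open>1 / x\<close>, divided by the unit that its constant term provides, expresses
\<open>x ^ n\<close> through lower powers; substituting this shortens the expression through \<open>x\<close>.\<close>
lemma span_below_descent:
  assumes x: "x \<noteq> 0" and low: "1 / real p \<in> span_below m (1 / x)" and mn: "m \<le> Suc n"
    and high: "1 / real p \<in> span_below (Suc n) x"
  shows "1 / real p \<in> span_below n x"
proof -
  obtain b where b: "\<And>i. b i \<in> A" "1 / real p = (\<Sum>i<m. b i * (1 / x) ^ i)"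
    using low by (auto simp: span_below_def)
  obtain a where a: "\<And>i. a i \<in> A" "1 / real p = (\<Sum>i<Suc n. a i * x ^ i)"
    using high by (auto simp: span_below_def)
  define B where "B i = (if i < m then b i else 0)" for i
  have BA: "B i \<in> A" for i unfolding B_def using b(1) ringI(2) by auto
  have "(\<Sum>i<m. b i * (1 / x) ^ i) = (\<Sum>i<Suc n. B i * (1 / x) ^ i)"
    using mn by (intro sum.mono_neutral_cong_left) (auto simp: B_def)
  then have B: "1 / real p = B 0 + (\<Sum>i<n. B (Suc i) * (1 / x) ^ Suc i)"
    using b(2) by (simp add: sum.lessThan_Suc_shift del: sum.lessThan_Suc)
  define u where "u = 1 + real p * (- B 0)"
  have u: "u \<noteq> 0" "1 / u \<in> A"
    unfolding u_def using one_plus_multiple_unit[OF ringI(5)[OF BA[of 0]]] by auto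
  have "u = real p * (\<Sum>i<n. B (Suc i) * (1 / x) ^ Suc i)"
    using B p_pos unfolding u_def by (simp add: field_simps)
  then have "x ^ n * u = real p * (\<Sum>i<n. x ^ n * (B (Suc i) * (1 / x) ^ Suc i))"
    by (simp add: sum_distrib_left mult_ac)
  also have "(\<Sum>i<n. x ^ n * (B (Suc i) * (1 / x) ^ Suc i)) = (\<Sum>i<n. B (Suc i) * x ^ (n - Suc i))"
  proof (intro sum.cong refl)
    fix i assume "i \<in> {..<n}"
    then have "x ^ n = x ^ (n - Suc i) * x ^ Suc i" by (simp only: power_add[symmetric]) simp
    then show "x ^ n * (B (Suc i) * (1 / x) ^ Suc i) = B (Suc i) * x ^ (n - Suc i)"
      using x by (simp add: power_one_over)
  qed
  also have "\<dots> = (\<Sum>i<n. B (n - i) * x ^ i)"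
    by (subst sum.nat_diff_reindex[symmetric]) (auto intro!: sum.cong simp: Suc_diff_Suc)
  finally have "x ^ n = real p * (1 / u) * (\<Sum>i<n. B (n - i) * x ^ i)"
    using u(1) by (simp add: field_simps)
  then have xn: "x ^ n = (\<Sum>i<n. (real p * (1 / u) * B (n - i)) * x ^ i)"
    by (simp only: sum_distrib_left mult.assoc)
  have "1 / real p = (\<Sum>i<n. a i * x ^ i) + a n * x ^ n" using a(2) by simp
  also have "\<dots> = (\<Sum>i<n. (a i + a n * (real p * (1 / u) * B (n - i))) * x ^ i)"
    by (subst xn) (simp add: sum_distrib_left sum.distrib algebra_simps)
  finally have e: "1 / real p = (\<Sum>i<n. (a i + a n * (real p * (1 / u) * B (n - i))) * x ^ i)" .
  have "\<forall>i. a i + a n * (real p * (1 / u) * B (n - i)) \<in> A"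
    by (intro allI ringI a(1) BA u(2))
  with e show ?thesis unfolding span_below_def
    by (intro CollectI exI[of _ "\<lambda>i. a i + a n * (real p * (1 / u) * B (n - i))"] conjI)
qed

text \<open>If \<open>x\<close> and \<open>1 / x\<close> were both missing, take expressions of \<open>1 / p\<close> of least length through either of
them. The longer one can be shortened.\<close>
lemma valuation_ring: "x \<in> A \<or> 1 / x \<in> A"
proof (rule ccontr)
  assume "\<not> (x \<in> A \<or> 1 / x \<in> A)"
  then have x: "x \<notin> A" "1 / x \<notin> A" by auto
  then have x0: "x \<noteq> 0" using ringI(2) by auto
  define n where "n = (LEAST n. 1 / real p \<in> span_below n x)"
  define m where "m = (LEAST n. 1 / real p \<in> span_below n (1 / x))"
  have n: "1 / real p \<in> span_below n x" unfolding n_def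
    using inv_p_in_span_below[OF x(1)] by (rule LeastI_ex)
  have m: "1 / real p \<in> span_below m (1 / x)" unfolding m_def
    using inv_p_in_span_below[OF x(2)] by (rule LeastI_ex)
  have "1 / real p \<notin> span_below 0 y" for y using p_pos by (simp add: span_below_def)
  then have nz: "n \<noteq> 0" "m \<noteq> 0" using n m by metis+
  show False
  proof (cases "m \<le> n")
    case True
    then obtain n' where n': "n = Suc n'" using nz by (cases n) auto
    have "1 / real p \<in> span_below n' x"
      using span_below_descent[OF x0 m] True n by (simp add: n')
    then have "n \<le> n'" unfolding n_def by (rule Least_le)
    then show False using n' by simp
  next
    case False
    then obtain m' where m': "m = Suc m'" using nz by (cases m) auto
    have "1 / real p \<in> span_below m' (1 / x)"
      using span_below_descent[of "1 / x" n m'] False n m x0 by (simp add: m')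
    then have "m \<le> m'" unfolding m_def by (rule Least_le)
    then show False using m' by simp
  qed
qed

definition nonunits :: "real set" where
  "nonunits = {x \<in> A. x = 0 \<or> 1 / x \<notin> A}"

lemma nonunitsD: "x \<in> nonunits \<Longrightarrow> x \<in> A"
  by (simp add: nonunits_def)

lemma nonunits_mult: "x \<in> A \<Longrightarrow> y \<in> nonunits \<Longrightarrow> x * y \<in> nonunits"
proof (cases "x * y = 0")
  assume xy: "x \<in> A" "y \<in> nonunits" and nz: "x * y \<noteq> 0"
  have "1 / (x * y) \<notin> A"
  proof
    assume "1 / (x * y) \<in> A"
    then have "x * (1 / (x * y)) \<in> A" using xy(1) by (rule ringI(4)[rotated])
    then have "1 / y \<in> A" using nz by simp
    then show False using xy(2) nz by (auto simp: nonunits_def)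
  qed
  then show ?thesis using xy by (auto simp: nonunits_def intro!: ringI)
qed (auto simp: nonunits_def ringI)

lemma nonunits_add:
  assumes "x \<in> nonunits" "y \<in> nonunits"
  shows "x + y \<in> nonunits"
proof -
  have *: "x + y \<in> nonunits" if "x \<in> nonunits" "y \<in> nonunits" "x / y \<in> A" "y \<noteq> 0" for x y
  proof -
    have "(x / y + 1) * y \<in> nonunits" using that by (intro nonunits_mult ringI) auto
    also have "(x / y + 1) * y = x + y" using that by (simp add: distrib_right)
    finally show ?thesis .
  qed
  show ?thesis
  proof (cases "x = 0 \<or> y = 0")
    case False
    then show ?thesis using valuation_ring[of "x / y"] *[of x y] *[of y x] assms by (auto simp: add.commute)
  qed (use assms in auto)
qed

lemma nonunits_minus: "x \<in> nonunits \<Longrightarrow> - x \<in> nonunits"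
  using nonunits_mult[of "-1" x] by (auto intro: ringI)

lemma nonunits_diff: "x \<in> nonunits \<Longrightarrow> y \<in> nonunits \<Longrightarrow> x - y \<in> nonunits"
  using nonunits_add[of x "- y"] nonunits_minus by auto

lemma nonunits_sum: "(\<And>i. i \<in> I \<Longrightarrow> h i \<in> nonunits) \<Longrightarrow> sum h I \<in> nonunits"
proof (induction I rule: infinite_finite_induct)
  case (insert i I)
  then show ?case by (auto intro: nonunits_add)
qed (auto simp: nonunits_def ringI)

lemma one_not_nonunit: "1 \<notin> nonunits"
  by (simp add: nonunits_def ringI)

lemma unit_not_nonunit: "x \<noteq> 0 \<Longrightarrow> 1 / x \<in> A \<Longrightarrow> x \<notin> nonunits"
  by (simp add: nonunits_def)

lemma of_int_nonunit_iff: "real_of_int n \<in> nonunits \<longleftrightarrow> int p dvd n"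
proof
  have pN: "real p \<in> nonunits" using inv_p by (auto simp: nonunits_def ringI)
  show "int p dvd n \<Longrightarrow> real_of_int n \<in> nonunits"
    using nonunits_mult[OF _ pN] by (auto elim!: dvdE simp: mult.commute ringI)
  assume n: "real_of_int n \<in> nonunits"
  show "int p dvd n"
  proof (rule ccontr)
    assume "\<not> int p dvd n"
    then have "coprime (int p) n" using prime_p by (simp add: prime_imp_coprime)
    then obtain u v where uv: "u * int p + v * n = 1"
      using bezout_int[of "int p" n] by (auto simp: coprime_iff_gcd_eq_1)
    have "of_int u * real p + of_int v * of_int n \<in> nonunits"
      using n pN by (intro nonunits_add nonunits_mult) (auto intro: ringI)
    also have "of_int u * real p + of_int v * of_int n = real_of_int (u * int p + v * n)" by simp
    finally show False using uv one_not_nonunit by simp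
  qed
qed

lemma of_int_unit: "\<not> int p dvd n \<Longrightarrow> 1 / real_of_int n \<in> A"
  using of_int_nonunit_iff[of n] by (auto simp: nonunits_def ringI)

end

context maximal_p_subring
begin

lemma power_nonunit: "r \<in> nonunits \<Longrightarrow> k > 0 \<Longrightarrow> r ^ k \<in> nonunits"
  using nonunits_mult[of "r ^ (k - 1)" r] by (cases k) (auto intro: ringI nonunitsD simp: mult.commute)

lemma multiple_nonunit: "x \<in> nonunits \<Longrightarrow> x * real_of_int n \<in> nonunits"
  using nonunits_mult[of "real_of_int n" x] by (simp add: ringI mult.commute)

text \<open>A monic relation of degree \<open>N\<close> modulo the maximal ideal reduces all powers to those below \<open>N\<close>. As integers matter
only modulo \<open>p\<close>, finitely many residues are left.\<close>
lemma powers_reduce: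
  assumes r: "r \<in> A" and rel: "r ^ N - (\<Sum>i<N. real_of_int (e i) * r ^ i) \<in> nonunits"
  shows "\<exists>c. r ^ k - (\<Sum>i<N. real_of_int (c i) * r ^ i) \<in> nonunits"
proof (induction k)
  case 0
  obtain M where M: "N = Suc M" using rel one_not_nonunit by (cases N) auto
  have "(\<Sum>i<N. real_of_int (if i = 0 then 1 else 0) * r ^ i) = 1"
    unfolding M sum.lessThan_Suc_shift by simp
  then show ?case by (intro exI[of _ "\<lambda>i. if i = 0 then 1 else 0"]) (auto simp: nonunits_def ringI)
next
  case (Suc k)
  then obtain c where c: "r ^ k - (\<Sum>i<N. real_of_int (c i) * r ^ i) \<in> nonunits" by blast
  obtain M where M: "N = Suc M" using rel one_not_nonunit by (cases N) auto
  define c' where "c' i = (if i = 0 then 0 else c (i - 1)) + c M * e i" for i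
  have "(\<Sum>i<N. real_of_int (c' i) * r ^ i)
      = (\<Sum>i<N. real_of_int (if i = 0 then 0 else c (i - 1)) * r ^ i)
        + real_of_int (c M) * (\<Sum>i<N. real_of_int (e i) * r ^ i)"
    unfolding c'_def by (simp add: sum.distrib sum_distrib_left algebra_simps)
  also have "(\<Sum>i<N. real_of_int (if i = 0 then 0 else c (i - 1)) * r ^ i)
      = r * (\<Sum>i<M. real_of_int (c i) * r ^ i)"
    unfolding M sum.lessThan_Suc_shift by (simp add: sum_distrib_left algebra_simps)
  finally have "r ^ Suc k - (\<Sum>i<N. real_of_int (c' i) * r ^ i)
      = r * (r ^ k - (\<Sum>i<N. real_of_int (c i) * r ^ i))
        + real_of_int (c M) * (r ^ N - (\<Sum>i<N. real_of_int (e i) * r ^ i))"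
    unfolding M by (simp add: algebra_simps)
  also have "\<dots> \<in> nonunits"
    using c rel r by (intro nonunits_add nonunits_mult) (auto intro: ringI)
  finally show ?case by blast
qed

lemma reduce_coefficients:
  assumes r: "r \<in> A"
  shows "(\<Sum>i<N. real_of_int (c i) * r ^ i) - (\<Sum>i<N. real_of_int (c i mod int p) * r ^ i) \<in> nonunits"
proof -
  have "(\<Sum>i<N. real_of_int (c i) * r ^ i) - (\<Sum>i<N. real_of_int (c i mod int p) * r ^ i)
      = (\<Sum>i<N. r ^ i * real_of_int (c i - c i mod int p))"
    by (simp add: sum_subtractf[symmetric] algebra_simps)
  also have "\<dots> \<in> nonunits"
    using r by (intro nonunits_sum nonunits_mult) (auto intro: ringI simp: of_int_nonunit_iff simp del: of_int_diff)
  finally show ?thesis .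
qed

text \<open>The relation between the three differences of a triangle becomes monic after multiplication by an inverse
modulo \<open>p\<close> of its top coefficient. That coefficient is prime to \<open>p\<close> even when two of the terms share
the top power, because the third term is a unit.\<close>
lemma relation_reduces:
  assumes r: "r \<in> A" and r0: "r \<noteq> 0" and r': "1 / r \<in> A"
    and rel: "r ^ k * real_of_int \<alpha> + r ^ l * real_of_int \<beta> = r ^ n * real_of_int \<gamma>"
    and nd: "\<not> int p dvd \<alpha>" "\<not> int p dvd \<beta>" "\<not> int p dvd \<gamma>"
    and ne: "\<not> (k = l \<and> l = n)"
  shows "\<exists>N e. r ^ N - (\<Sum>i<N. real_of_int (e i) * r ^ i) \<in> nonunits"
proof -
  \<comment> \<open>It suffices to find a relation with a unique top power whose coefficient is prime to \<open>p\<close>.\<close>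
  have reduce: ?thesis
    if m: "\<not> int p dvd m" "a < N" "b < N"
      "r ^ N * real_of_int m = r ^ a * real_of_int s + r ^ b * real_of_int t" for N m a b s t
  proof -
    have "coprime (int p) m" using m(1) prime_p by (simp add: prime_imp_coprime)
    then have "coprime m (int p)" by (simp add: coprime_commute)
    then obtain u v where uv: "u * m + v * int p = 1"
      using bezout_int[of m "int p"] by (auto simp: coprime_iff_gcd_eq_1)
    define e where "e i = (if i = a then u * s else 0) + (if i = b then u * t else 0)" for i
    have "(\<Sum>i<N. real_of_int (e i) * r ^ i)
        = real_of_int u * (r ^ a * real_of_int s + r ^ b * real_of_int t)"
      using m(2,3) by (simp add: e_def distrib_right if_distrib[of real_of_int] if_distribR
          sum.distrib sum.delta algebra_simps if_distrib[of "\<lambda>x. x * _"] if_distrib[of "\<lambda>x. _ * x"] cong: if_cong)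
    then have "r ^ N - (\<Sum>i<N. real_of_int (e i) * r ^ i) = r ^ N * (1 - real_of_int (u * m))"
      unfolding m(4)[symmetric] by (simp add: algebra_simps)
    also have "1 - real_of_int (u * m) = real_of_int (v * int p)"
      using uv by (metis add_diff_cancel_left' of_int_1 of_int_diff)
    also have "r ^ N * real_of_int (v * int p) \<in> nonunits"
      using r by (intro nonunits_mult ringI) (auto simp: of_int_nonunit_iff simp del: of_int_mult)
    finally show ?thesis by blast
  qed
  have unit: "r ^ i * real_of_int m \<notin> nonunits" if "\<not> int p dvd m" for i m
  proof (rule unit_not_nonunit)
    have "m \<noteq> 0" using that by auto
    then show "r ^ i * real_of_int m \<noteq> 0" using r0 by simp
    have "(1 / r) ^ i * (1 / real_of_int m) \<in> A" using that r' by (intro ringI of_int_unit)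
    then show "1 / (r ^ i * real_of_int m) \<in> A" by (simp add: power_one_over)
  qed
  have sum_unit: "\<not> int p dvd \<alpha> + \<beta>" if "k = l"
  proof
    assume "int p dvd \<alpha> + \<beta>"
    then have "r ^ k * real_of_int (\<alpha> + \<beta>) \<in> nonunits"
      using r by (intro nonunits_mult ringI) (auto simp: of_int_nonunit_iff simp del: of_int_add)
    then show False using rel that unit[OF nd(3)] by (simp add: algebra_simps)
  qed
  have diff_unit: "\<not> int p dvd x" if "r ^ i * real_of_int x = r ^ j * real_of_int y" "\<not> int p dvd y" for x y i j
    using unit[OF that(2), of j] that(1) r
    by (metis nonunits_mult of_int_nonunit_iff ringI(7))
  consider "k < n" "l < n" | "k < l" "n < l" | "l < k" "n < k" | "k = l" "n < k" | "k = n" "l < n" | "l = n" "k < n"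
    using ne by linarith
  then show ?thesis
  proof cases
    case 1
    show ?thesis by (rule reduce[OF nd(3) 1 rel[symmetric]])
  next
    case 2
    have "r ^ l * real_of_int \<beta> = r ^ k * real_of_int (- \<alpha>) + r ^ n * real_of_int \<gamma>" using rel by simp
    then show ?thesis by (rule reduce[OF nd(2) 2])
  next
    case 3
    have "r ^ k * real_of_int \<alpha> = r ^ l * real_of_int (- \<beta>) + r ^ n * real_of_int \<gamma>" using rel by simp
    then show ?thesis by (rule reduce[OF nd(1) 3])
  next
    case 4
    have "r ^ k * real_of_int (\<alpha> + \<beta>) = r ^ n * real_of_int 0 + r ^ n * real_of_int \<gamma>"
      using rel 4(1) by (simp add: distrib_left)
    then show ?thesis by (rule reduce[OF sum_unit[OF 4(1)] 4(2) 4(2)])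
  next
    case 5
    have e: "r ^ n * real_of_int (\<gamma> - \<alpha>) = r ^ l * real_of_int \<beta>"
      using rel unfolding 5(1) of_int_diff right_diff_distrib by linarith
    then have "r ^ n * real_of_int (\<gamma> - \<alpha>) = r ^ l * real_of_int 0 + r ^ l * real_of_int \<beta>" by (simp only: of_int_0 mult_zero_right add_0)
    then show ?thesis by (rule reduce[OF diff_unit[OF e nd(2)] 5(2) 5(2)])
  next
    case 6
    have e: "r ^ n * real_of_int (\<gamma> - \<beta>) = r ^ k * real_of_int \<alpha>"
      using rel unfolding 6(1) of_int_diff right_diff_distrib by linarith
    then have "r ^ n * real_of_int (\<gamma> - \<beta>) = r ^ k * real_of_int 0 + r ^ k * real_of_int \<alpha>" by (simp only: of_int_0 mult_zero_right add_0)
    then show ?thesis by (rule reduce[OF diff_unit[OF e nd(1)] 6(2) 6(2)])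
  qed
qed

end

section \<open>Sets of points whose differences have levels\<close>

text \<open>The example to keep in mind is a spectrum, projected to a line by \<open>\<phi>\<close>: two of its points have level \<open>k\<close>
if the \<open>k\<close>-th factor of the infinite product for the Fourier transform vanishes at their difference.
A pair may a priori have several levels.\<close>
locale difference_levels =
  fixes p :: nat and r :: real and \<Lambda> :: "'a set" and \<phi> :: "'a \<Rightarrow> real"
    and Lev :: "nat \<Rightarrow> 'a \<Rightarrow> 'a \<Rightarrow> bool"
  assumes prime_p: "prime p" and r_gt_1: "r > 1"
    and Lev_form: "\<And>k x y. Lev k x y \<Longrightarrow> \<exists>\<alpha>. \<not> int p dvd \<alpha> \<and> \<phi> x - \<phi> y = r ^ k * real_of_int \<alpha>"
    and Lev_sym: "\<And>k x y. Lev k x y \<Longrightarrow> Lev k y x"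
    and Lev_total: "\<And>x y. x \<in> \<Lambda> \<Longrightarrow> y \<in> \<Lambda> \<Longrightarrow> x \<noteq> y \<Longrightarrow> \<exists>k\<ge>1. Lev k x y"
    and Lev_occurs: "\<And>k. k \<ge> 1 \<Longrightarrow> \<exists>x\<in>\<Lambda>. \<exists>y\<in>\<Lambda>. x \<noteq> y \<and> Lev k x y"
begin

lemma Lev_diff_ge:
  assumes "Lev k x y"
  shows "\<bar>\<phi> x - \<phi> y\<bar> \<ge> r ^ k"
proof -
  obtain \<alpha> where a: "\<not> int p dvd \<alpha>" "\<phi> x - \<phi> y = r ^ k * real_of_int \<alpha>" using Lev_form[OF assms] by blast
  have "\<alpha> \<noteq> 0" using a(1) by auto
  then have "1 \<le> \<bar>real_of_int \<alpha>\<bar>" by linarith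
  then have "r ^ k * 1 \<le> r ^ k * \<bar>real_of_int \<alpha>\<bar>" using r_gt_1 by (intro mult_left_mono) auto
  then show ?thesis using a r_gt_1 by (simp add: abs_mult)
qed

lemma power_exceeds: "\<exists>n>k. r ^ n > (B::real)"
proof -
  obtain m where "B < r ^ m" using real_arch_pow[OF r_gt_1] by blast
  also have "r ^ m \<le> r ^ (max m (Suc k))" using r_gt_1 by (intro power_increasing) auto
  finally show ?thesis by (intro exI[of _ "max m (Suc k)"]) auto
qed

lemma infinite_\<Lambda>: "infinite \<Lambda>"
proof
  assume fin: "finite \<Lambda>"
  define B where "B = (\<Sum>x\<in>\<Lambda>. \<Sum>y\<in>\<Lambda>. \<bar>\<phi> x - \<phi> y\<bar>)"
  obtain n where n: "n > 0" "r ^ n > B" using power_exceeds by blast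
  then obtain x y where xy: "x \<in> \<Lambda>" "y \<in> \<Lambda>" "Lev n x y" using Lev_occurs[of n] by auto
  have "\<bar>\<phi> x - \<phi> y\<bar> \<le> (\<Sum>y\<in>\<Lambda>. \<bar>\<phi> x - \<phi> y\<bar>)"
    using fin xy by (intro member_le_sum) auto
  also have "\<dots> \<le> B" unfolding B_def
    using fin xy by (intro member_le_sum[where f = "\<lambda>x. \<Sum>y\<in>\<Lambda>. \<bar>\<phi> x - \<phi> y\<bar>"] sum_nonneg) auto
  finally show False using Lev_diff_ge[OF xy(3)] n by linarith
qed

text \<open>If \<open>r\<close> were a unit, all the differences would be units, so \<open>\<Lambda>\<close> would inject into the residue
  field; a relation between three differences makes the residues of the powers of \<open>r\<close> finite in
  number, and without such a relation all differences lie on one level.\<close>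

lemma ratio_not_unit:
  assumes "maximal_p_subring p A" "r \<in> A"
  shows "1 / r \<notin> A"
proof
  interpret maximal_p_subring p A by fact
  assume r': "1 / r \<in> A"
  have r0: "r \<noteq> 0" using r_gt_1 by auto
  have unit: "r ^ i * real_of_int m \<notin> nonunits" if "\<not> int p dvd m" for i m
  proof (rule unit_not_nonunit)
    have "m \<noteq> 0" using that by auto
    then show "r ^ i * real_of_int m \<noteq> 0" using r0 by simp
    have "(1 / r) ^ i * (1 / real_of_int m) \<in> A" using that r' by (intro ringI of_int_unit)
    then show "1 / (r ^ i * real_of_int m) \<in> A" by (simp add: power_one_over)
  qed
  have dif: "\<phi> x - \<phi> y \<notin> nonunits" if xy: "x \<in> \<Lambda>" "y \<in> \<Lambda>" "x \<noteq> y" for x y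
    using Lev_total[OF xy] Lev_form unit by metis
  obtain x0 where x0: "x0 \<in> \<Lambda>" using infinite_\<Lambda> by (metis finite.emptyI ex_in_conv)
  have "\<exists>k \<alpha>. \<not> int p dvd \<alpha> \<and> \<phi> x - \<phi> x0 = r ^ k * real_of_int \<alpha>" if "x \<in> \<Lambda> - {x0}" for x
    using Lev_total[of x x0] Lev_form that x0 by (metis DiffD1 DiffD2 singletonI)
  then obtain \<kappa> \<alpha> where ka: "\<And>x. x \<in> \<Lambda> - {x0} \<Longrightarrow> \<not> int p dvd \<alpha> x"
      "\<And>x. x \<in> \<Lambda> - {x0} \<Longrightarrow> \<phi> x - \<phi> x0 = r ^ \<kappa> x * real_of_int (\<alpha> x)"
    by metis
  have "finite (\<Lambda> - {x0})"
  proof (cases "\<exists>N e. r ^ N - (\<Sum>i<N. real_of_int (e i) * r ^ i) \<in> nonunits")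
    case True
    then obtain N e where Ne: "r ^ N - (\<Sum>i<N. real_of_int (e i) * r ^ i) \<in> nonunits" by blast
    have "\<exists>c. \<forall>k. r ^ k - (\<Sum>i<N. real_of_int (c k i) * r ^ i) \<in> nonunits"
      using powers_reduce[OF assms(2) Ne] by metis
    then obtain c where c: "\<And>k. r ^ k - (\<Sum>i<N. real_of_int (c k i) * r ^ i) \<in> nonunits" by blast
    define h where "h x = (\<lambda>i\<in>{..<N}. (c (\<kappa> x) i * \<alpha> x) mod int p)" for x
    have h: "\<phi> x - \<phi> x0 - (\<Sum>i<N. real_of_int (h x i) * r ^ i) \<in> nonunits" if x: "x \<in> \<Lambda> - {x0}" for x
    proof -
      have "\<phi> x - \<phi> x0 - (\<Sum>i<N. real_of_int (c (\<kappa> x) i * \<alpha> x) * r ^ i)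
          = (r ^ \<kappa> x - (\<Sum>i<N. real_of_int (c (\<kappa> x) i) * r ^ i)) * real_of_int (\<alpha> x)"
        unfolding ka(2)[OF x] by (simp add: left_diff_distrib right_diff_distrib sum_distrib_right sum_distrib_left mult_ac)
      then have "\<phi> x - \<phi> x0 - (\<Sum>i<N. real_of_int (c (\<kappa> x) i * \<alpha> x) * r ^ i) \<in> nonunits"
        using multiple_nonunit[OF c] by metis
      from nonunits_add[OF this reduce_coefficients[OF assms(2), of "\<lambda>i. c (\<kappa> x) i * \<alpha> x" N]]
      show ?thesis by (simp add: h_def algebra_simps)
    qed
    have "inj_on h (\<Lambda> - {x0})"
    proof (rule inj_onI, rule ccontr)
      fix x y assume xy: "x \<in> \<Lambda> - {x0}" "y \<in> \<Lambda> - {x0}" "h x = h y" "x \<noteq> y"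
      have "\<phi> x - \<phi> y \<in> nonunits" using nonunits_diff[OF h[OF xy(1)] h[OF xy(2)]] xy(3) by simp
      then show False using dif xy by auto
    qed
    moreover have "h ` (\<Lambda> - {x0}) \<subseteq> ({..<N} \<rightarrow>\<^sub>E {0..<int p})"
      using prime_gt_0_nat[OF prime_p] by (auto simp: h_def split: if_splits)
    ultimately show ?thesis
      by (meson finite_PiE finite_atLeastLessThan_int finite_lessThan finite_imageD finite_subset)
  next
    case False
    have lev: "\<kappa> x = \<kappa> y" if xy: "x \<in> \<Lambda> - {x0}" "y \<in> \<Lambda> - {x0}" for x y
    proof (cases "x = y")
      case ne: False
      then obtain k \<gamma> where k: "\<not> int p dvd \<gamma>" "\<phi> x - \<phi> y = r ^ k * real_of_int \<gamma>"
        using Lev_total[of x y] Lev_form xy by (metis DiffD1)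
      have "r ^ k * real_of_int \<gamma> + r ^ \<kappa> y * real_of_int (\<alpha> y) = r ^ \<kappa> x * real_of_int (\<alpha> x)"
        using k(2) ka(2)[OF xy(1)] ka(2)[OF xy(2)] by linarith
      from relation_reduces[OF assms(2) r0 r' this k(1) ka(1)[OF xy(2)] ka(1)[OF xy(1)]] False
      show ?thesis by metis
    qed auto
    have "inj_on (\<lambda>x. \<alpha> x mod int p) (\<Lambda> - {x0})"
    proof (rule inj_onI, rule ccontr)
      fix x y assume xy: "x \<in> \<Lambda> - {x0}" "y \<in> \<Lambda> - {x0}" "\<alpha> x mod int p = \<alpha> y mod int p" "x \<noteq> y"
      have "\<phi> x - \<phi> y = r ^ \<kappa> x * real_of_int (\<alpha> x - \<alpha> y)"
        using ka(2)[OF xy(1)] ka(2)[OF xy(2)] lev[OF xy(1,2)] by (simp add: algebra_simps)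
      also have "\<dots> \<in> nonunits"
        using xy(3) assms(2) by (intro nonunits_mult)
          (auto simp: of_int_nonunit_iff mod_eq_dvd_iff intro: ringI simp del: of_int_diff)
      finally show False using dif xy by auto
    qed
    moreover have "(\<lambda>x. \<alpha> x mod int p) ` (\<Lambda> - {x0}) \<subseteq> {0..<int p}"
      using prime_gt_0_nat[OF prime_p] by auto
    ultimately show ?thesis by (meson finite_atLeastLessThan_int finite_imageD finite_subset)
  qed
  then show False using infinite_\<Lambda> by simp
qed

text \<open>With \<open>1 / r\<close> divisible by \<open>p\<close>, the largest level in a triangle occurs twice. Fix two points and let a
third move to arbitrarily high level over one of them; it then has that same high level over the other,
so the distance of the two fixed points is a nonzero multiple of a large power of \<open>r\<close>, which exceeds it.\<close>
lemma inverse_ratio_not_nonunit: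
  assumes "maximal_p_subring p A"
  shows "1 / r \<notin> maximal_p_subring.nonunits A"
proof
  interpret maximal_p_subring p A by fact
  assume s: "1 / r \<in> nonunits"
  have r0: "r > 0" using r_gt_1 by auto
  \<comment> \<open>The largest of the three levels of a triangle cannot be attained only once.\<close>
  have top: False if "r ^ n * real_of_int \<alpha> = r ^ a * real_of_int \<beta> + r ^ b * real_of_int \<gamma>"
    "a < n" "b < n" "\<not> int p dvd \<alpha>" for n a b \<alpha> \<beta> \<gamma>
  proof -
    have d: "r ^ j / r ^ n = (1 / r) ^ (n - j)" if "j < n" for j
      using that r0 by (simp add: power_one_over power_diff)
    have "real_of_int \<alpha> = (r ^ a / r ^ n) * real_of_int \<beta> + (r ^ b / r ^ n) * real_of_int \<gamma>"
      using that(1) r0 by (simp add: field_simps)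
    also have "\<dots> \<in> nonunits"
      using that(2,3) d s by (auto intro!: nonunits_add multiple_nonunit power_nonunit)
    finally show False using that(4) by (simp add: of_int_nonunit_iff)
  qed
  obtain x0 where x0: "x0 \<in> \<Lambda>" using infinite_\<Lambda> by (metis finite.emptyI ex_in_conv)
  obtain x1 where x1: "x1 \<in> \<Lambda>" "x1 \<noteq> x0"
    using infinite_\<Lambda> x0 by (metis finite.emptyI finite_insert finite_subset insertI1 subsetI)
  obtain k1 \<alpha>1 where k1: "\<not> int p dvd \<alpha>1" "\<phi> x1 - \<phi> x0 = r ^ k1 * real_of_int \<alpha>1"
    using Lev_total[OF x1(1) x0 x1(2)] Lev_form by metis
  obtain n where n: "n > k1" "r ^ n > \<bar>\<phi> x1 - \<phi> x0\<bar>" using power_exceeds by blast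
  obtain u v where uv: "u \<in> \<Lambda>" "v \<in> \<Lambda>" "u \<noteq> v" "Lev n u v" using Lev_occurs[of n] n by auto
  have "\<exists>w\<in>\<Lambda>. \<exists>l\<ge>n. Lev l w x0"
  proof (cases "u = x0 \<or> v = x0")
    case True then show ?thesis using uv Lev_sym by blast
  next
    case False
    then obtain a b where ab: "Lev a u x0" "Lev b v x0" using Lev_total x0 uv by metis
    then obtain \<beta> \<gamma> where bg: "\<phi> u - \<phi> x0 = r ^ a * real_of_int \<beta>" "\<phi> v - \<phi> x0 = r ^ b * real_of_int \<gamma>"
      using Lev_form by metis
    obtain \<alpha> where al: "\<not> int p dvd \<alpha>" "\<phi> u - \<phi> v = r ^ n * real_of_int \<alpha>" using Lev_form[OF uv(4)] by blast
    have "r ^ n * real_of_int \<alpha> = r ^ a * real_of_int \<beta> + r ^ b * real_of_int (- \<gamma>)"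
      using al(2) bg by simp
    then have "\<not> (a < n \<and> b < n)" using top al(1) by blast
    then show ?thesis using ab uv by (meson not_le)
  qed
  then obtain w l where w: "w \<in> \<Lambda>" "l \<ge> n" "Lev l w x0" by blast
  have rl: "r ^ l \<ge> r ^ n" using r_gt_1 w by (intro power_increasing) auto
  have "w \<noteq> x1" using Lev_diff_ge[OF w(3)] rl n by auto
  then obtain t where t: "Lev t w x1" using Lev_total w x1 by metis
  obtain \<beta> where be: "\<not> int p dvd \<beta>" "\<phi> w - \<phi> x0 = r ^ l * real_of_int \<beta>" using Lev_form[OF w(3)] by blast
  obtain \<gamma> where ga: "\<not> int p dvd \<gamma>" "\<phi> w - \<phi> x1 = r ^ t * real_of_int \<gamma>" using Lev_form[OF t] by blast
  have "r ^ l * real_of_int \<beta> = r ^ t * real_of_int \<gamma> + r ^ k1 * real_of_int \<alpha>1"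
    using be ga k1 by simp
  then have "\<not> t < l" using top[of l \<beta> t \<gamma> k1 \<alpha>1] be(1) n w by auto
  moreover have "r ^ t * real_of_int \<gamma> = r ^ l * real_of_int \<beta> + r ^ k1 * real_of_int (- \<alpha>1)"
    using be ga k1 by simp
  then have "\<not> l < t" using top[of t \<gamma> l \<beta> k1 "- \<alpha>1"] ga(1) n w by auto
  ultimately have "t = l" by simp
  then have eq: "\<phi> x1 - \<phi> x0 = r ^ l * real_of_int (\<beta> - \<gamma>)" using be ga by (simp add: algebra_simps)
  have "\<alpha>1 \<noteq> 0" using k1 by auto
  then have "\<phi> x1 - \<phi> x0 \<noteq> 0" using k1(2) r0 by simp
  then have "\<beta> - \<gamma> \<noteq> 0" unfolding eq by (auto simp del: of_int_diff)
  then have "1 \<le> \<bar>real_of_int (\<beta> - \<gamma>)\<bar>" by linarith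
  then have "r ^ l * 1 \<le> r ^ l * \<bar>real_of_int (\<beta> - \<gamma>)\<bar>" using r0 by (intro mult_left_mono) auto
  then have "r ^ l \<le> \<bar>\<phi> x1 - \<phi> x0\<bar>" unfolding eq using r0 by (simp add: abs_mult)
  then show False using rl n by linarith
qed

text \<open>With \<open>r\<close> divisible by \<open>p\<close>, the smallest level in a triangle occurs twice. Hence each point has
level one over one of the two ends of any pair of level one, and a point at level one from \<open>x\<close> is at level
one from every \<open>y\<close> whose level over \<open>x\<close> is higher.\<close>
lemma level_one_witness:
  assumes "maximal_p_subring p A" "r \<in> maximal_p_subring.nonunits A" "x \<in> \<Lambda>"
  shows "\<exists>w\<in>\<Lambda>. Lev 1 x w"
    and "y \<in> \<Lambda> \<Longrightarrow> x \<noteq> y \<Longrightarrow> \<not> Lev 1 x y \<Longrightarrow> \<exists>w\<in>\<Lambda>. Lev 1 x w \<and> Lev 1 y w"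
proof -
  interpret maximal_p_subring p A by fact
  \<comment> \<open>The smallest of the three levels of a triangle cannot be attained only once.\<close>
  have bottom: False if "r * real_of_int \<alpha> = r ^ a * real_of_int \<beta> + r ^ b * real_of_int \<gamma>"
    "1 < a" "1 < b" "\<not> int p dvd \<alpha>" for a b \<alpha> \<beta> \<gamma>
  proof -
    have e: "r ^ a = r * r ^ (a - 1)" "r ^ b = r * r ^ (b - 1)"
      using that by (simp_all flip: power_Suc)
    have "r * real_of_int \<alpha> = r * (r ^ (a - 1) * real_of_int \<beta> + r ^ (b - 1) * real_of_int \<gamma>)"
      using that(1) unfolding e by (simp add: algebra_simps)
    then have "real_of_int \<alpha> = r ^ (a - 1) * real_of_int \<beta> + r ^ (b - 1) * real_of_int \<gamma>"
      using r_gt_1 by simp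
    also have "\<dots> \<in> nonunits"
      using that(2,3) assms(2) by (auto intro!: nonunits_add multiple_nonunit power_nonunit)
    finally show False using that(4) by (simp add: of_int_nonunit_iff)
  qed
  obtain u v where uv: "u \<in> \<Lambda>" "v \<in> \<Lambda>" "u \<noteq> v" "Lev 1 u v" using Lev_occurs[of 1] by auto
  show one: "\<exists>w\<in>\<Lambda>. Lev 1 x w"
  proof (cases "x = u \<or> x = v")
    case True then show ?thesis using uv Lev_sym by blast
  next
    case False
    then obtain a b where ab: "a \<ge> 1" "Lev a x u" "b \<ge> 1" "Lev b x v" using Lev_total assms(3) uv by metis
    then obtain \<beta> \<gamma> where bg: "\<phi> x - \<phi> u = r ^ a * real_of_int \<beta>" "\<phi> x - \<phi> v = r ^ b * real_of_int \<gamma>"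
      using Lev_form by metis
    obtain \<alpha> where al: "\<not> int p dvd \<alpha>" "\<phi> u - \<phi> v = r ^ 1 * real_of_int \<alpha>" using Lev_form[OF uv(4)] by blast
    have "r * real_of_int \<alpha> = r ^ a * real_of_int (- \<beta>) + r ^ b * real_of_int \<gamma>"
      using al(2) bg by simp
    then have "\<not> (1 < a \<and> 1 < b)" using bottom al(1) by blast
    then have "a = 1 \<or> b = 1" using ab by linarith
    then show ?thesis using ab uv by blast
  qed
  assume y: "y \<in> \<Lambda>" "x \<noteq> y" "\<not> Lev 1 x y"
  obtain w where w: "w \<in> \<Lambda>" "Lev 1 x w" using one by blast
  obtain k where k: "k \<ge> 1" "Lev k x y" using Lev_total[OF assms(3) y(1,2)] by blast
  then have k2: "k > 1" using y(3) by (cases "k = 1") auto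
  have "y \<noteq> w" using w y by auto
  then obtain t where t: "t \<ge> 1" "Lev t y w" using Lev_total y w by metis
  obtain \<alpha> where al: "\<phi> x - \<phi> y = r ^ k * real_of_int \<alpha>" using Lev_form[OF k(2)] by blast
  obtain \<beta> where be: "\<not> int p dvd \<beta>" "\<phi> x - \<phi> w = r ^ 1 * real_of_int \<beta>" using Lev_form[OF w(2)] by blast
  obtain \<gamma> where ga: "\<phi> y - \<phi> w = r ^ t * real_of_int \<gamma>" using Lev_form[OF t(2)] by blast
  have "r * real_of_int \<beta> = r ^ k * real_of_int \<alpha> + r ^ t * real_of_int \<gamma>"
    using al be ga by simp
  then have "\<not> 1 < t" using bottom k2 be(1) by blast
  then have "t = 1" using t by simp
  then show "\<exists>w\<in>\<Lambda>. Lev 1 x w \<and> Lev 1 y w" using w t by blast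
qed

text \<open>The valuation leaves only the case that \<open>r\<close> is a nonunit. Any two points are then linked through a third
one by pairs of level one, so all differences are integral multiples of \<open>r\<close>. A pair of level two is also
an integral multiple of \<open>r\<^sup>2\<close>, and comparing the two multiples shows that \<open>r\<close> is rational.\<close>
theorem levels_force_rational_ratio:
  shows "\<exists>a b. coprime a b \<and> b > 0 \<and> r = real_of_int a / real_of_int b \<and> int p dvd a \<and>
      (\<forall>x\<in>\<Lambda>. \<forall>y\<in>\<Lambda>. \<exists>t. real_of_int b * (\<phi> x - \<phi> y) = real_of_int (a * t))"
    and "\<And>x y. x \<in> \<Lambda> \<Longrightarrow> y \<in> \<Lambda> \<Longrightarrow> x \<noteq> y \<Longrightarrow> \<not> Lev 1 x y \<Longrightarrow> \<exists>w\<in>\<Lambda>. Lev 1 x w \<and> Lev 1 y w"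
proof -
  obtain A where A: "maximal_p_subring p A" using exists_maximal_p_subring[OF prime_p] by blast
  interpret maximal_p_subring p A by fact
  have rA: "r \<in> A" using valuation_ring[of r] inverse_ratio_not_nonunit[OF A] r_gt_1 by (auto simp: nonunits_def)
  have rN: "r \<in> nonunits" using ratio_not_unit[OF A rA] rA by (simp add: nonunits_def)
  show two: "\<And>x y. x \<in> \<Lambda> \<Longrightarrow> y \<in> \<Lambda> \<Longrightarrow> x \<noteq> y \<Longrightarrow> \<not> Lev 1 x y \<Longrightarrow> \<exists>w\<in>\<Lambda>. Lev 1 x w \<and> Lev 1 y w"
    by (rule level_one_witness(2)[OF A rN])
  have multiple: "\<exists>t. \<phi> x - \<phi> y = r * real_of_int t" if xy: "x \<in> \<Lambda>" "y \<in> \<Lambda>" for x y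
  proof -
    consider "x = y" | "Lev 1 x y" | w where "Lev 1 x w" "Lev 1 y w" using two xy by blast
    then show ?thesis
    proof cases
      case 1 then show ?thesis by (auto intro: exI[of _ 0])
    next
      case 2
      obtain \<alpha> where "\<phi> x - \<phi> y = r ^ 1 * real_of_int \<alpha>" using Lev_form[OF 2] by blast
      then show ?thesis unfolding power_one_right ..
    next
      case 3
      obtain \<alpha> where "\<phi> x - \<phi> w = r ^ 1 * real_of_int \<alpha>" using Lev_form[OF 3(1)] by blast
      moreover obtain \<beta> where "\<phi> y - \<phi> w = r ^ 1 * real_of_int \<beta>" using Lev_form[OF 3(2)] by blast
      ultimately have "\<phi> x - \<phi> y = r * real_of_int (\<alpha> - \<beta>)" by (simp add: algebra_simps)
      then show ?thesis by blast
    qed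
  qed
  obtain x y where xy: "x \<in> \<Lambda>" "y \<in> \<Lambda>" "Lev 2 x y" using Lev_occurs[of 2] by auto
  obtain \<alpha> where al: "\<not> int p dvd \<alpha>" "\<phi> x - \<phi> y = r\<^sup>2 * real_of_int \<alpha>" using Lev_form[OF xy(3)] by blast
  obtain t where t: "\<phi> x - \<phi> y = r * real_of_int t" using multiple xy by blast
  have a0: "\<alpha> \<noteq> 0" using al by auto
  have "r * (r * real_of_int \<alpha>) = r * real_of_int t"
    using al(2) unfolding t by (simp only: power2_eq_square mult.assoc)
  then have ra: "r * real_of_int \<alpha> = real_of_int t" using r_gt_1 unfolding mult_cancel_left by simp
  have "r = real_of_int t / real_of_int \<alpha>" using a0 unfolding ra[symmetric] by simp
  then have "r \<in> \<rat>" by simp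
  then obtain a b where ab: "b > 0" "coprime a b" "r = of_int a / of_int b" by (rule Rats_cases')
  have "real_of_int a = r * real_of_int b" using ab by simp
  then have "real_of_int a \<in> nonunits" using multiple_nonunit[OF rN] by simp
  then have "int p dvd a" by (simp add: of_int_nonunit_iff)
  moreover have "\<exists>t. real_of_int b * (\<phi> x - \<phi> y) = real_of_int (a * t)" if xy: "x \<in> \<Lambda>" "y \<in> \<Lambda>" for x y
  proof -
    obtain t where "\<phi> x - \<phi> y = r * real_of_int t" using multiple xy by blast
    then have "real_of_int b * (\<phi> x - \<phi> y) = real_of_int (a * t)" using ab by simp
    then show ?thesis by blast
  qed
  ultimately show "\<exists>a b. coprime a b \<and> b > 0 \<and> r = real_of_int a / real_of_int b \<and> int p dvd a \<and>
      (\<forall>x\<in>\<Lambda>. \<forall>y\<in>\<Lambda>. \<exists>t. real_of_int b * (\<phi> x - \<phi> y) = real_of_int (a * t))"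
    using ab by blast
qed

end

section \<open>Positive definite functions\<close>
lemma fourier_exp_0 [simp]: "fourier_exp 0 x = 1" "fourier_exp x 0 = 1"
  by (simp_all add: fourier_exp_def)

lemma fourier_exp_add: "fourier_exp (s + t) x = fourier_exp s x * fourier_exp t x"
  by (simp add: fourier_exp_def inner_add_left distrib_left flip: exp_add)

lemma fourier_exp_add_right: "fourier_exp s (x + y) = fourier_exp s x * fourier_exp s y"
  by (simp add: fourier_exp_def inner_add_right distrib_left flip: exp_add)

lemma fourier_exp_minus: "fourier_exp (- s) x = cnj (fourier_exp s x)"
  by (simp add: fourier_exp_def exp_cnj)

lemma fourier_exp_diff: "fourier_exp (s - t) x = fourier_exp s x * cnj (fourier_exp t x)"
  using fourier_exp_add[of s "- t" x] by (simp add: fourier_exp_minus)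

lemma norm_fourier_exp [simp]: "cmod (fourier_exp s x) = 1"
  by (simp add: fourier_exp_def)

lemma fourier_exp_mult_cnj [simp]: "fourier_exp s x * cnj (fourier_exp s x) = 1"
  by (metis complex_norm_square norm_fourier_exp of_real_1 power_one)

text \<open>Positive definiteness stands in for being the Fourier transform of a positive measure: it suffices for
Bessel's inequality and passes to the partial products below without any construction of measures.\<close>
definition positive_definite :: "('a::ab_group_add \<Rightarrow> complex) \<Rightarrow> bool" where
  "positive_definite g \<longleftrightarrow> (\<forall>x. g (- x) = cnj (g x)) \<and>
     (\<forall>S c. finite S \<longrightarrow> 0 \<le> Re (\<Sum>s\<in>S. \<Sum>t\<in>S. c s * cnj (c t) * g (s - t)))"

lemma positive_definiteD:
  assumes "positive_definite g"
  shows "g (- x) = cnj (g x)"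
    and "finite S \<Longrightarrow> 0 \<le> Re (\<Sum>s\<in>S. \<Sum>t\<in>S. c s * cnj (c t) * g (s - t))"
  using assms by (auto simp: positive_definite_def)

lemma positive_definite_one: "positive_definite (\<lambda>_. 1)"
  unfolding positive_definite_def
proof (intro conjI allI impI)
  fix S :: "'a set" and c :: "'a \<Rightarrow> complex" assume "finite S"
  have "(\<Sum>s\<in>S. \<Sum>t\<in>S. c s * cnj (c t) * 1) = (\<Sum>s\<in>S. c s) * cnj (\<Sum>s\<in>S. c s)"
    by (simp add: sum_product cnj_sum)
  also have "Re \<dots> \<ge> 0" by (simp only: complex_norm_square[symmetric]) simp
  finally show "0 \<le> Re (\<Sum>s\<in>S. \<Sum>t\<in>S. c s * cnj (c t) * 1)" .
qed auto

lemma positive_definite_compose: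
  fixes L :: "'b::ab_group_add \<Rightarrow> 'a::ab_group_add"
  assumes g: "positive_definite g" and L: "\<And>x y. L (x + y) = L x + L y" "inj L"
  shows "positive_definite (\<lambda>x. g (L x))"
proof -
  have L0: "L 0 = 0" using L(1)[of 0 0] by simp
  have Lm: "L (- x) = - L x" for x
    using L(1)[of x "- x"] L0 by (simp add: eq_neg_iff_add_eq_0 add.commute)
  have Ld: "L (x - y) = L x - L y" for x y using L(1)[of x "- y"] Lm by simp
  show ?thesis
    unfolding positive_definite_def
  proof (intro conjI allI impI)
    show "g (L (- x)) = cnj (g (L x))" for x using positive_definiteD(1)[OF g] Lm by simp
    fix S :: "'b set" and c assume S: "finite S"
    have "0 \<le> Re (\<Sum>s\<in>L ` S. \<Sum>t\<in>L ` S. c (inv L s) * cnj (c (inv L t)) * g (s - t))"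
      using S by (intro positive_definiteD(2)[OF g]) auto
    also have "(\<Sum>s\<in>L ` S. \<Sum>t\<in>L ` S. c (inv L s) * cnj (c (inv L t)) * g (s - t))
        = (\<Sum>s\<in>S. \<Sum>t\<in>S. c s * cnj (c t) * g (L (s - t)))"
      using inj_on_subset[OF L(2), of S] L(2) by (simp add: sum.reindex Ld)
    finally show "0 \<le> Re (\<Sum>s\<in>S. \<Sum>t\<in>S. c s * cnj (c t) * g (L (s - t)))" .
  qed
qed

text \<open>Multiplication by a character only changes the coefficients of the quadratic form.\<close>
lemma positive_definite_characters:
  assumes h: "positive_definite h" and D: "finite D"
    and \<psi>: "\<And>d s t. d \<in> D \<Longrightarrow> \<psi> d (s - t) = \<psi> d s * cnj (\<psi> d t)"
      "\<And>d s. d \<in> D \<Longrightarrow> \<psi> d (- s) = cnj (\<psi> d s)"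
  shows "positive_definite (\<lambda>x. (\<Sum>d\<in>D. \<psi> d x) / of_nat n * h x)"
  unfolding positive_definite_def
proof (intro conjI allI impI)
  fix x show "(\<Sum>d\<in>D. \<psi> d (- x)) / of_nat n * h (- x) = cnj ((\<Sum>d\<in>D. \<psi> d x) / of_nat n * h x)"
    using \<psi>(2) positive_definiteD(1)[OF h] by simp
next
  fix S :: "'a set" and c :: "'a \<Rightarrow> complex" assume S: "finite S"
  have "(\<Sum>s\<in>S. \<Sum>t\<in>S. c s * cnj (c t) * ((\<Sum>d\<in>D. \<psi> d (s - t)) / of_nat n * h (s - t)))
      = (\<Sum>s\<in>S. \<Sum>t\<in>S. \<Sum>d\<in>D. (c s * \<psi> d s) * cnj (c t * \<psi> d t) * h (s - t) / of_nat n)"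
    using \<psi>(1) by (intro sum.cong refl) (simp add: sum_distrib_left sum_distrib_right sum_divide_distrib mult_ac)
  also have "\<dots> = (\<Sum>d\<in>D. (\<Sum>s\<in>S. \<Sum>t\<in>S. (c s * \<psi> d s) * cnj (c t * \<psi> d t) * h (s - t)) / of_nat n)"
    by (subst sum.swap[of _ D S], subst sum.swap[of _ D S, symmetric])
       (simp add: sum_divide_distrib sum.swap[of _ D S])
  also have "Re \<dots> = (\<Sum>d\<in>D. Re (\<Sum>s\<in>S. \<Sum>t\<in>S. (c s * \<psi> d s) * cnj (c t * \<psi> d t) * h (s - t)) / real n)"
    by (simp add: Re_divide_of_nat)
  also have "\<dots> \<ge> 0"
    by (intro sum_nonneg divide_nonneg_nonneg positive_definiteD(2)[OF h S]) auto
  finally show "0 \<le> Re (\<Sum>s\<in>S. \<Sum>t\<in>S. c s * cnj (c t) * ((\<Sum>d\<in>D. \<psi> d (s - t)) / of_nat n * h (s - t)))" .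
qed

text \<open>Evaluate the form at the points of \<open>F\<close> together with \<open>- \<xi>\<close>, with coefficient \<open>1\<close> at \<open>- \<xi>\<close> and the negative
Fourier coefficients on \<open>F\<close>; orthogonality removes all other terms.\<close>
lemma positive_definite_bessel:
  assumes g: "positive_definite g" and g0: "g 0 = 1" and F: "finite F"
    and orth: "\<And>x y. x \<in> F \<Longrightarrow> y \<in> F \<Longrightarrow> x \<noteq> y \<Longrightarrow> g (x - y) = 0"
  shows "(\<Sum>l\<in>F. (cmod (g (\<xi> + l)))\<^sup>2) \<le> 1"
proof (cases "- \<xi> \<in> F")
  case True
  have "(\<Sum>l\<in>F. (cmod (g (\<xi> + l)))\<^sup>2) = (\<Sum>l\<in>F. if l = - \<xi> then 1 else 0)"
    using orth[OF _ True] g0 by (intro sum.cong) (auto simp: add.commute)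
  then show ?thesis using F True by simp
next
  case False
  define u where "u = - \<xi>"
  define c where "c s = (if s = u then 1 else - g (u - s))" for s
  have uF: "u \<notin> F" using False by (simp add: u_def)
  have cF: "c s = - g (u - s)" if "s \<in> F" for s using that uF by (auto simp: c_def)
  have herm: "g (s - u) = cnj (g (u - s))" for s
    using positive_definiteD(1)[OF g, of "u - s"] by simp
  define q where "q s = complex_of_real ((cmod (g (u - s)))\<^sup>2)" for s
  have q: "g (u - s) * cnj (g (u - s)) = q s" for s by (simp only: q_def complex_norm_square)
  have q': "cnj (g (u - s)) * g (u - s) = q s" for s using q by (simp only: mult.commute)
  have inner: "(\<Sum>t\<in>F. c s * cnj (c t) * g (s - t)) = q s" if s: "s \<in> F" for s
  proof -
    have "(\<Sum>t\<in>F. c s * cnj (c t) * g (s - t)) = (\<Sum>t\<in>F. if t = s then q s else 0)"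
      using s orth g0 by (intro sum.cong) (auto simp: cF q)
    then show ?thesis using F s by simp
  qed
  have r1: "(\<Sum>t\<in>F. cnj (c t) * g (u - t)) = - (\<Sum>t\<in>F. q t)"
    unfolding sum_negf[symmetric] by (intro sum.cong) (auto simp: cF q')
  have r2: "(\<Sum>s\<in>F. c s * g (s - u)) = - (\<Sum>t\<in>F. q t)"
    unfolding sum_negf[symmetric] by (intro sum.cong) (auto simp: cF herm q)
  have cu: "c u = 1" by (simp add: c_def)
  have "(\<Sum>s\<in>insert u F. \<Sum>t\<in>insert u F. c s * cnj (c t) * g (s - t))
      = 1 + (\<Sum>t\<in>F. cnj (c t) * g (u - t)) + (\<Sum>s\<in>F. c s * g (s - u) + (\<Sum>t\<in>F. c s * cnj (c t) * g (s - t)))"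
    using F uF by (simp add: cu g0)
  also have "\<dots> = 1 - (\<Sum>t\<in>F. q t)"
    using r1 r2 inner by (simp add: sum.distrib)
  finally have eq: "(\<Sum>s\<in>insert u F. \<Sum>t\<in>insert u F. c s * cnj (c t) * g (s - t)) = 1 - (\<Sum>t\<in>F. q t)" .
  have "0 \<le> Re (1 - (\<Sum>t\<in>F. q t))"
    using positive_definiteD(2)[OF g, of "insert u F" c] F unfolding eq by simp
  then have "(\<Sum>t\<in>F. (cmod (g (u - t)))\<^sup>2) \<le> 1" by (simp add: q_def)
  moreover have "cmod (g (u - t)) = cmod (g (\<xi> + t))" for t
    using positive_definiteD(1)[OF g, of "\<xi> + t"] by (simp add: u_def)
  ultimately show ?thesis by simp
qed

lemma positive_definite_norm_le_1:
  assumes "positive_definite g" "g 0 = 1"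
  shows "cmod (g x) \<le> 1"
  using positive_definite_bessel[OF assms, of "{0}" x] by (simp add: power2_le_iff_abs_le power_le_one_iff)

section \<open>Refinable functions and their spectra\<close>

text \<open>The abstract form of the Fourier transform \<open>g\<close> of a self-affine measure: \<open>f\<close> is the Fourier transform of
the uniform measure on the digits and \<open>P n\<close> is the \<open>n\<close>-th power of the transposed inverse of the matrix.\<close>
locale refinable =
  fixes D :: "'a::euclidean_space set" and f g :: "'a \<Rightarrow> complex" and P :: "nat \<Rightarrow> 'a \<Rightarrow> 'a"
  assumes finite_D: "finite D" and D_nonempty: "D \<noteq> {}"
    and f_eq: "\<And>x. f x = (\<Sum>d\<in>D. fourier_exp x d) / of_nat (card D)"
    and P_linear: "\<And>n. linear (P n)" and P_0: "\<And>x. P 0 x = x"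
    and P_P: "\<And>m n x. P m (P n x) = P (m + n) x"
    and P_inj: "\<And>n. inj (P n)" and P_tendsto: "\<And>x. (\<lambda>n. P n x) \<longlonglongrightarrow> 0"
    and g_refine: "\<And>x. g x = f (P 1 x) * g (P 1 x)" and g_0: "g 0 = 1"
    and g_cont: "continuous_on UNIV g" and g_pd: "positive_definite g"
begin

lemmas P_simps = linear_add[OF P_linear] linear_diff[OF P_linear] linear_neg[OF P_linear]
  linear_0[OF P_linear]

lemma card_D: "card D > 0"
  using finite_D D_nonempty by (simp add: card_gt_0_iff)

lemma f_0: "f 0 = 1"
  using card_D by (simp add: f_eq)

lemma f_minus: "f (- x) = cnj (f x)"
  by (simp add: f_eq fourier_exp_minus)

lemma f_minus_zero: "f (x - y) = 0 \<longleftrightarrow> f (y - x) = 0"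
  using f_minus[of "x - y"] by simp

lemma norm_f_le_1: "cmod (f x) \<le> 1"
proof -
  have "cmod (\<Sum>d\<in>D. fourier_exp x d) \<le> real (card D)"
    using norm_sum[of "\<lambda>d. fourier_exp x d" D] by simp
  then show ?thesis using card_D by (simp add: f_eq norm_divide)
qed

lemma norm_g_le_1: "cmod (g x) \<le> 1"
  by (rule positive_definite_norm_le_1[OF g_pd g_0])

definition partial :: "nat \<Rightarrow> 'a \<Rightarrow> complex" where
  "partial n x = (\<Prod>i<n. f (P (Suc i) x))"

lemma partial_0: "partial n 0 = 1"
  by (simp add: partial_def P_simps f_0)

lemma partial_Suc: "partial (Suc n) x = partial n x * f (P (Suc n) x)"
  by (simp add: partial_def)

lemma norm_partial_le_1: "cmod (partial n x) \<le> 1"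
  unfolding partial_def prod_norm[symmetric] by (intro prod_le_1) (auto simp: norm_f_le_1)

lemma partial_zero_iff: "partial n x = 0 \<longleftrightarrow> (\<exists>k\<ge>1. k \<le> n \<and> f (P k x) = 0)"
proof -
  have "partial n x = 0 \<longleftrightarrow> (\<exists>i<n. f (P (Suc i) x) = 0)" by (auto simp: partial_def)
  also have "\<dots> \<longleftrightarrow> (\<exists>k\<ge>1. k \<le> n \<and> f (P k x) = 0)"
    by (metis One_nat_def Suc_le_D Suc_le_eq le_simps(3) zero_less_Suc)
  finally show ?thesis .
qed

lemma g_factor: "g x = partial n x * g (P n x)"
proof (induction n)
  case 0 show ?case by (simp add: partial_def P_0)
next
  case (Suc n)
  have "g (P n x) = f (P (Suc n) x) * g (P (Suc n) x)"
    using g_refine[of "P n x"] by (simp add: P_P)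
  then show ?case using Suc by (simp add: partial_Suc)
qed

lemma norm_g_le_partial: "cmod (g x) \<le> cmod (partial n x)"
  using g_factor[of x n] norm_g_le_1[of "P n x"] by (simp add: norm_mult mult_left_le)

lemma norm_g_le_tail: "cmod (g x) \<le> cmod (g (P n x))"
  using g_factor[of x n] norm_partial_le_1[of n x] by (simp add: norm_mult mult_left_le_one_le)

lemma g_tail_tendsto: "(\<lambda>n. g (P n x)) \<longlonglongrightarrow> 1"
proof -
  have "isCont g 0" using g_cont by (simp add: continuous_on_eq_continuous_at)
  from isCont_tendsto_compose[OF this P_tendsto[of x]] show ?thesis by (simp add: g_0)
qed

lemma partial_tendsto: "(\<lambda>n. partial n x) \<longlonglongrightarrow> g x"
proof -
  have ev: "eventually (\<lambda>n. g (P n x) \<noteq> 0) sequentially"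
    using tendsto_imp_eventually_ne[OF g_tail_tendsto] by simp
  have "(\<lambda>n. g x / g (P n x)) \<longlonglongrightarrow> g x / 1"
    by (intro tendsto_divide tendsto_const g_tail_tendsto) auto
  moreover have "eventually (\<lambda>n. g x / g (P n x) = partial n x) sequentially"
    using ev
  proof eventually_elim
    case (elim n)
    then show ?case using g_factor[of x n] by simp
  qed
  ultimately show ?thesis by (simp add: Lim_transform_eventually)
qed

text \<open>Far down the orbit \<open>P n x\<close> the function \<open>g\<close> is close to \<open>g 0 = 1\<close>, so a zero must come from one of the
finitely many earlier factors.\<close>
lemma g_zero_iff: "g x = 0 \<longleftrightarrow> (\<exists>k\<ge>1. f (P k x) = 0)"
proof
  assume z: "g x = 0"
  obtain n where "g (P n x) \<noteq> 0"
    using tendsto_imp_eventually_ne[OF g_tail_tendsto[of x], of 0] by (auto simp: eventually_sequentially)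
  then have "partial n x = 0" using g_factor[of x n] z by simp
  then show "\<exists>k\<ge>1. f (P k x) = 0" by (auto simp: partial_zero_iff)
next
  assume "\<exists>k\<ge>1. f (P k x) = 0"
  then obtain k where "partial k x = 0" using partial_zero_iff by blast
  then show "g x = 0" using g_factor[of x k] by simp
qed

lemma positive_definite_f_mult:
  assumes "positive_definite h"
  shows "positive_definite (\<lambda>x. f (P i x) * h x)"
  unfolding f_eq
  by (rule positive_definite_characters[OF assms finite_D, of "\<lambda>d x. fourier_exp (P i x) d"])
     (auto simp: P_simps fourier_exp_diff fourier_exp_minus)

lemma positive_definite_partial_mult:
  assumes "positive_definite h"
  shows "positive_definite (\<lambda>x. partial n x * h x)"
proof (induction n)
  case 0 show ?case using assms by (simp add: partial_def)
next
  case (Suc n)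
  from positive_definite_f_mult[OF this, of "Suc n"] show ?case
    by (simp add: partial_Suc mult_ac)
qed

lemma positive_definite_partial: "positive_definite (partial n)"
  using positive_definite_partial_mult[OF positive_definite_one, of n] by simp

lemma positive_definite_tail: "positive_definite (\<lambda>x. g (P n x))"
  by (rule positive_definite_compose[OF g_pd _ P_inj]) (simp add: P_simps)

end

text \<open>\<open>complete\<close> is Parseval's identity for the exponentials. The points near the origin that \<open>small_strict\<close>
provides are those at which the removal of any factor increases the modulus of the product.\<close>
locale refinable_spectrum = refinable +
  fixes \<Lambda> :: "'a set"
  assumes orth: "\<And>x y. x \<in> \<Lambda> \<Longrightarrow> y \<in> \<Lambda> \<Longrightarrow> x \<noteq> y \<Longrightarrow> g (x - y) = 0"
    and complete: "\<And>\<xi> \<epsilon>. \<epsilon> > 0 \<Longrightarrow> \<exists>F\<subseteq>\<Lambda>. finite F \<and> (\<Sum>l\<in>F. (cmod (g (\<xi> + l)))\<^sup>2) > 1 - \<epsilon>"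
    and small_strict: "\<And>\<epsilon>. \<epsilon> > 0 \<Longrightarrow> \<exists>\<eta>. norm \<eta> < \<epsilon> \<and> (\<forall>n. cmod (f (P n \<eta>)) < 1)"
begin

lemma small_nonzero:
  assumes "\<epsilon> > 0"
  shows "\<exists>\<eta>. norm \<eta> < \<epsilon> \<and> g \<eta> \<noteq> 0 \<and> (\<forall>n. cmod (f (P n \<eta>)) < 1)"
proof -
  have "isCont g 0" using g_cont by (simp add: continuous_on_eq_continuous_at)
  then obtain d where d: "d > 0" "\<And>x. dist x 0 < d \<Longrightarrow> dist (g x) (g 0) < 1"
    unfolding continuous_at_eps_delta by (metis zero_less_one)
  obtain \<eta> where e: "norm \<eta> < min d \<epsilon>" "\<forall>n. cmod (f (P n \<eta>)) < 1"
    using small_strict[of "min d \<epsilon>"] d(1) assms by (metis min_less_iff_conj)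
  have "g \<eta> \<noteq> 0" using d(2)[of \<eta>] e by (auto simp: g_0 dist_norm)
  with e show ?thesis by auto
qed

lemma \<Lambda>_nonempty: "\<Lambda> \<noteq> {}"
  using complete[of "1/2" 0] by auto

text \<open>Otherwise the \<open>k\<close>-th factor could be deleted from the product without losing the
  orthogonality of \<open>\<Lambda>\<close>, and Bessel's inequality for the remaining product, which is strictly larger
  in modulus somewhere, would contradict completeness.\<close>

lemma level_occurs:
  assumes "k \<ge> 1"
  shows "\<exists>x\<in>\<Lambda>. \<exists>y\<in>\<Lambda>. x \<noteq> y \<and> f (P k (x - y)) = 0"
proof (rule ccontr)
  assume no: "\<not> ?thesis"
  obtain j where k: "k = Suc j" using assms by (cases k) auto
  define h where "h x = partial j x * g (P k x)" for x
  have gh: "g x = f (P k x) * h x" for x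
    using g_factor[of x k] by (simp add: h_def k partial_Suc)
  have h_pd: "positive_definite h" unfolding h_def
    by (rule positive_definite_partial_mult[OF positive_definite_tail])
  have h0: "h 0 = 1" by (simp add: h_def partial_0 P_simps g_0)
  have h_orth: "h (x - y) = 0" if "x \<in> \<Lambda>" "y \<in> \<Lambda>" "x \<noteq> y" for x y
    using orth[OF that] no that gh[of "x - y"] by auto
  obtain l0 where l0: "l0 \<in> \<Lambda>" using \<Lambda>_nonempty by blast
  obtain \<eta> where eta: "g \<eta> \<noteq> 0" "\<And>n. cmod (f (P n \<eta>)) < 1" using small_nonzero[of 1] by auto
  define \<delta> where "\<delta> = (cmod (h \<eta>))\<^sup>2 - (cmod (g \<eta>))\<^sup>2"
  have "h \<eta> \<noteq> 0" using eta gh[of \<eta>] by auto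
  then have "cmod (g \<eta>) < cmod (h \<eta>)" using eta(2)[of k] by (simp add: gh[of \<eta>] norm_mult)
  then have \<delta>: "\<delta> > 0" by (simp add: \<delta>_def power_strict_mono)
  obtain F where F: "F \<subseteq> \<Lambda>" "finite F" "(\<Sum>l\<in>F. (cmod (g (\<eta> - l0 + l)))\<^sup>2) > 1 - \<delta>"
    using complete[OF \<delta>] by blast
  let ?F = "insert l0 F"
  have "1 - \<delta> < (\<Sum>l\<in>F. (cmod (g (\<eta> - l0 + l)))\<^sup>2)" by fact
  also have "\<dots> \<le> (\<Sum>l\<in>?F. (cmod (g (\<eta> - l0 + l)))\<^sup>2)" using F by (intro sum_mono2) auto
  also have "\<dots> = (cmod (g \<eta>))\<^sup>2 + (\<Sum>l\<in>?F - {l0}. (cmod (g (\<eta> - l0 + l)))\<^sup>2)"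
    using F by (subst sum.remove[of _ l0]) auto
  also have "(\<Sum>l\<in>?F - {l0}. (cmod (g (\<eta> - l0 + l)))\<^sup>2) \<le> (\<Sum>l\<in>?F - {l0}. (cmod (h (\<eta> - l0 + l)))\<^sup>2)"
    by (intro sum_mono power_mono) (auto simp: gh norm_mult mult_left_le_one_le norm_f_le_1)
  also have "(cmod (g \<eta>))\<^sup>2 + (\<Sum>l\<in>?F - {l0}. (cmod (h (\<eta> - l0 + l)))\<^sup>2)
      = (\<Sum>l\<in>?F. (cmod (h (\<eta> - l0 + l)))\<^sup>2) - \<delta>"
    using F by (subst (2) sum.remove[of _ l0]) (auto simp: \<delta>_def)
  also have "(\<Sum>l\<in>?F. (cmod (h (\<eta> - l0 + l)))\<^sup>2) \<le> 1"
    using F l0 by (intro positive_definite_bessel[OF h_pd h0] h_orth) auto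
  finally show False by simp
qed

end

section \<open>A spectrum forces an integral ratio\<close>

text \<open>The functional \<open>\<phi>\<close> is a left eigenvector of all \<open>P n\<close>. By \<open>near_integer\<close>, \<open>f\<close> has modulus close to one
only where a multiple of \<open>\<phi>\<close> is close to an integer.\<close>
locale refinable_spectrum_functional = refinable_spectrum +
  fixes p :: nat and r w :: real and \<phi> :: "'a \<Rightarrow> real"
  assumes prime_p: "prime p" and r_gt_1: "r > 1"
    and \<phi>_linear: "linear \<phi>" and \<phi>_P: "\<And>n x. \<phi> (P n x) = \<phi> x / r ^ n"
    and f_zero_form: "\<And>x. f x = 0 \<Longrightarrow> \<exists>\<alpha>. \<not> int p dvd \<alpha> \<and> \<phi> x = real_of_int \<alpha>"
    and near_integer: "\<And>\<epsilon>. \<epsilon> > 0 \<Longrightarrow>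
      \<exists>\<theta><1. \<forall>x. cmod (f x) > \<theta> \<longrightarrow> (\<exists>n::int. \<bar>w * \<phi> x - real_of_int n\<bar> < \<epsilon>)"
    and w_ge_1: "\<bar>w\<bar> \<ge> 1"
begin

lemmas \<phi>_simps = linear_add[OF \<phi>_linear] linear_diff[OF \<phi>_linear] linear_neg[OF \<phi>_linear]
  linear_0[OF \<phi>_linear]

sublocale difference_levels p r \<Lambda> \<phi> "\<lambda>k x y. f (P k (x - y)) = 0"
proof
  show "\<exists>\<alpha>. \<not> int p dvd \<alpha> \<and> \<phi> x - \<phi> y = r ^ k * real_of_int \<alpha>" if "f (P k (x - y)) = 0" for k x y
  proof -
    obtain \<alpha> where "\<not> int p dvd \<alpha>" "\<phi> (P k (x - y)) = real_of_int \<alpha>" using f_zero_form \<open>f (P k (x - y)) = 0\<close> by blast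
    then show ?thesis using r_gt_1 by (intro exI[of _ \<alpha>]) (auto simp: \<phi>_P \<phi>_simps field_simps)
  qed
  show "f (P k (y - x)) = 0" if "f (P k (x - y)) = 0" for k x y
    using that f_minus_zero[of "P k x" "P k y"] by (simp add: P_simps)
  show "\<exists>k\<ge>1. f (P k (x - y)) = 0" if "x \<in> \<Lambda>" "y \<in> \<Lambda>" "x \<noteq> y" for x y
    using orth[OF that] by (simp add: g_zero_iff)
  show "\<exists>x\<in>\<Lambda>. \<exists>y\<in>\<Lambda>. x \<noteq> y \<and> f (P k (x - y)) = 0" if "k \<ge> 1" for k
    using level_occurs[OF that] .
qed (use prime_p r_gt_1 in auto)

lemma abs_\<phi>_P: "\<bar>\<phi> (P n x)\<bar> = \<bar>\<phi> x\<bar> / r ^ n"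
  using r_gt_1 by (simp add: \<phi>_P)

context
  fixes a b :: int
  assumes ab: "coprime a b" "b \<ge> 2" "r = real_of_int a / real_of_int b"
begin

lemma a_gt_b: "a > b"
proof -
  have b: "real_of_int b > 0" using ab(2) by simp
  then have "real_of_int a = r * real_of_int b" using ab(3) by simp
  moreover have "1 * real_of_int b < r * real_of_int b"
    using b r_gt_1 by (rule mult_strict_right_mono[rotated])
  ultimately show ?thesis by simp
qed

text \<open>As long as no factor is small, \<open>w * \<phi> x / r ^ i\<close> stays near integers \<open>N i\<close>, and these satisfy
\<open>b * N i = a * N (Suc i)\<close> exactly, because both sides are integers at distance below one. Hence
\<open>b ^ (I - 1)\<close> divides \<open>N I\<close>. But \<open>N I\<close> is nonzero and its size is about \<open>r ^ n\<close>, so \<open>I\<close> cannot be much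
larger than \<open>n\<close>.\<close>
lemma decay_step:
  "\<exists>\<theta> C. 0 \<le> \<theta> \<and> \<theta> < 1 \<and> C \<ge> (2::nat) \<and> (\<forall>n x. n \<ge> 1 \<longrightarrow> r ^ (C * n) \<le> \<bar>\<phi> x\<bar> \<longrightarrow>
      (\<exists>i\<ge>1. cmod (f (P i x)) \<le> \<theta> \<and> r ^ n \<le> \<bar>\<phi> (P i x)\<bar>))"
proof -
  define \<epsilon> where "\<epsilon> = 1 / real_of_int (a + b)"
  have ab_pos: "real_of_int a > 0" "real_of_int b > 0" "\<epsilon> > 0" "\<epsilon> < 1"
    using ab a_gt_b by (auto simp: \<epsilon>_def)
  obtain \<theta>0 where \<theta>0: "\<theta>0 < 1"
    "\<And>x. cmod (f x) > \<theta>0 \<Longrightarrow> \<exists>n::int. \<bar>w * \<phi> x - real_of_int n\<bar> < \<epsilon>"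
    using near_integer[OF ab_pos(3)] by blast
  define H where "H = \<bar>w\<bar> * r\<^sup>2 + 1 + r"
  obtain e where e: "H < 2 ^ e" using real_arch_pow[of 2 H] by auto
  \<comment> \<open>The bound \<open>H ^ n\<close> on \<open>N I\<close> is beaten by \<open>2 ^ (I - 1)\<close> once \<open>I\<close> is at least \<open>(e + 1) * n\<close>.\<close>
  define C where "C = e + 2"
  have H1: "H \<ge> 1" "H \<ge> r" "H \<ge> \<bar>w\<bar> * r\<^sup>2 + 1" using r_gt_1 by (auto simp: H_def)
  have main: "\<exists>i\<ge>1. cmod (f (P i x)) \<le> max \<theta>0 0 \<and> r ^ n \<le> \<bar>\<phi> (P i x)\<bar>"
    if n: "n \<ge> 1" and x: "r ^ (C * n) \<le> \<bar>\<phi> x\<bar>" for n x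
  proof (rule ccontr)
    assume contra: "\<not> ?thesis"
    define y where "y = \<bar>\<phi> x\<bar>"
    \<comment> \<open>\<open>I\<close> is the last index with \<open>y / r ^ I \<ge> r ^ n\<close>.\<close>
    define m where "m = (LEAST m. y < r ^ m)"
    have "\<exists>m. y < r ^ m" using real_arch_pow[OF r_gt_1] by blast
    then have m: "y < r ^ m" unfolding m_def by (rule LeastI_ex)
    have "r ^ (C * n) < r ^ m" using x m by (simp add: y_def)
    then have mC: "C * n < m" using r_gt_1 by (simp add: power_strict_increasing_iff)
    have m': "r ^ (m - 1) \<le> y"
    proof (rule ccontr)
      assume "\<not> r ^ (m - 1) \<le> y"
      then have "m \<le> m - 1" unfolding m_def[symmetric] using Least_le[of "\<lambda>m. y < r ^ m" "m - 1"]
        by (simp add: m_def)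
      then show False using mC by simp
    qed
    define I where "I = m - 1 - n"
    have "C * n = (e + 1) * n + n" by (simp add: C_def algebra_simps)
    then have I: "(e + 1) * n \<le> I" "m - 1 = I + n" using mC by (auto simp: I_def)
    have en: "e * n + 1 \<le> (e + 1) * n" using n by simp
    have near: "\<exists>N::int. \<bar>w * (\<phi> x / r ^ i) - real_of_int N\<bar> < \<epsilon>" if i: "1 \<le> i" "i \<le> I" for i
    proof -
      have "r ^ n * r ^ i \<le> r ^ (I + n)"
        unfolding power_add[symmetric] using i r_gt_1 by (intro power_increasing) auto
      also have "\<dots> \<le> y" using m' I(2) by simp
      finally have "r ^ n \<le> \<bar>\<phi> (P i x)\<bar>" using r_gt_1 by (simp add: abs_\<phi>_P y_def field_simps)
      then have "cmod (f (P i x)) > \<theta>0" using contra i by fastforce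
      from \<theta>0(2)[OF this] show ?thesis by (simp add: \<phi>_P)
    qed
    have "\<exists>N. \<forall>i. 1 \<le> i \<and> i \<le> I \<longrightarrow> \<bar>w * (\<phi> x / r ^ i) - real_of_int (N i)\<bar> < \<epsilon>"
      using near by (intro choice) blast
    then obtain N :: "nat \<Rightarrow> int" where N: "\<And>i. 1 \<le> i \<Longrightarrow> i \<le> I \<Longrightarrow> \<bar>w * (\<phi> x / r ^ i) - real_of_int (N i)\<bar> < \<epsilon>"
      by blast
    have step: "b * N i = a * N (Suc i)" if i: "1 \<le> i" "Suc i \<le> I" for i
    proof -
      define u v where "u = w * (\<phi> x / r ^ i) - real_of_int (N i)"
        and "v = w * (\<phi> x / r ^ Suc i) - real_of_int (N (Suc i))"
      have uv: "\<bar>u\<bar> < \<epsilon>" "\<bar>v\<bar> < \<epsilon>" unfolding u_def v_def using N[of i] N[of "Suc i"] i by auto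
      have "w * (\<phi> x / r ^ i) = r * (w * (\<phi> x / r ^ Suc i))" using r_gt_1 by simp
      then have "real_of_int b * (w * (\<phi> x / r ^ i)) = real_of_int a * (w * (\<phi> x / r ^ Suc i))"
        unfolding ab(3) using ab_pos by simp
      then have "real_of_int (a * N (Suc i) - b * N i) = b * u - a * v"
        by (simp add: u_def v_def algebra_simps)
      also have "\<bar>b * u - a * v\<bar> \<le> b * \<bar>u\<bar> + a * \<bar>v\<bar>"
        using ab_pos abs_triangle_ineq4[of "b * u" "a * v"] by (simp add: abs_mult)
      also have "\<dots> < b * \<epsilon> + a * \<epsilon>" using uv ab_pos by (intro add_strict_mono mult_strict_left_mono) auto
      also have "\<dots> = real_of_int (a + b) * \<epsilon>" by (simp add: algebra_simps)
      also have "\<dots> = 1" using ab_pos by (simp add: \<epsilon>_def)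
      finally have "\<bar>real_of_int (a * N (Suc i) - b * N i)\<bar> < 1" .
      then show ?thesis by linarith
    qed
    have chain: "Suc j \<le> I \<Longrightarrow> b ^ j * N 1 = a ^ j * N (Suc j)" for j
    proof (induction j)
      case (Suc j)
      have "b ^ Suc j * N 1 = b * (a ^ j * N (Suc j))" using Suc by simp
      also have "\<dots> = a ^ j * (b * N (Suc j))" by simp
      also have "\<dots> = a ^ Suc j * N (Suc (Suc j))" using step[of "Suc j"] Suc(2) by simp
      finally show ?case .
    qed simp
    have I1: "1 \<le> I" using I(1) n by (cases I) auto
    have "b ^ (I - 1) dvd a ^ (I - 1) * N I" using chain[of "I - 1"] I1 by (metis Suc_pred' dvd_triv_left le_eq_less_or_eq less_le_trans zero_less_one order_refl)
    moreover have "coprime (b ^ (I - 1)) (a ^ (I - 1))" using ab(1) by (simp add: coprime_commute)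
    ultimately have dvd: "b ^ (I - 1) dvd N I" by (simp add: coprime_dvd_mult_right_iff)
    define v where "v = w * (\<phi> x / r ^ I)"
    have NI: "\<bar>v - real_of_int (N I)\<bar> < \<epsilon>" using N[of I] I1 by (simp add: v_def)
    have size: "\<bar>v\<bar> = \<bar>w\<bar> * (y / r ^ I)" using r_gt_1 by (simp add: v_def y_def abs_mult)
    have yI: "r ^ n \<le> y / r ^ I" using m' I(2) r_gt_1 by (simp add: field_simps power_add)
    have "m = Suc (m - 1)" using mC by simp
    then have "m = Suc n + I" using I(2) by simp
    then have "y < r ^ (Suc n) * r ^ I" using m by (simp only: power_add)
    then have yI': "y / r ^ I \<le> r ^ Suc n" using r_gt_1 by (simp add: field_simps)
    have "1 \<le> r ^ n" using r_gt_1 by simp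
    then have "1 * 1 \<le> \<bar>w\<bar> * (y / r ^ I)" using w_ge_1 yI by (intro mult_mono) auto
    then have "1 \<le> \<bar>v\<bar>" by (simp only: size mult_1)
    then have "\<bar>real_of_int (N I)\<bar> > 0" using NI ab_pos(4) by linarith
    then have NI0: "N I \<noteq> 0" by simp
    have "2 ^ (I - 1) \<le> b ^ (I - 1)" using ab(2) by (intro power_mono) auto
    also have "\<dots> \<le> \<bar>N I\<bar>" using dvd NI0 ab(2) by (intro zdvd_imp_le) auto
    finally have "real_of_int (2 ^ (I - 1)) \<le> real_of_int \<bar>N I\<bar>" by (simp only: of_int_le_iff)
    then have low: "(2::real) ^ (I - 1) \<le> \<bar>real_of_int (N I)\<bar>" by simp
    have "\<bar>real_of_int (N I)\<bar> \<le> \<bar>v\<bar> + 1" using NI ab_pos(4) by linarith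
    then have "(2::real) ^ (I - 1) \<le> \<bar>w\<bar> * (y / r ^ I) + 1" using low size by linarith
    moreover have "\<bar>w\<bar> * (y / r ^ I) \<le> \<bar>w\<bar> * r ^ Suc n" using yI' by (rule mult_left_mono) auto
    ultimately have "(2::real) ^ (I - 1) \<le> \<bar>w\<bar> * r ^ Suc n + 1" by linarith
    also have "\<dots> \<le> (\<bar>w\<bar> * r\<^sup>2 + 1) * r ^ (n - 1)"
    proof -
      have "r ^ Suc n = r\<^sup>2 * r ^ (n - 1)" using n by (cases n) (auto simp: power2_eq_square)
      moreover have "1 \<le> r ^ (n - 1)" using r_gt_1 by simp
      ultimately show ?thesis by (simp add: algebra_simps)
    qed
    also have "\<dots> \<le> H * H ^ (n - 1)" using H1 r_gt_1 by (intro mult_mono power_mono) auto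
    also have "\<dots> = H ^ n" using n by (cases n) auto
    also have "\<dots> < (2 ^ e) ^ n" using e H1 n by (intro power_strict_mono) auto
    also have "\<dots> \<le> 2 ^ (I - 1)" unfolding power_mult[symmetric] using I(1) en by (intro power_increasing) auto
    finally show False by simp
  qed
  show ?thesis
    by (rule exI[of _ "max \<theta>0 0"], rule exI[of _ C]) (use main \<theta>0(1) in \<open>auto simp: C_def\<close>)
qed

text \<open>Iterating the previous estimate gives a negative power of \<open>ln \<bar>\<phi> x\<bar>\<close> as a bound for \<open>g\<close>.\<close>
lemma decay:
  "\<exists>\<theta> C. 0 \<le> \<theta> \<and> \<theta> < 1 \<and> C \<ge> (2::nat) \<and> (\<forall>j x. r ^ (C ^ j) \<le> \<bar>\<phi> x\<bar> \<longrightarrow> cmod (g x) \<le> \<theta> ^ j)"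
proof -
  obtain \<theta> C where *: "0 \<le> \<theta>" "\<theta> < 1" "C \<ge> (2::nat)"
    "\<And>n x. n \<ge> 1 \<Longrightarrow> r ^ (C * n) \<le> \<bar>\<phi> x\<bar> \<Longrightarrow> \<exists>i\<ge>1. cmod (f (P i x)) \<le> \<theta> \<and> r ^ n \<le> \<bar>\<phi> (P i x)\<bar>"
    using decay_step by blast
  have "cmod (g x) \<le> \<theta> ^ j" if "r ^ (C ^ j) \<le> \<bar>\<phi> x\<bar>" for j x
    using that
  proof (induction j arbitrary: x)
    case 0 then show ?case by (simp add: norm_g_le_1)
  next
    case (Suc j)
    obtain i where i: "i \<ge> 1" "cmod (f (P i x)) \<le> \<theta>" "r ^ (C ^ j) \<le> \<bar>\<phi> (P i x)\<bar>"
      using *(4)[of "C ^ j" x] Suc(2) *(3) by auto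
    obtain k where k: "i = Suc k" using i(1) by (cases i) auto
    have "cmod (g x) = cmod (partial k x) * cmod (f (P i x)) * cmod (g (P i x))"
      using g_factor[of x i] by (simp add: k partial_Suc norm_mult)
    also have "\<dots> \<le> 1 * \<theta> * \<theta> ^ j"
      using i Suc.IH[OF i(3)] norm_partial_le_1[of k x] *(1) by (intro mult_mono) auto
    finally show ?case by simp
  qed
  then show ?thesis using * by blast
qed

text \<open>A priori a difference of level \<open>k\<close> is an integer multiple of \<open>(a / b) ^ k\<close>. As it is also an
integer multiple of \<open>a / b\<close>, its denominator is at most \<open>b\<close>, which leaves a multiple of \<open>a ^ k / b\<close>.\<close>
lemma level_gap:
  assumes "x \<in> \<Lambda>" "y \<in> \<Lambda>" "f (P k (x - y)) = 0" "k \<ge> 1"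
    and str: "\<And>x y. x \<in> \<Lambda> \<Longrightarrow> y \<in> \<Lambda> \<Longrightarrow> \<exists>t. real_of_int b * (\<phi> x - \<phi> y) = real_of_int (a * t)"
  shows "real_of_int a ^ k / real_of_int b \<le> \<bar>\<phi> x - \<phi> y\<bar>"
proof -
  have pos: "a > 0" "b > 0" using ab a_gt_b by auto
  obtain \<alpha> where al: "\<not> int p dvd \<alpha>" "\<phi> x - \<phi> y = r ^ k * real_of_int \<alpha>"
    using Lev_form[OF assms(3)] by blast
  obtain t where t: "real_of_int b * (\<phi> x - \<phi> y) = real_of_int (a * t)" using str assms by blast
  have a0: "\<alpha> \<noteq> 0" using al by auto
  have "r ^ k * real_of_int b ^ k = real_of_int a ^ k" using pos by (simp add: ab(3) power_divide)
  then have "real_of_int a ^ k * real_of_int \<alpha> = real_of_int b ^ k * (\<phi> x - \<phi> y)"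
    using al(2) by (simp add: mult_ac)
  also have "\<dots> = real_of_int b ^ (k - 1) * (real_of_int b * (\<phi> x - \<phi> y))"
    using assms(4) by (cases k) auto
  also have "\<dots> = real_of_int (b ^ (k - 1) * (a * t))" using t by simp
  finally have "real_of_int (a ^ k * \<alpha>) = real_of_int (b ^ (k - 1) * (a * t))" by simp
  then have eq: "a ^ k * \<alpha> = b ^ (k - 1) * (a * t)" by (simp only: of_int_eq_iff)
  then have "a ^ k dvd b ^ (k - 1) * (a * t)" by (metis dvd_triv_left)
  moreover have "coprime (a ^ k) (b ^ (k - 1))" using ab(1) by simp
  ultimately have "a ^ k dvd a * t" by (simp add: coprime_dvd_mult_right_iff)
  moreover have "a * t \<noteq> 0" using eq a0 pos by auto
  ultimately have "a ^ k \<le> \<bar>a * t\<bar>" using pos by (intro zdvd_imp_le) auto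
  then have "real_of_int (a ^ k) \<le> \<bar>real_of_int (a * t)\<bar>" by (simp flip: of_int_abs del: of_int_power of_int_mult)
  also have "\<dots> = real_of_int b * \<bar>\<phi> x - \<phi> y\<bar>" unfolding t[symmetric] using pos by (simp add: abs_mult)
  finally show ?thesis using pos by (simp add: field_simps)
qed

text \<open>Distances are measured by \<open>\<phi>\<close>: a settled point is strictly closer to \<open>l0\<close> than every point at a level above \<open>n\<close>
from it. Of two such points neither can be closer, so settled points are orthogonal for the \<open>n\<close>-th partial product, and each point of \<open>\<Lambda>\<close> is settled for large \<open>n\<close>.\<close>
definition settled :: "'a \<Rightarrow> nat \<Rightarrow> 'a set" where
  "settled l0 n = {l\<in>\<Lambda>. \<forall>l'\<in>\<Lambda>. \<forall>k>n. f (P k (l - l')) = 0 \<longrightarrow> \<bar>\<phi> l - \<phi> l0\<bar> < \<bar>\<phi> l' - \<phi> l0\<bar>}"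

lemma settled_mono: "m \<le> n \<Longrightarrow> settled l0 m \<subseteq> settled l0 n"
  unfolding settled_def using le_less_trans by blast

lemma settled_partial_zero:
  assumes "x \<in> settled l0 n" "y \<in> settled l0 n" "x \<noteq> y"
  shows "partial n (x - y) = 0"
proof -
  have xy: "x \<in> \<Lambda>" "y \<in> \<Lambda>" using assms by (auto simp: settled_def)
  obtain k where k: "k \<ge> 1" "f (P k (x - y)) = 0" using Lev_total[OF xy assms(3)] by blast
  have "f (P k (y - x)) = 0" by (rule Lev_sym[OF k(2)])
  have "\<not> k > n"
  proof
    assume "k > n"
    then have "\<bar>\<phi> x - \<phi> l0\<bar> < \<bar>\<phi> y - \<phi> l0\<bar>" "\<bar>\<phi> y - \<phi> l0\<bar> < \<bar>\<phi> x - \<phi> l0\<bar>"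
      using assms(1,2) k(2) \<open>f (P k (y - x)) = 0\<close> xy unfolding settled_def by blast+
    then show False by simp
  qed
  then show ?thesis using k by (auto simp: partial_zero_iff)
qed

lemma eventually_settled:
  assumes "l \<in> \<Lambda>"
  shows "\<exists>n. l \<in> settled l0 n"
proof -
  obtain n where n: "r ^ n > 2 * \<bar>\<phi> l - \<phi> l0\<bar>" using power_exceeds by blast
  have "\<bar>\<phi> l - \<phi> l0\<bar> < \<bar>\<phi> l' - \<phi> l0\<bar>" if "k > n" "f (P k (l - l')) = 0" for k l'
  proof -
    have "r ^ n \<le> r ^ k" using that r_gt_1 by (intro power_increasing) auto
    also have "\<dots> \<le> \<bar>\<phi> l - \<phi> l'\<bar>" by (rule Lev_diff_ge[OF that(2)])
    also have "\<dots> \<le> \<bar>\<phi> l - \<phi> l0\<bar> + \<bar>\<phi> l' - \<phi> l0\<bar>"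
      using abs_triangle_ineq4[of "\<phi> l - \<phi> l0" "\<phi> l' - \<phi> l0"] by simp
    finally show ?thesis using n by simp
  qed
  then show ?thesis using assms by (auto simp: settled_def)
qed

lemma base_settled: "l0 \<in> \<Lambda> \<Longrightarrow> l0 \<in> settled l0 n"
  unfolding settled_def
proof (intro CollectI conjI ballI allI impI)
  fix l' k assume "f (P k (l0 - l')) = 0"
  from Lev_diff_ge[OF this] have "r ^ k \<le> \<bar>\<phi> l0 - \<phi> l'\<bar>" .
  moreover have "r ^ k > 0" using r_gt_1 by simp
  ultimately show "\<bar>\<phi> l0 - \<phi> l0\<bar> < \<bar>\<phi> l' - \<phi> l0\<bar>" by auto
qed

text \<open>\<open>T n\<close> is what the settled points still lack in Parseval's identity. The points added between \<open>m\<close> and \<open>n\<close>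
have small tails, and Bessel's inequality for the \<open>n\<close>-th partial product bounds their partial
contributions by the deficit at \<open>m\<close>; so the deficit shrinks only by a factor close to one.\<close>
lemma deficit_step:
  fixes F :: "'a set" and l0 \<xi> :: 'a
  defines "T n \<equiv> 1 - (\<Sum>l\<in>F \<inter> settled l0 n. (cmod (g (\<xi> + l)))\<^sup>2)"
  assumes F: "finite F" and mn: "m \<le> n" and \<kappa>: "\<kappa> \<ge> 0"
    and tail: "\<And>l. l \<in> settled l0 n - settled l0 m \<Longrightarrow> (cmod (g (P n (\<xi> + l))))\<^sup>2 \<le> \<kappa>"
  shows "(1 - \<kappa>) * T m \<le> T n" "0 \<le> T m"
proof -
  let ?R = "\<lambda>n. F \<inter> settled l0 n"
  have bessel: "(\<Sum>l\<in>?R n. (cmod (partial n (\<xi> + l)))\<^sup>2) \<le> 1" for n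
    using F by (intro positive_definite_bessel[OF positive_definite_partial partial_0])
      (auto intro: settled_partial_zero)
  have le: "(\<Sum>l\<in>?R m. (cmod (g (\<xi> + l)))\<^sup>2) \<le> (\<Sum>l\<in>?R m. (cmod (partial k (\<xi> + l)))\<^sup>2)" for m k
    by (intro sum_mono power_mono norm_g_le_partial) auto
  show "0 \<le> T m" unfolding T_def using le[of m m] bessel[of m] by linarith
  have split: "(\<Sum>l\<in>?R n. h l) = (\<Sum>l\<in>?R m. h l) + (\<Sum>l\<in>?R n - ?R m. h l)" for h :: "'a \<Rightarrow> real"
    using F settled_mono[OF mn] by (subst add.commute, intro sum.subset_diff) auto
  have "(\<Sum>l\<in>?R n - ?R m. (cmod (g (\<xi> + l)))\<^sup>2) \<le> (\<Sum>l\<in>?R n - ?R m. \<kappa> * (cmod (partial n (\<xi> + l)))\<^sup>2)"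
  proof (intro sum_mono)
    fix l assume "l \<in> ?R n - ?R m"
    then have "(cmod (g (P n (\<xi> + l))))\<^sup>2 \<le> \<kappa>" by (intro tail) auto
    then have "(cmod (partial n (\<xi> + l)))\<^sup>2 * (cmod (g (P n (\<xi> + l))))\<^sup>2 \<le> (cmod (partial n (\<xi> + l)))\<^sup>2 * \<kappa>"
      by (intro mult_left_mono) auto
    then show "(cmod (g (\<xi> + l)))\<^sup>2 \<le> \<kappa> * (cmod (partial n (\<xi> + l)))\<^sup>2"
      using g_factor[of "\<xi> + l" n] by (simp add: norm_mult power_mult_distrib mult.commute)
  qed
  also have "\<dots> = \<kappa> * (\<Sum>l\<in>?R n - ?R m. (cmod (partial n (\<xi> + l)))\<^sup>2)" by (simp add: sum_distrib_left)
  also have "\<dots> \<le> \<kappa> * T m"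
  proof (intro mult_left_mono \<kappa>)
    show "(\<Sum>l\<in>?R n - ?R m. (cmod (partial n (\<xi> + l)))\<^sup>2) \<le> T m"
      unfolding T_def using bessel[of n] split[of "\<lambda>l. (cmod (partial n (\<xi> + l)))\<^sup>2"] le[of m n] by linarith
  qed
  finally show "(1 - \<kappa>) * T m \<le> T n"
    unfolding T_def using split[of "\<lambda>l. (cmod (g (\<xi> + l)))\<^sup>2"] by (simp add: algebra_simps)
qed

text \<open>A point that becomes settled between \<open>m\<close> and \<open>n\<close> has distance at least \<open>a ^ (m + 1) / b\<close> from a point that
is no farther from \<open>l0\<close>, so its own distance from \<open>l0\<close> is at least half of that. Division by
\<open>r ^ n = (a / b) ^ n\<close> leaves a quantity that grows like a power of \<open>b ^ m\<close>, provided that \<open>n - m\<close> is a small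
fraction of \<open>m\<close>.\<close>
lemma new_element_tail:
  assumes str: "\<And>x y. x \<in> \<Lambda> \<Longrightarrow> y \<in> \<Lambda> \<Longrightarrow> \<exists>t. real_of_int b * (\<phi> x - \<phi> y) = real_of_int (a * t)"
    and l: "l \<in> settled l0 n - settled l0 m" and l0: "l0 \<in> \<Lambda>"
    and u: "a \<le> b ^ u" "u \<ge> 1" and mn: "m \<le> n" "2 * u * (n - m) \<le> m"
    and large: "2 ^ m \<ge> 4 * \<bar>\<phi> \<eta>\<bar>" "2 * u * N + 4 \<le> m"
  shows "r ^ N \<le> \<bar>\<phi> (P n (\<eta> - l0 + l))\<bar>"
proof -
  have pos: "real_of_int a > 0" "real_of_int b > 0" "real_of_int b \<ge> 2" "real_of_int a \<ge> real_of_int b"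
    using ab a_gt_b by auto
  have ab': "real_of_int a \<le> real_of_int b ^ u"
    using u(1) by (metis of_int_le_iff of_int_power)
  obtain l' k where k: "l' \<in> \<Lambda>" "k > m" "f (P k (l - l')) = 0" "\<bar>\<phi> l' - \<phi> l0\<bar> \<le> \<bar>\<phi> l - \<phi> l0\<bar>"
    using l by (auto simp: settled_def not_less)
  have lL: "l \<in> \<Lambda>" using l by (auto simp: settled_def)
  have "real_of_int a ^ Suc m / real_of_int b \<le> real_of_int a ^ k / real_of_int b"
    using k(2) pos by (intro divide_right_mono power_increasing) auto
  also have "\<dots> \<le> \<bar>\<phi> l - \<phi> l'\<bar>" using level_gap[OF lL k(1) k(3) _ str] k(2) by simp
  also have "\<dots> \<le> 2 * \<bar>\<phi> l - \<phi> l0\<bar>"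
    using k(4) abs_triangle_ineq4[of "\<phi> l - \<phi> l0" "\<phi> l' - \<phi> l0"] by simp
  finally have 1: "real_of_int a ^ Suc m / real_of_int b \<le> 2 * \<bar>\<phi> l - \<phi> l0\<bar>" .
  have "real_of_int a ^ m * 1 \<le> real_of_int a ^ m * (real_of_int a / real_of_int b)"
    using pos by (intro mult_left_mono) auto
  also have "\<dots> = real_of_int a ^ Suc m / real_of_int b" by simp
  finally have 2: "real_of_int a ^ m / 2 \<le> \<bar>\<phi> l - \<phi> l0\<bar>" using 1 by simp
  have "(2::real) ^ m \<le> real_of_int a ^ m" using pos by (intro power_mono) auto
  then have 3: "\<bar>\<phi> \<eta>\<bar> \<le> real_of_int a ^ m / 4" using large by linarith
  have phi: "\<phi> (\<eta> - l0 + l) = \<phi> \<eta> + (\<phi> l - \<phi> l0)" by (simp add: \<phi>_simps)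
  have 4: "real_of_int a ^ m / 4 \<le> \<bar>\<phi> (\<eta> - l0 + l)\<bar>" unfolding phi using 2 3 by linarith
  have rn: "r ^ n = real_of_int a ^ n / real_of_int b ^ n" by (simp add: ab(3) power_divide)
  have "r \<le> real_of_int a" unfolding ab(3) using pos by (simp add: field_simps)
  then have "r ^ N \<le> real_of_int a ^ N" using r_gt_1 by (intro power_mono) auto
  also have "\<dots> \<le> (real_of_int b ^ u) ^ N" using ab' pos by (intro power_mono) auto
  finally have "r ^ N \<le> real_of_int b ^ (u * N)" by (simp add: power_mult)
  moreover have "real_of_int a ^ (n - m) \<le> (real_of_int b ^ u) ^ (n - m)"
    using ab' pos by (intro power_mono) auto
  then have "real_of_int a ^ (n - m) \<le> real_of_int b ^ (u * (n - m))" by (simp add: power_mult)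
  moreover have "(2::real)\<^sup>2 \<le> real_of_int b ^ 2" using pos by (intro power_mono) auto
  ultimately have "r ^ N * (real_of_int a ^ (n - m) * 2\<^sup>2)
      \<le> real_of_int b ^ (u * N) * (real_of_int b ^ (u * (n - m)) * real_of_int b ^ 2)"
    using pos r_gt_1 by (intro mult_mono) auto
  also have "\<dots> = real_of_int b ^ (u * N + u * (n - m) + 2)" by (simp only: power_add mult.assoc)
  also have "\<dots> \<le> real_of_int b ^ n" using pos mn large(2) by (intro power_increasing) linarith+
  finally have 5: "r ^ N * (real_of_int a ^ (n - m) * 4) \<le> real_of_int b ^ n" by simp
  have "r ^ N * (real_of_int a ^ n * 4) = r ^ N * (real_of_int a ^ (n - m) * 4) * real_of_int a ^ m"
    using mn(1) by (simp add: power_add[symmetric] mult_ac)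
  also have "\<dots> \<le> real_of_int b ^ n * real_of_int a ^ m" using 5 pos by (intro mult_right_mono) auto
  finally have "r ^ N \<le> real_of_int a ^ m / 4 / r ^ n"
    unfolding rn using pos by (simp add: field_simps)
  also have "\<dots> \<le> \<bar>\<phi> (\<eta> - l0 + l)\<bar> / r ^ n" using 4 r_gt_1 by (intro divide_right_mono) auto
  finally show ?thesis by (simp add: abs_\<phi>_P)
qed

text \<open>Advance through levels in steps of a small constant proportion. A bounded number \<open>L\<close> of steps multiplies the
level by \<open>C\<close>, and each of them costs a factor \<open>1 - \<theta> ^ (2 * j)\<close> at most. As the costs are summable, the
deficit stays bounded below, for every finite part of \<open>\<Lambda>\<close> alike.\<close>
lemma noninteger_ratio_incomplete:
  assumes str: "\<And>x y. x \<in> \<Lambda> \<Longrightarrow> y \<in> \<Lambda> \<Longrightarrow> \<exists>t. real_of_int b * (\<phi> x - \<phi> y) = real_of_int (a * t)"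
  shows False
proof -
  obtain \<theta> C where \<theta>: "0 \<le> \<theta>" "\<theta> < 1" and C: "C \<ge> (2::nat)"
    and dec: "\<And>j x. r ^ (C ^ j) \<le> \<bar>\<phi> x\<bar> \<Longrightarrow> cmod (g x) \<le> \<theta> ^ j"
    using decay by blast
  obtain l0 where l0: "l0 \<in> \<Lambda>" using \<Lambda>_nonempty by blast
  obtain \<eta> where eta: "g \<eta> \<noteq> 0" "\<And>n. cmod (f (P n \<eta>)) < 1" using small_nonzero[of 1] by auto
  define \<xi> where "\<xi> = \<eta> - l0"
  obtain u where u: "real_of_int a < 2 ^ u" using real_arch_pow[of 2 "real_of_int a"] by auto
  have u1: "u \<ge> 1" using u ab a_gt_b by (cases u) auto
  have "real_of_int a < real_of_int (2 ^ u)" using u by simp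
  then have "a < 2 ^ u" by (simp only: of_int_less_iff)
  also have "2 ^ u \<le> b ^ u" using ab(2) by (intro power_mono) auto
  finally have au: "a \<le> b ^ u" by simp
  obtain n0 where n0: "4 * \<bar>\<phi> \<eta>\<bar> < 2 ^ n0" using real_arch_pow[of 2 "4 * \<bar>\<phi> \<eta>\<bar>"] by auto
  define b' where "b' = n0 + 4"
  \<comment> \<open>The \<open>i\<close>-th level of the \<open>j\<close>-th block; \<open>M j L = M (Suc j) 0\<close> for the \<open>L\<close> below.\<close>
  define M where "M j i = C ^ j * b' * (2 * u + i)" for j i
  define L where "L = 2 * u * (C - 1)"
  define q where "q = \<theta>\<^sup>2"
  have q: "0 \<le> q" "q < 1" using \<theta> by (auto simp: q_def power_less_one_iff)
  have M_L: "M j L = M (Suc j) 0" for j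
  proof -
    obtain C' where "C = Suc C'" using C by (cases C) auto
    then have "2 * u + L = C * (2 * u)" by (simp add: L_def)
    then show ?thesis by (simp add: M_def mult_ac)
  qed
  have M_step: "M j (Suc i) - M j i = C ^ j * b'" "M j i \<le> M j (Suc i)" for j i
    by (simp_all add: M_def algebra_simps)
  have M_ge: "M j i \<ge> C ^ j * b' * (2 * u)" for i j by (simp add: M_def)
  have C1: "C ^ j \<ge> 1" for j using C by simp
  have M_large: "2 * u * (C ^ j) + 4 \<le> M j i" "n0 \<le> M j i" for i j
  proof -
    have "1 * 1 \<le> C ^ j * u" using C1 u1 by (intro mult_le_mono) auto
    then have "1 \<le> C ^ j * u" by (simp only: mult_1)
    then have "2 * (C ^ j * u) * 1 + 4 \<le> 2 * (C ^ j * u) * 4" by linarith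
    also have "\<dots> \<le> 2 * (C ^ j * u) * b'" by (intro mult_le_mono) (auto simp: b'_def)
    also have "\<dots> = C ^ j * b' * (2 * u)" by simp
    finally show "2 * u * (C ^ j) + 4 \<le> M j i" using M_ge[of j i] by (simp add: mult_ac)
    have "1 * n0 * 1 \<le> C ^ j * b' * (2 * u)" using C1 u1 by (intro mult_le_mono) (auto simp: b'_def)
    then show "n0 \<le> M j i" using M_ge[of j i] by simp
  qed
  have tail: "(cmod (g (P (M j (Suc i)) (\<xi> + l))))\<^sup>2 \<le> q ^ j"
    if "l \<in> settled l0 (M j (Suc i)) - settled l0 (M j i)" for j i l
  proof -
    have "(2::real) ^ n0 \<le> 2 ^ M j i" using M_large by (intro power_increasing) auto
    then have pw: "4 * \<bar>\<phi> \<eta>\<bar> \<le> 2 ^ M j i" using n0 by linarith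
    have "r ^ (C ^ j) \<le> \<bar>\<phi> (P (M j (Suc i)) (\<eta> - l0 + l))\<bar>"
    proof (rule new_element_tail[OF str that l0 au u1 M_step(2) _ pw M_large(1)])
      show "2 * u * (M j (Suc i) - M j i) \<le> M j i"
        unfolding M_step(1) using M_ge[of j i] by (simp add: mult_ac)
    qed
    from dec[OF this] have "(cmod (g (P (M j (Suc i)) (\<xi> + l))))\<^sup>2 \<le> (\<theta> ^ j)\<^sup>2"
      by (intro power_mono) (auto simp: \<xi>_def)
    also have "(\<theta> ^ j)\<^sup>2 = q ^ j" by (simp add: q_def power_mult[symmetric] mult.commute)
    finally show ?thesis .
  qed
  define T where "T F n = 1 - (\<Sum>l\<in>F \<inter> settled l0 n. (cmod (g (\<xi> + l)))\<^sup>2)" for F n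
  have qj: "0 \<le> q ^ j" "q ^ j \<le> 1" for j using q by (auto intro: power_le_one)
  have T_step: "(1 - q ^ j) * T F (M j i) \<le> T F (M j (Suc i))" "0 \<le> T F (M j i)"
    if "finite F" for F i j
    unfolding T_def using deficit_step[OF that M_step(2)[of j i] qj(1)[of j] tail] by blast+
  have T_iter: "(1 - q ^ j) ^ i * T F (M j 0) \<le> T F (M j i)" if F: "finite F" for F i j
  proof (induction i)
    case (Suc i)
    have "(1 - q ^ j) ^ Suc i * T F (M j 0) = (1 - q ^ j) * ((1 - q ^ j) ^ i * T F (M j 0))" by simp
    also have "\<dots> \<le> (1 - q ^ j) * T F (M j i)" using Suc qj by (intro mult_left_mono) auto
    also have "\<dots> \<le> T F (M j (Suc i))" by (rule T_step(1)[OF F])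
    finally show ?case .
  qed simp
  have T_block: "(1 - real L * q ^ j) * T F (M j 0) \<le> T F (M (Suc j) 0)" if F: "finite F" for F j
  proof -
    have "1 + real L * (- (q ^ j)) \<le> (1 + - (q ^ j)) ^ L" using qj by (intro Bernoulli_inequality) auto
    then have "(1 - real L * q ^ j) * T F (M j 0) \<le> (1 - q ^ j) ^ L * T F (M j 0)"
      using T_step(2)[OF F] by (intro mult_right_mono) auto
    also have "\<dots> \<le> T F (M j L)" by (rule T_iter[OF F])
    finally show ?thesis by (simp add: M_L)
  qed
  have "(\<lambda>j. real L * (q ^ j / (1 - q))) \<longlonglongrightarrow> real L * (0 / (1 - q))"
    using q by (intro tendsto_intros LIMSEQ_realpow_zero) auto
  then have "eventually (\<lambda>j. real L * (q ^ j / (1 - q)) < 1 / 2) sequentially"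
    by (rule order_tendstoD) simp
  then obtain j0 where j0: "real L * (q ^ j0 / (1 - q)) < 1 / 2" by (auto simp: eventually_sequentially)
  define A where "A = real L * q ^ j0"
  have A: "0 \<le> A" "A / (1 - q) < 1 / 2" using j0 qj by (auto simp: A_def)
  have T_low: "(1 - A * (\<Sum>k<i. q ^ k)) * T F (M j0 0) \<le> T F (M (j0 + i) 0)" if F: "finite F" for F i
  proof (induction i)
    case (Suc i)
    have s0: "0 \<le> (\<Sum>k<i. q ^ k)" using qj by (intro sum_nonneg) auto
    have Aq: "A * q ^ i = real L * q ^ (j0 + i)" by (simp add: A_def power_add)
    have "A * q ^ i \<le> A / (1 - q)"
    proof -
      have "A * q ^ i \<le> A * 1" using A qj by (intro mult_left_mono) auto
      also have "\<dots> \<le> A / (1 - q)" using A q by (simp add: field_simps mult_left_le)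
      finally show ?thesis .
    qed
    then have Aq1: "A * q ^ i \<le> 1" using A by linarith
    have "1 - A * (\<Sum>k<Suc i. q ^ k) \<le> (1 - A * q ^ i) * (1 - A * (\<Sum>k<i. q ^ k))"
      using A qj s0 by (simp add: algebra_simps)
    then have "(1 - A * (\<Sum>k<Suc i. q ^ k)) * T F (M j0 0)
        \<le> (1 - A * q ^ i) * (1 - A * (\<Sum>k<i. q ^ k)) * T F (M j0 0)"
      using T_step(2)[OF F] by (intro mult_right_mono)
    also have "\<dots> \<le> (1 - A * q ^ i) * T F (M (j0 + i) 0)"
      unfolding mult.assoc using Suc Aq1 by (intro mult_left_mono) auto
    also have "\<dots> \<le> T F (M (j0 + Suc i) 0)" unfolding Aq using T_block[OF F, of "j0 + i"] by simp
    finally show ?case .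
  qed simp
  have half: "T F (M j0 0) / 2 \<le> T F (M (j0 + i) 0)" if F: "finite F" for F i
  proof -
    have "(\<Sum>k<i. q ^ k) \<le> 1 / (1 - q)"
      using q qj[of i] by (simp add: sum_gp_strict divide_right_mono)
    then have "A * (\<Sum>k<i. q ^ k) \<le> A * (1 / (1 - q))" using A by (intro mult_left_mono) auto
    moreover have "A * (1 / (1 - q)) = A / (1 - q)" by simp
    ultimately have "1 / 2 \<le> 1 - A * (\<Sum>k<i. q ^ k)" using A(2) by linarith
    from mult_right_mono[OF this T_step(2)[OF F, of j0 0]]
    show ?thesis using T_low[OF F, of i] by linarith
  qed
  define m where "m = M j0 0"
  define e0 where "e0 = (cmod (partial m \<eta>))\<^sup>2 - (cmod (g \<eta>))\<^sup>2"
  have e0: "e0 > 0"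
  proof -
    have "cmod (g (P m \<eta>)) \<le> cmod (f (P (Suc m) \<eta>)) * 1"
      using g_refine[of "P m \<eta>"] by (simp add: P_P norm_mult mult_left_le norm_g_le_1)
    then have "cmod (g (P m \<eta>)) < 1" using eta(2)[of "Suc m"] by simp
    moreover have "partial m \<eta> \<noteq> 0" using eta(1) g_factor[of \<eta> m] by auto
    ultimately have "cmod (g \<eta>) < cmod (partial m \<eta>)"
      using g_factor[of \<eta> m] by (simp add: norm_mult)
    then show ?thesis by (simp add: e0_def power_strict_mono)
  qed
  have T_base: "e0 \<le> T F m" if F: "finite F" for F
  proof -
    let ?G = "insert l0 (F \<inter> settled l0 m)"
    have "(\<Sum>l\<in>F \<inter> settled l0 m. (cmod (g (\<xi> + l)))\<^sup>2) \<le> (\<Sum>l\<in>?G. (cmod (g (\<xi> + l)))\<^sup>2)"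
      using F by (intro sum_mono2) auto
    also have "\<dots> = (cmod (g \<eta>))\<^sup>2 + (\<Sum>l\<in>?G - {l0}. (cmod (g (\<xi> + l)))\<^sup>2)"
      using F by (subst sum.remove[of _ l0]) (auto simp: \<xi>_def)
    also have "(\<Sum>l\<in>?G - {l0}. (cmod (g (\<xi> + l)))\<^sup>2) \<le> (\<Sum>l\<in>?G - {l0}. (cmod (partial m (\<xi> + l)))\<^sup>2)"
      by (intro sum_mono power_mono norm_g_le_partial) auto
    also have "\<dots> = (\<Sum>l\<in>?G. (cmod (partial m (\<xi> + l)))\<^sup>2) - (cmod (partial m \<eta>))\<^sup>2"
      using F by (subst (2) sum.remove[of _ l0]) (auto simp: \<xi>_def)
    also have "(\<Sum>l\<in>?G. (cmod (partial m (\<xi> + l)))\<^sup>2) \<le> 1"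
      using F base_settled[OF l0] by (intro positive_definite_bessel[OF positive_definite_partial partial_0])
        (auto intro: settled_partial_zero)
    finally show ?thesis by (simp add: T_def e0_def)
  qed
  obtain F where F: "F \<subseteq> \<Lambda>" "finite F" "(\<Sum>l\<in>F. (cmod (g (\<xi> + l)))\<^sup>2) > 1 - e0 / 2"
    using complete[of "e0 / 2" \<xi>] e0 by auto
  have "\<exists>n. F \<subseteq> settled l0 n"
    using F(2,1)
  proof (induction F rule: finite_induct)
    case (insert x F)
    then obtain n1 n2 where "F \<subseteq> settled l0 n1" "x \<in> settled l0 n2" using eventually_settled by blast
    then show ?case using settled_mono[of n1 "max n1 n2" l0] settled_mono[of n2 "max n1 n2" l0]
      by (intro exI[of _ "max n1 n2"]) auto
  qed auto
  then obtain n where n: "F \<subseteq> settled l0 n" by blast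
  have "n < C ^ (j0 + n)"
  proof -
    have "n < 2 ^ n" by simp
    also have "\<dots> \<le> 2 ^ (j0 + n)" by (intro power_increasing) auto
    also have "\<dots> \<le> C ^ (j0 + n)" using C by (intro power_mono) auto
    finally show ?thesis .
  qed
  also have "\<dots> * 1 * 1 \<le> C ^ (j0 + n) * b' * (2 * u)" using u1 by (intro mult_le_mono) (auto simp: b'_def)
  finally have "n \<le> M (j0 + n) 0" by (simp add: M_def)
  then have "F \<inter> settled l0 (M (j0 + n) 0) = F" using n settled_mono by blast
  then have "T F (M (j0 + n) 0) < e0 / 2" using F(3) by (simp add: T_def)
  then show False using half[OF F(2), of n] T_base[OF F(2)] by (simp add: m_def)
qed

end

text \<open>The ratio is rational with \<open>p\<close> dividing its numerator, and a denominator greater than one contradicts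
completeness.\<close>
theorem r_multiple_of_p: "\<exists>k::int. r = real_of_int (int p * k)"
proof -
  obtain a b where ab: "coprime a b" "b > 0" "r = real_of_int a / real_of_int b" "int p dvd a"
    and str: "\<forall>x\<in>\<Lambda>. \<forall>y\<in>\<Lambda>. \<exists>t. real_of_int b * (\<phi> x - \<phi> y) = real_of_int (a * t)"
    using levels_force_rational_ratio(1) by blast
  have "\<not> b \<ge> 2" using noninteger_ratio_incomplete[OF ab(1) _ ab(3)] str by blast
  then have "b = 1" using ab(2) by linarith
  then show ?thesis using ab by (auto elim!: dvdE)
qed

end

section \<open>Construction of a spectrum\<close>

text \<open>Compactness of a fundamental domain makes the nonvanishing uniform, with a margin for perturbations.\<close>
lemma uniform_nonvanishing:
  fixes g :: "'a::euclidean_space \<Rightarrow> complex"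
  assumes cont: "continuous_on UNIV g" and C: "compact C"
    and cover: "\<And>y. \<exists>k\<in>\<Gamma>. y + k \<in> C" and add: "\<And>k l. k \<in> \<Gamma> \<Longrightarrow> l \<in> \<Gamma> \<Longrightarrow> k + l \<in> \<Gamma>"
    and nz: "\<And>y. \<exists>k\<in>\<Gamma>. g (y + k) \<noteq> 0"
  shows "\<exists>\<epsilon>>0. \<exists>\<delta>>0. \<forall>y. \<exists>k\<in>\<Gamma>. \<forall>w. norm w < \<delta> \<longrightarrow> \<epsilon> \<le> cmod (g (y + k + w))"
proof -
  obtain K where K: "\<And>y. K y \<in> \<Gamma>" "\<And>y. g (y + K y) \<noteq> 0" using nz by metis
  define G where "G c = {y. cmod (g (c + K c)) / 2 < cmod (g (y + K c))}" for c
  have G_open: "open (G c)" for c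
    unfolding G_def by (intro open_Collect_less continuous_intros continuous_on_compose2[OF cont]) auto
  have "c \<in> G c" for c using K(2)[of c] by (simp add: G_def)
  then have "C \<subseteq> \<Union> (G ` C)" by blast
  then obtain A where A: "A \<subseteq> C" "finite A" "C \<subseteq> \<Union> (G ` A)"
    using compactE_image[OF C, of C G] G_open by (metis UN_iff)
  obtain e where e: "e > 0" "\<And>x. x \<in> C \<Longrightarrow> \<exists>B\<in>G ` A. ball x e \<subseteq> B"
    using Heine_Borel_lemma[OF C A(3)] G_open by blast
  define \<epsilon> where "\<epsilon> = Min (insert 1 ((\<lambda>c. cmod (g (c + K c)) / 2) ` A))"
  have "\<epsilon> > 0" unfolding \<epsilon>_def using A(2) K(2) by (subst Min_gr_iff) auto
  moreover have "\<exists>k\<in>\<Gamma>. \<forall>w. norm w < e \<longrightarrow> \<epsilon> \<le> cmod (g (y + k + w))" for y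
  proof -
    obtain k where k: "k \<in> \<Gamma>" "y + k \<in> C" using cover by blast
    obtain c where c: "c \<in> A" "ball (y + k) e \<subseteq> G c" using e(2)[OF k(2)] by blast
    have "\<epsilon> \<le> cmod (g (y + (k + K c) + w))" if w: "norm w < e" for w
    proof -
      have "y + k + w \<in> ball (y + k) e" using w by (simp add: dist_norm)
      then have "cmod (g (c + K c)) / 2 < cmod (g (y + k + w + K c))" using c by (auto simp: G_def)
      moreover have "\<epsilon> \<le> cmod (g (c + K c)) / 2" unfolding \<epsilon>_def using A(2) c(1) by (intro Min_le) auto
      ultimately show ?thesis by (simp add: algebra_simps)
    qed
    then show ?thesis using add[OF k(1) K(1)] by blast
  qed
  ultimately show ?thesis using e(1) by blast
qed

text \<open>\<open>U n\<close> is the inverse of \<open>P n\<close>. The digits \<open>s j\<close> form a spectrum of the uniform measure on \<open>D\<close>, and all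
translations by \<open>\<Gamma>\<close>, as well as by positive powers of the matrix applied to shifted digits, are periods of \<open>f\<close>.\<close>
locale digit_tower = refinable +
  fixes U :: "nat \<Rightarrow> 'a \<Rightarrow> 'a" and \<Gamma> \<Omega> :: "'a set" and s :: "nat \<Rightarrow> 'a" and p :: nat
  assumes U_linear: "\<And>n. linear (U n)"
    and P_U: "\<And>i n x. i \<le> n \<Longrightarrow> P i (U n x) = U (n - i) x" and U_0: "\<And>x. U 0 x = x"
    and period_\<Gamma>: "\<And>k x. k \<in> \<Gamma> \<Longrightarrow> f (x + k) = f x"
    and period_\<Omega>: "\<And>i v x. i \<ge> 1 \<Longrightarrow> v \<in> \<Omega> \<Longrightarrow> f (x + U i v) = f x"
    and digit: "\<And>j k. j < p \<Longrightarrow> k \<in> \<Gamma> \<Longrightarrow> s j + k \<in> \<Omega>"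
    and digit_0: "s 0 = 0" and p_pos: "p > 0"
    and digit_orth: "\<And>i j. i < p \<Longrightarrow> j < p \<Longrightarrow> i \<noteq> j \<Longrightarrow> f (s i - s j) = 0"
    and digit_parseval: "\<And>x. (\<Sum>j<p. (cmod (f (x + s j)))\<^sup>2) = 1"
    and nonvanishing: "\<exists>\<epsilon>>0. \<exists>\<delta>>0. \<forall>y. \<exists>k\<in>\<Gamma>. \<forall>w. norm w < \<delta> \<longrightarrow> \<epsilon> \<le> cmod (g (y + k + w))"
begin

lemmas U_simps = linear_add[OF U_linear] linear_diff[OF U_linear] linear_0[OF U_linear]

context
  fixes \<epsilon> \<delta> :: real and K :: "'a \<Rightarrow> 'a"
  assumes pos: "\<epsilon> > 0" "\<delta> > 0" and K: "\<And>y. K y \<in> \<Gamma>"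
    "\<And>y w. norm w < \<delta> \<Longrightarrow> \<epsilon> \<le> cmod (g (y + K y + w))"
begin

text \<open>The digit zero keeps the parent, so that the trees grow. Any other digit is shifted along the period
lattice to a place where \<open>g\<close> is bounded below; periodicity makes the shift invisible to the first \<open>Suc n\<close> factors.\<close>
definition child :: "nat \<Rightarrow> 'a \<Rightarrow> nat \<Rightarrow> 'a" where
  "child n l j = (if j = 0 then l else l + U (Suc n) (s j + K (P (Suc n) l + s j)))"

primrec tree :: "nat \<Rightarrow> 'a set" where
  "tree 0 = {0}"
| "tree (Suc n) = (\<Union>l\<in>tree n. child n l ` {..<p})"

lemma child_eq:
  assumes "j < p"
  shows "\<exists>v\<in>\<Omega>. child n l j = l + U (Suc n) v \<or> child n l j = l"
    and "f (P (Suc n) (x + child n l j)) = f (P (Suc n) (x + l) + s j)"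
    and "i \<le> n \<Longrightarrow> f (P i (x + child n l j)) = f (P i (x + l))"
proof -
  let ?k = "K (P (Suc n) l + s j)"
  have v: "s j + ?k \<in> \<Omega>" by (rule digit[OF assms K(1)])
  then show "\<exists>v\<in>\<Omega>. child n l j = l + U (Suc n) v \<or> child n l j = l"
    unfolding child_def by auto
  show "f (P (Suc n) (x + child n l j)) = f (P (Suc n) (x + l) + s j)"
  proof (cases "j = 0")
    case False
    have "P (Suc n) (x + child n l j) = (P (Suc n) (x + l) + s j) + ?k"
      using False by (simp add: child_def P_simps P_U U_0 algebra_simps)
    then show ?thesis using period_\<Gamma>[OF K(1)] by simp
  qed (simp add: child_def digit_0)
  show "f (P i (x + child n l j)) = f (P i (x + l))" if i: "i \<le> n"
  proof (cases "j = 0")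
    case False
    have "P i (x + child n l j) = P i (x + l) + U (Suc n - i) (s j + ?k)"
      using False i by (simp add: child_def P_simps P_U algebra_simps)
    then show ?thesis using period_\<Omega>[OF _ v, of "Suc n - i"] i by simp
  qed (simp add: child_def)
qed

lemma partial_child:
  assumes "j < p"
  shows "partial n (x + child n l j) = partial n (x + l)"
  unfolding partial_def using child_eq(3)[OF assms] by (intro prod.cong) auto

lemma tree_Suc: "tree n \<subseteq> tree (Suc n)"
proof
  fix l assume "l \<in> tree n"
  moreover have "child n l 0 = l" by (simp add: child_def)
  ultimately show "l \<in> tree (Suc n)" using p_pos by (auto intro!: bexI[of _ l] image_eqI[of _ _ 0])
qed

lemma tree_mono: "m \<le> n \<Longrightarrow> tree m \<subseteq> tree n"
  using lift_Suc_mono_le[of tree] tree_Suc by blast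

lemma finite_tree: "finite (tree n)"
  by (induction n) auto

lemma child_separates:
  assumes "i < p" "j < p" "i \<noteq> j"
  shows "f (P (Suc n) (child n l i - child n l j)) = 0"
proof -
  have "f (P (Suc n) (child n l i - child n l j)) = f (P (Suc n) (- child n l j + child n l i))" by simp
  also have "\<dots> = f (P (Suc n) (- child n l j + l) + s i)" by (rule child_eq(2)[OF assms(1)])
  also have "\<dots> = cnj (f (- (P (Suc n) (- child n l j + l) + s i)))" using f_minus by (metis complex_cnj_cnj)
  also have "- (P (Suc n) (- child n l j + l) + s i) = P (Suc n) ((U (Suc n) (- s i) - l) + child n l j)"
    by (simp add: P_simps P_U U_0)
  also have "f \<dots> = f (P (Suc n) ((U (Suc n) (- s i) - l) + l) + s j)" by (rule child_eq(2)[OF assms(2)])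
  also have "P (Suc n) ((U (Suc n) (- s i) - l) + l) + s j = s j - s i"
    by (simp add: P_U U_0)
  also have "f (s j - s i) = 0" using digit_orth assms by metis
  finally show ?thesis by simp
qed

lemma tree_separates:
  "x \<in> tree n \<Longrightarrow> y \<in> tree n \<Longrightarrow> x \<noteq> y \<Longrightarrow> \<exists>i\<ge>1. i \<le> n \<and> f (P i (x - y)) = 0"
proof (induction n arbitrary: x y)
  case (Suc n)
  then obtain l j l' j' where x: "l \<in> tree n" "j < p" "x = child n l j"
    and y: "l' \<in> tree n" "j' < p" "y = child n l' j'" by auto
  show ?case
  proof (cases "l = l'")
    case True
    then have "j \<noteq> j'" using Suc.prems x y by auto
    then have "f (P (Suc n) (x - y)) = 0" using child_separates x y True by simp
    then show ?thesis by (intro exI[of _ "Suc n"]) auto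
  next
    case False
    then obtain i where i: "i \<ge> 1" "i \<le> n" "f (P i (l - l')) = 0" using Suc.IH x y by blast
    have "f (P i (x - y)) = f (P i (- y + child n l j))" by (simp add: x(3))
    also have "\<dots> = f (P i (- y + l))" by (rule child_eq(3)[OF x(2) i(2)])
    also have "\<dots> = cnj (f (P i (- l + child n l' j')))"
      using f_minus[of "P i (- l + y)"] by (simp add: P_simps y(3))
    also have "f (P i (- l + child n l' j')) = f (P i (- l + l'))" by (rule child_eq(3)[OF y(2) i(2)])
    also have "\<dots> = 0" using i(3) f_minus[of "P i (l - l')"] by (simp add: P_simps)
    finally show ?thesis using i by (intro exI[of _ i]) auto
  qed
qed simp

lemma inj_on_child: "inj_on (\<lambda>(l, j). child n l j) (tree n \<times> {..<p})"
proof (rule inj_onI)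
  fix x y :: "'a \<times> nat"
  assume x: "x \<in> tree n \<times> {..<p}" and y: "y \<in> tree n \<times> {..<p}"
    and eq: "(\<lambda>(l, j). child n l j) x = (\<lambda>(l, j). child n l j) y"
  obtain l j l' j' where xy: "x = (l, j)" "y = (l', j')" by (cases x, cases y)
  have *: "l \<in> tree n" "j \<in> {..<p}" "l' \<in> tree n" "j' \<in> {..<p}" "child n l j = child n l' j'"
    using x y eq by (auto simp: xy)
  have "l = l'"
  proof (rule ccontr)
    assume "l \<noteq> l'"
    then obtain i where i: "i \<le> n" "f (P i (l - l')) = 0" using tree_separates * by blast
    have "f (P i (- l' + l)) = f (P i (- l' + child n l j))" using child_eq(3)[of j i n "- l'" l] i * by simp
    also have "\<dots> = f (P i (- l' + l'))" unfolding *(5) using child_eq(3)[of j' i n "- l'" l'] i * by simp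
    finally show False using i f_0 by (simp add: P_simps)
  qed
  moreover have "j = j'"
  proof (rule ccontr)
    assume "j \<noteq> j'"
    then have "f (P (Suc n) (child n l j - child n l' j')) = 0" using child_separates[of j j' n l] * calculation by auto
    moreover have "child n l j - child n l' j' = 0" using *(5) by simp
    ultimately show False using f_0 by (simp only: P_simps) simp
  qed
  ultimately show "x = y" by (simp add: xy)
qed

text \<open>By periodicity, the children of a node share its first \<open>n\<close> factors, and Parseval's identity for the digits
takes care of the next one.\<close>
lemma tree_parseval: "(\<Sum>l\<in>tree n. (cmod (partial n (x + l)))\<^sup>2) = 1"
proof (induction n)
  case 0 show ?case by (simp add: partial_def)
next
  case (Suc n)
  have "tree (Suc n) = (\<lambda>(l, j). child n l j) ` (tree n \<times> {..<p})" by auto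
  then have "(\<Sum>l\<in>tree (Suc n). (cmod (partial (Suc n) (x + l)))\<^sup>2)
      = (\<Sum>(l, j)\<in>tree n \<times> {..<p}. (cmod (partial (Suc n) (x + child n l j)))\<^sup>2)"
    using inj_on_child by (simp add: sum.reindex case_prod_unfold)
  also have "\<dots> = (\<Sum>l\<in>tree n. \<Sum>j<p. (cmod (partial (Suc n) (x + child n l j)))\<^sup>2)"
    by (simp add: sum.cartesian_product)
  also have "\<dots> = (\<Sum>l\<in>tree n. \<Sum>j<p. (cmod (partial n (x + l)))\<^sup>2 * (cmod (f (P (Suc n) (x + l) + s j)))\<^sup>2)"
    by (intro sum.cong refl) (auto simp: partial_Suc partial_child child_eq(2) norm_mult power_mult_distrib)
  also have "\<dots> = 1" using Suc by (simp add: sum_distrib_left[symmetric] digit_parseval)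
  finally show ?case .
qed

text \<open>Every element was chosen, at the step at which it appeared, so that its tail is bounded below;
  as the modulus of a tail only grows with the index, this bound persists.\<close>

lemma tree_birth:
  "l \<in> tree n \<Longrightarrow> \<exists>b\<le>n. l \<in> tree b \<and> (b = 0 \<or> (\<forall>w. norm w < \<delta> \<longrightarrow> \<epsilon> \<le> cmod (g (P b l + w))))"
proof (induction n arbitrary: l)
  case (Suc n)
  then obtain l' j where l: "l' \<in> tree n" "j < p" "l = child n l' j" by auto
  show ?case
  proof (cases "j = 0")
    case True
    then have "l = l'" using l by (simp add: child_def)
    moreover obtain b where "b \<le> n" "l' \<in> tree b" "b = 0 \<or> (\<forall>w. norm w < \<delta> \<longrightarrow> \<epsilon> \<le> cmod (g (P b l' + w)))"
      using Suc.IH[OF l(1)] by blast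
    ultimately show ?thesis by (intro exI[of _ b]) simp
  next
    case False
    have "P (Suc n) l = (P (Suc n) l' + s j) + K (P (Suc n) l' + s j)"
      using l False by (simp add: child_def P_simps P_U U_0)
    then show ?thesis using K(2) Suc.prems by (intro exI[of _ "Suc n"]) auto
  qed
qed auto

lemma tail_lower_bound:
  "\<exists>c>0. \<exists>N. \<forall>n\<ge>N. \<forall>l\<in>tree n. c \<le> cmod (g (P n (\<xi> + l)))"
proof -
  have "eventually (\<lambda>n. dist (P n \<xi>) 0 < \<delta>) sequentially"
    using P_tendsto[of \<xi>] pos(2) by (rule tendstoD)
  then obtain b0 where b0: "\<And>b. b \<ge> b0 \<Longrightarrow> norm (P b \<xi>) < \<delta>"
    by (auto simp: eventually_sequentially)
  have "eventually (\<lambda>n. \<forall>l\<in>tree b0. dist (g (P n (\<xi> + l))) 1 < 1 / 2) sequentially"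
    by (intro eventually_ball_finite finite_tree ballI tendstoD[OF g_tail_tendsto]) auto
  then obtain N where N: "\<And>n l. n \<ge> N \<Longrightarrow> l \<in> tree b0 \<Longrightarrow> dist (g (P n (\<xi> + l))) 1 < 1 / 2"
    by (auto simp: eventually_sequentially)
  have "min \<epsilon> (1 / 2) \<le> cmod (g (P n (\<xi> + l)))" if n: "n \<ge> N" and l: "l \<in> tree n" for n l
  proof -
    obtain b where b: "b \<le> n" "l \<in> tree b" "b = 0 \<or> (\<forall>w. norm w < \<delta> \<longrightarrow> \<epsilon> \<le> cmod (g (P b l + w)))"
      using tree_birth[OF l] by blast
    show ?thesis
    proof (cases "b \<le> b0")
      case True
      then have "l \<in> tree b0" using b tree_mono by blast
      then have "dist (g (P n (\<xi> + l))) 1 < 1 / 2" using N n by blast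
      moreover have "cmod 1 - cmod (g (P n (\<xi> + l))) \<le> cmod (1 - g (P n (\<xi> + l)))"
        by (rule norm_triangle_ineq2)
      ultimately show ?thesis by (simp add: dist_norm norm_minus_commute)
    next
      case False
      then have "\<epsilon> \<le> cmod (g (P b l + P b \<xi>))" using b b0[of b] by auto
      also have "\<dots> = cmod (g (P b (\<xi> + l)))" by (simp add: P_simps add.commute)
      also have "\<dots> \<le> cmod (g (P (n - b) (P b (\<xi> + l))))" by (rule norm_g_le_tail)
      also have "\<dots> = cmod (g (P n (\<xi> + l)))" using b(1) by (simp add: P_P)
      finally show ?thesis by simp
    qed
  qed
  then show ?thesis using pos(1) by (intro exI[of _ "min \<epsilon> (1 / 2)"]) auto
qed

text \<open>The lower bound on the tails makes \<open>\<bar>g (\<xi> + l)\<bar>\<^sup>2\<close> a summable majorant, up to a constant, of the summands in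
Parseval's identity for the partial products; this identity therefore passes to the limit.\<close>
lemma tree_complete:
  assumes \<eta>: "\<eta> > 0"
  shows "\<exists>F\<subseteq>(\<Union>n. tree n). finite F \<and> (\<Sum>l\<in>F. (cmod (g (\<xi> + l)))\<^sup>2) > 1 - \<eta>"
proof -
  define h where "h l = (cmod (g (\<xi> + l)))\<^sup>2" for l
  define S where "S n = (\<Sum>l\<in>tree n. h l)" for n
  have h0: "h l \<ge> 0" for l by (simp add: h_def)
  obtain c N where c: "c > 0" "\<And>n l. n \<ge> N \<Longrightarrow> l \<in> tree n \<Longrightarrow> c \<le> cmod (g (P n (\<xi> + l)))"
    using tail_lower_bound by blast
  have dom: "(cmod (partial n (\<xi> + l)))\<^sup>2 * c\<^sup>2 \<le> h l" if "n \<ge> N" "l \<in> tree n" for n l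
  proof -
    have "c\<^sup>2 \<le> (cmod (g (P n (\<xi> + l))))\<^sup>2" using c(2)[OF that] c(1) by (intro power_mono) auto
    then have "(cmod (partial n (\<xi> + l)))\<^sup>2 * c\<^sup>2 \<le> (cmod (partial n (\<xi> + l)))\<^sup>2 * (cmod (g (P n (\<xi> + l))))\<^sup>2"
      by (intro mult_left_mono) auto
    then show ?thesis unfolding h_def using g_factor[of "\<xi> + l" n] by (simp add: norm_mult power_mult_distrib)
  qed
  have S_le: "S n \<le> 1" for n
  proof -
    have "S n \<le> (\<Sum>l\<in>tree n. (cmod (partial n (\<xi> + l)))\<^sup>2)"
      unfolding S_def h_def by (intro sum_mono power_mono norm_g_le_partial) auto
    then show ?thesis by (simp add: tree_parseval)
  qed
  have S_mono: "S m \<le> S n" if "m \<le> n" for m n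
    unfolding S_def by (intro sum_mono2 finite_tree tree_mono that h0)
  then have "incseq S" by (simp add: incseq_def)
  then obtain L where L: "S \<longlonglongrightarrow> L" "\<And>n. S n \<le> L" using incseq_convergent[of S 1] S_le by metis
  have "eventually (\<lambda>n. S n > L - c\<^sup>2 * \<eta> / 3) sequentially"
    using c \<eta> by (intro order_tendstoD(1)[OF L(1)]) auto
  then obtain m where m: "m \<ge> N" "S m > L - c\<^sup>2 * \<eta> / 3"
    unfolding eventually_sequentially by (meson nat_le_linear order_refl)
  have "(\<lambda>n. \<Sum>l\<in>tree m. (cmod (partial n (\<xi> + l)))\<^sup>2) \<longlonglongrightarrow> S m"
    unfolding S_def h_def by (intro tendsto_intros partial_tendsto)
  then have "eventually (\<lambda>n. (\<Sum>l\<in>tree m. (cmod (partial n (\<xi> + l)))\<^sup>2) < S m + \<eta> / 3) sequentially"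
    using \<eta> by (intro order_tendstoD(2)) auto
  then obtain n where n: "n \<ge> m" "(\<Sum>l\<in>tree m. (cmod (partial n (\<xi> + l)))\<^sup>2) < S m + \<eta> / 3"
    unfolding eventually_sequentially by (meson nat_le_linear order_refl)
  have sub: "tree m \<subseteq> tree n" using tree_mono[OF n(1)] .
  have split: "sum k (tree n) = sum k (tree m) + sum k (tree n - tree m)" for k :: "'a \<Rightarrow> real"
    using sum.subset_diff[OF sub finite_tree, of k] by simp
  have "(\<Sum>l\<in>tree n - tree m. (cmod (partial n (\<xi> + l)))\<^sup>2) * c\<^sup>2 \<le> (\<Sum>l\<in>tree n - tree m. h l)"
    unfolding sum_distrib_right using m n by (intro sum_mono dom) auto
  also have "\<dots> \<le> c\<^sup>2 * \<eta> / 3" using split[of h] L(2)[of n] m(2) by (simp add: S_def)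
  finally have "(\<Sum>l\<in>tree n - tree m. (cmod (partial n (\<xi> + l)))\<^sup>2) \<le> \<eta> / 3"
    using c by (simp add: field_simps)
  then have "1 \<le> S m + \<eta> / 3 + \<eta> / 3"
    using split[of "\<lambda>l. (cmod (partial n (\<xi> + l)))\<^sup>2"] tree_parseval[of n \<xi>] n(2) by linarith
  then have "S m > 1 - \<eta>" using \<eta> by simp
  then have "(\<Sum>l\<in>tree m. (cmod (g (\<xi> + l)))\<^sup>2) > 1 - \<eta>" by (simp only: S_def h_def)
  then show ?thesis using finite_tree[of m] by blast
qed

lemma tree_orthogonal:
  assumes "x \<in> (\<Union>n. tree n)" "y \<in> (\<Union>n. tree n)" "x \<noteq> y"
  shows "g (x - y) = 0"
proof -
  obtain m n where "x \<in> tree m" "y \<in> tree n" using assms by blast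
  then have "x \<in> tree (max m n)" "y \<in> tree (max m n)"
    using tree_mono[of m "max m n"] tree_mono[of n "max m n"] by auto
  then obtain i where "i \<ge> 1" "f (P i (x - y)) = 0" using tree_separates assms(3) by blast
  then show ?thesis using g_zero_iff[of "x - y"] by blast
qed

end

theorem exists_complete_set:
  "\<exists>\<Lambda>. countable \<Lambda> \<and> (\<forall>x\<in>\<Lambda>. \<forall>y\<in>\<Lambda>. x \<noteq> y \<longrightarrow> g (x - y) = 0) \<and>
    (\<forall>\<xi> \<eta>. \<eta> > 0 \<longrightarrow> (\<exists>F\<subseteq>\<Lambda>. finite F \<and> (\<Sum>l\<in>F. (cmod (g (\<xi> + l)))\<^sup>2) > 1 - \<eta>))"
proof -
  obtain \<epsilon> \<delta> where *: "\<epsilon> > 0" "\<delta> > 0"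
    "\<forall>y. \<exists>k\<in>\<Gamma>. \<forall>w. norm w < \<delta> \<longrightarrow> \<epsilon> \<le> cmod (g (y + k + w))"
    using nonvanishing by blast
  then have "\<exists>K. \<forall>y. K y \<in> \<Gamma> \<and> (\<forall>w. norm w < \<delta> \<longrightarrow> \<epsilon> \<le> cmod (g (y + K y + w)))"
    by (intro choice) blast
  then obtain K where K: "\<And>y. K y \<in> \<Gamma>" "\<And>y w. norm w < \<delta> \<Longrightarrow> \<epsilon> \<le> cmod (g (y + K y + w))"
    by blast
  let ?\<Lambda> = "\<Union>n. tree K n"
  have "countable ?\<Lambda>"
    by (intro countable_UN countableI_type countable_finite finite_tree[OF *(1,2) K])
  moreover have "\<forall>x\<in>?\<Lambda>. \<forall>y\<in>?\<Lambda>. x \<noteq> y \<longrightarrow> g (x - y) = 0"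
    using tree_orthogonal[OF *(1,2) K] by blast
  moreover have "\<forall>\<xi> \<eta>. \<eta> > 0 \<longrightarrow> (\<exists>F\<subseteq>?\<Lambda>. finite F \<and> (\<Sum>l\<in>F. (cmod (g (\<xi> + l)))\<^sup>2) > 1 - \<eta>)"
    using tree_complete[OF *(1,2) K] by blast
  ultimately show ?thesis by (intro exI[of _ ?\<Lambda>] conjI)
qed

end

section \<open>Orthonormal bases of exponentials\<close>
lemma continuous_on_fourier_exp: "continuous_on A (fourier_exp s)"
  unfolding fourier_exp_def by (intro continuous_intros)

lemma borel_measurable_fourier_exp [measurable]: "fourier_exp s \<in> borel_measurable borel"
  by (intro borel_measurable_continuous_onI continuous_on_fourier_exp)

text \<open>A finite average of measures is the measure mixed over the uniform distribution on the index
  set, which reduces its integrals to those of the Giry monad.\<close>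

lemma average_measure_eq_bind:
  assumes E: "finite E" "E \<noteq> {}" and N: "\<And>e. e \<in> E \<Longrightarrow> prob_space (N e)"
    "\<And>e. e \<in> E \<Longrightarrow> sets (N e) = sets borel"
  shows "average_measure E N = Giry_Monad.bind (measure_pmf (pmf_of_set E)) (\<lambda>e. if e \<in> E then N e else return borel undefined)"
    (is "_ = Giry_Monad.bind _ ?N")
    and "(\<lambda>e. if e \<in> E then N e else return borel undefined)
      \<in> measurable (measure_pmf (pmf_of_set E)) (subprob_algebra borel)"
proof -
  show meas: "?N \<in> measurable (measure_pmf (pmf_of_set E)) (subprob_algebra borel)"
  proof -
    have "?N e \<in> space (subprob_algebra borel)" for e
      using N[of e] by (cases "e \<in> E")
        (auto simp: space_subprob_algebra intro!: prob_space_imp_subprob_space prob_space_return)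
    then show ?thesis by (simp add: Pi_iff)
  qed
  show "average_measure E N = Giry_Monad.bind (measure_pmf (pmf_of_set E)) ?N"
  proof (rule measure_eqI)
    show "sets (average_measure E N) = sets (Giry_Monad.bind (measure_pmf (pmf_of_set E)) ?N)"
      using sets_bind[of "measure_pmf (pmf_of_set E)" ?N borel] sets_kernel[OF meas] by simp
    fix A assume "A \<in> sets (average_measure E N)"
    then have A: "A \<in> sets borel" by simp
    have "emeasure (Giry_Monad.bind (measure_pmf (pmf_of_set E)) ?N) A = (\<Sum>e\<in>E. emeasure (?N e) A) / of_nat (card E)"
      using E by (subst emeasure_bind[OF _ meas A]) (auto simp: nn_integral_pmf_of_set ennreal_of_nat_eq_real_of_nat)
    also have "(\<Sum>e\<in>E. emeasure (?N e) A) = (\<Sum>e\<in>E. emeasure (N e) A)" by (intro sum.cong) auto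
    finally show "emeasure (average_measure E N) A = emeasure (Giry_Monad.bind (measure_pmf (pmf_of_set E)) ?N) A"
      using emeasure_average_measure[of E N A] N(2) A by simp
  qed
qed

lemma integral_average_measure:
  fixes h :: "'a::topological_space \<Rightarrow> complex"
  assumes E: "finite E" "E \<noteq> {}" and N: "\<And>e. e \<in> E \<Longrightarrow> prob_space (N e)"
    "\<And>e. e \<in> E \<Longrightarrow> sets (N e) = sets borel"
    and h[measurable]: "h \<in> borel_measurable borel" and bnd: "\<And>x. cmod (h x) \<le> B"
  shows "(LINT x|average_measure E N. h x) = (\<Sum>e\<in>E. LINT x|N e. h x) / of_nat (card E)"
proof -
  let ?p = "measure_pmf (pmf_of_set E)"
  let ?N = "\<lambda>e. if e \<in> E then N e else return borel undefined"
  have eq: "average_measure E N = Giry_Monad.bind ?p ?N"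
    by (rule average_measure_eq_bind(1)) (use E N in auto)
  have meas: "?N \<in> measurable ?p (subprob_algebra borel)"
    by (rule average_measure_eq_bind(2)) (use E N in auto)
  have fin: "AE e in ?p. emeasure (?N e) (space (?N e)) \<le> ennreal 1"
    using N E by (intro AE_I2) (auto simp: prob_space.emeasure_space_1 space_return)
  have re: "(LINT x|average_measure E N. k x) = (\<Sum>e\<in>E. LINT x|N e. k x) / real (card E)"
    "integrable (average_measure E N) k" "\<And>e. e \<in> E \<Longrightarrow> integrable (N e) k"
    if k[measurable]: "k \<in> borel_measurable borel" and kb: "\<And>x. \<bar>k x\<bar> \<le> B" for k :: "'a \<Rightarrow> real"
  proof -
    have fm: "finite_measure ?p" by (rule measure_pmf.finite_measure)
    have "integrable (Giry_Monad.bind ?p ?N) k"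
      by (rule integrable_bind[OF k _ meas fm fin]) (rule kb)
    moreover have "(LINT x|(Giry_Monad.bind ?p ?N). k x) = (LINT e|?p. LINT x|?N e. k x)"
      by (rule integral_bind[OF k _ meas fm fin]) (rule kb)
    ultimately have bind: "integrable (Giry_Monad.bind ?p ?N) k"
      "(LINT x|(Giry_Monad.bind ?p ?N). k x) = (LINT e|?p. LINT x|?N e. k x)" by auto
    have "(LINT x|average_measure E N. k x) = (LINT e|?p. LINT x|?N e. k x)"
      unfolding eq by (rule bind(2))
    also have "\<dots> = (\<Sum>e\<in>E. LINT x|?N e. k x) / real (card E)"
      using E by (simp add: integral_pmf_of_set)
    also have "(\<Sum>e\<in>E. LINT x|?N e. k x) = (\<Sum>e\<in>E. LINT x|N e. k x)" by (intro sum.cong) auto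
    finally show "(LINT x|average_measure E N. k x) = (\<Sum>e\<in>E. LINT x|N e. k x) / real (card E)" .
    show "integrable (average_measure E N) k" unfolding eq by (rule bind(1))
    fix e assume e: "e \<in> E"
    interpret prob_space "N e" by (rule N(1)[OF e])
    show "integrable (N e) k"
      using kb N(2)[OF e] by (intro integrable_const_bound[where B = B]) (auto cong: measurable_cong_sets)
  qed
  have b: "\<bar>Re (h x)\<bar> \<le> B" "\<bar>Im (h x)\<bar> \<le> B" for x
    using bnd[of x] abs_Re_le_cmod[of "h x"] abs_Im_le_cmod[of "h x"] by linarith+
  note r = re[of "\<lambda>x. Re (h x)", OF _ b(1)] and i = re[of "\<lambda>x. Im (h x)", OF _ b(2)]
  have int: "integrable M h" if "integrable M (\<lambda>x. Re (h x))" "integrable M (\<lambda>x. Im (h x))" for M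
  proof -
    have "integrable M (\<lambda>x. complex_of_real (Re (h x)) + \<i> * complex_of_real (Im (h x)))"
      using that by (intro Bochner_Integration.integrable_add integrable_mult_right integrable_of_real)
    then show ?thesis by (simp flip: complex_eq)
  qed
  have ih: "integrable (average_measure E N) h" using r(2) i(2) by (intro int) auto
  have ie: "integrable (N e) h" if "e \<in> E" for e using r(3) i(3) that by (intro int) auto
  show ?thesis
  proof (rule complex_eqI)
    show "Re (LINT x|average_measure E N. h x) = Re ((\<Sum>e\<in>E. LINT x|N e. h x) / of_nat (card E))"
      using r(1) ih ie by (simp add: Re_divide_of_nat)
    show "Im (LINT x|average_measure E N. h x) = Im ((\<Sum>e\<in>E. LINT x|N e. h x) / of_nat (card E))"
      using i(1) ih ie by (simp add: Im_divide_of_nat)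
  qed
qed

lemma fourier_transform_delta_measure:
  assumes "finite D" "D \<noteq> {}"
  shows "fourier_transform (delta_measure D) x = (\<Sum>d\<in>D. fourier_exp x d) / of_nat (card D)"
proof -
  have "(LINT y|average_measure D (return borel). fourier_exp x y)
      = (\<Sum>d\<in>D. LINT y|return borel d. fourier_exp x y) / of_nat (card D)"
    by (rule integral_average_measure[OF assms, where B = 1]) (auto intro: prob_space_return)
  then show ?thesis
    by (simp add: fourier_transform_def delta_measure_def integral_return)
qed

locale borel_prob = prob_space \<mu> for \<mu> :: "'a::euclidean_space measure" +
  assumes sets_\<mu> [measurable_cong]: "sets \<mu> = sets borel"
begin

lemma space_\<mu> [simp]: "space \<mu> = UNIV"
  using sets_eq_imp_space_eq[OF sets_\<mu>] by simp

lemma prob_UNIV [simp]: "prob UNIV = 1"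
  using prob_space by simp

lemma integrable_bounded:
  fixes h :: "'a \<Rightarrow> 'b::{banach, second_countable_topology}"
  shows "h \<in> borel_measurable \<mu> \<Longrightarrow> (\<And>x. norm (h x) \<le> B) \<Longrightarrow> integrable \<mu> h"
  by (intro integrable_const_bound[where B = B]) auto

lemma integrable_fourier_exp [simp]: "integrable \<mu> (fourier_exp s)"
  by (intro integrable_bounded[where B = 1]) auto

lemma integral_fourier_exp: "(LINT x|\<mu>. fourier_exp s x * cnj (fourier_exp t x)) = fourier_transform \<mu> (s - t)"
  by (simp add: fourier_transform_def fourier_exp_diff)

lemma fourier_transform_0: "fourier_transform \<mu> 0 = 1"
  by (simp add: fourier_transform_def prob_space)

lemma positive_definite_fourier_transform: "positive_definite (fourier_transform \<mu>)"
  unfolding positive_definite_def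
proof (intro conjI allI impI)
  show "fourier_transform \<mu> (- x) = cnj (fourier_transform \<mu> x)" for x
    unfolding fourier_transform_def fourier_exp_minus by simp
  fix S :: "'a set" and c assume S: "finite S"
  have int: "integrable \<mu> (\<lambda>x. c s * cnj (c t) * fourier_exp (s - t) x)" for s t by simp
  have "(\<Sum>s\<in>S. \<Sum>t\<in>S. c s * cnj (c t) * fourier_transform \<mu> (s - t))
      = (LINT x|\<mu>. (\<Sum>s\<in>S. \<Sum>t\<in>S. c s * cnj (c t) * fourier_exp (s - t) x))"
    unfolding fourier_transform_def by (simp add: Bochner_Integration.integral_sum)
  also have "(\<lambda>x. \<Sum>s\<in>S. \<Sum>t\<in>S. c s * cnj (c t) * fourier_exp (s - t) x)
      = (\<lambda>x. complex_of_real ((cmod (\<Sum>s\<in>S. c s * fourier_exp s x))\<^sup>2))"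
    unfolding complex_norm_square cnj_sum sum_product by (simp add: fourier_exp_diff mult_ac)
  also have "(LINT x|\<mu>. complex_of_real ((cmod (\<Sum>s\<in>S. c s * fourier_exp s x))\<^sup>2))
      = complex_of_real (LINT x|\<mu>. (cmod (\<Sum>s\<in>S. c s * fourier_exp s x))\<^sup>2)"
    by (rule integral_complex_of_real)
  finally have eq: "(\<Sum>s\<in>S. \<Sum>t\<in>S. c s * cnj (c t) * fourier_transform \<mu> (s - t))
      = complex_of_real (LINT x|\<mu>. (cmod (\<Sum>s\<in>S. c s * fourier_exp s x))\<^sup>2)" .
  have "0 \<le> (LINT x|\<mu>. (cmod (\<Sum>s\<in>S. c s * fourier_exp s x))\<^sup>2)" by simp
  then show "0 \<le> Re (\<Sum>s\<in>S. \<Sum>t\<in>S. c s * cnj (c t) * fourier_transform \<mu> (s - t))"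
    by (simp only: eq Re_complex_of_real)
qed

lemma continuous_fourier_transform: "continuous_on UNIV (fourier_transform \<mu>)"
proof -
  have "isCont (fourier_transform \<mu>) x" for x
    unfolding continuous_at_sequentially comp_def fourier_transform_def
  proof (intro allI impI)
    fix u :: "nat \<Rightarrow> 'a" assume u: "u \<longlonglongrightarrow> x"
    show "(\<lambda>n. LINT y|\<mu>. fourier_exp (u n) y) \<longlonglongrightarrow> (LINT y|\<mu>. fourier_exp x y)"
    proof (rule integral_dominated_convergence[where w = "\<lambda>_. 1"])
      show "AE y in \<mu>. (\<lambda>n. fourier_exp (u n) y) \<longlonglongrightarrow> fourier_exp x y"
        unfolding fourier_exp_def by (intro AE_I2 tendsto_intros u)
    qed auto
  qed
  then show ?thesis by (simp add: continuous_on_eq_continuous_at)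
qed

definition approximable :: "'a set \<Rightarrow> ('a \<Rightarrow> complex) \<Rightarrow> bool" where
  "approximable \<Lambda> h \<longleftrightarrow> h \<in> L2_functions \<mu> \<and> (\<forall>\<epsilon>>0. \<exists>S c. finite S \<and> S \<subseteq> \<Lambda> \<and>
     (LINT x|\<mu>. (cmod (h x - (\<Sum>i\<in>S. c i * fourier_exp i x)))\<^sup>2) < \<epsilon>)"

lemma L2D:
  assumes "h \<in> L2_functions \<mu>"
  shows "h \<in> borel_measurable borel" "integrable \<mu> (\<lambda>x. (cmod (h x))\<^sup>2)"
  using assms by (auto simp: L2_functions_def)

lemma L2_bounded: "h \<in> borel_measurable borel \<Longrightarrow> (\<And>x. cmod (h x) \<le> B) \<Longrightarrow> h \<in> L2_functions \<mu>"
  unfolding L2_functions_def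
  by (auto intro!: integrable_bounded[where B = "B\<^sup>2"] power_mono simp: measurable_cong_sets[OF sets_\<mu> refl])

lemma cmod_add_square: "(cmod (a + b))\<^sup>2 \<le> 2 * (cmod a)\<^sup>2 + 2 * (cmod b)\<^sup>2"
proof -
  have "(cmod (a + b))\<^sup>2 \<le> (cmod a + cmod b)\<^sup>2" by (intro power_mono norm_triangle_ineq) auto
  also have "\<dots> \<le> 2 * (cmod a)\<^sup>2 + 2 * (cmod b)\<^sup>2"
    using sum_squares_bound[of "cmod a" "cmod b"] by (simp add: power2_sum)
  finally show ?thesis .
qed

lemma L2_add:
  assumes "h \<in> L2_functions \<mu>" "k \<in> L2_functions \<mu>"
  shows "(\<lambda>x. h x + k x) \<in> L2_functions \<mu>"
    and "(LINT x|\<mu>. (cmod (h x + k x))\<^sup>2) \<le> 2 * (LINT x|\<mu>. (cmod (h x))\<^sup>2) + 2 * (LINT x|\<mu>. (cmod (k x))\<^sup>2)"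
proof -
  note [measurable] = L2D(1)[OF assms(1)] L2D(1)[OF assms(2)]
  have int: "integrable \<mu> (\<lambda>x. 2 * (cmod (h x))\<^sup>2 + 2 * (cmod (k x))\<^sup>2)"
    using L2D(2)[OF assms(1)] L2D(2)[OF assms(2)] by simp
  have int': "integrable \<mu> (\<lambda>x. (cmod (h x + k x))\<^sup>2)"
    using cmod_add_square by (intro Bochner_Integration.integrable_bound[OF int]) auto
  then show "(\<lambda>x. h x + k x) \<in> L2_functions \<mu>" by (auto simp: L2_functions_def)
  have "(LINT x|\<mu>. (cmod (h x + k x))\<^sup>2) \<le> (LINT x|\<mu>. 2 * (cmod (h x))\<^sup>2 + 2 * (cmod (k x))\<^sup>2)"
    by (intro integral_mono int int' cmod_add_square)
  also have "\<dots> = 2 * (LINT x|\<mu>. (cmod (h x))\<^sup>2) + 2 * (LINT x|\<mu>. (cmod (k x))\<^sup>2)"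
    using L2D(2)[OF assms(1)] L2D(2)[OF assms(2)] by simp
  finally show "(LINT x|\<mu>. (cmod (h x + k x))\<^sup>2) \<le> 2 * (LINT x|\<mu>. (cmod (h x))\<^sup>2) + 2 * (LINT x|\<mu>. (cmod (k x))\<^sup>2)" .
qed

lemma L2_scale: "h \<in> L2_functions \<mu> \<Longrightarrow> (\<lambda>x. c * h x) \<in> L2_functions \<mu>"
  by (auto simp: L2_functions_def norm_mult power_mult_distrib)

lemma L2_diff: "h \<in> L2_functions \<mu> \<Longrightarrow> k \<in> L2_functions \<mu> \<Longrightarrow> (\<lambda>x. h x - k x) \<in> L2_functions \<mu>"
  using L2_add(1)[of h "\<lambda>x. - 1 * k x"] L2_scale[of k "- 1"] by simp

lemma L2_exponential_sum: "(\<lambda>x. \<Sum>i\<in>S. c i * fourier_exp i x) \<in> L2_functions \<mu>"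
  by (rule L2_bounded[where B = "\<Sum>i\<in>S. cmod (c i)"])
     (auto intro!: order_trans[OF norm_sum] simp: norm_mult)

text \<open>Approximability is passed on from exponentials to continuous functions by the Stone-Weierstrass theorem, from
there to indicators of compact sets by dominated convergence, to indicators of Borel sets by inner
regularity, and to all square integrable functions through simple functions.\<close>
lemma approximable_limit:
  assumes h: "h \<in> L2_functions \<mu>"
    and k: "\<And>\<epsilon>. \<epsilon> > 0 \<Longrightarrow> \<exists>k. approximable \<Lambda> k \<and> (LINT x|\<mu>. (cmod (h x - k x))\<^sup>2) < \<epsilon>"
  shows "approximable \<Lambda> h"
  unfolding approximable_def
proof (intro conjI h allI impI)
  fix \<epsilon> :: real assume e: "\<epsilon> > 0"
  obtain k where k: "approximable \<Lambda> k" "(LINT x|\<mu>. (cmod (h x - k x))\<^sup>2) < \<epsilon> / 4" using k[of "\<epsilon> / 4"] e by auto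
  have kL: "k \<in> L2_functions \<mu>" using k(1) by (simp add: approximable_def)
  obtain S c where S: "finite S" "S \<subseteq> \<Lambda>"
    "(LINT x|\<mu>. (cmod (k x - (\<Sum>i\<in>S. c i * fourier_exp i x)))\<^sup>2) < \<epsilon> / 4"
    using k(1) e unfolding approximable_def by (meson divide_pos_pos zero_less_numeral)
  have "(LINT x|\<mu>. (cmod ((h x - k x) + (k x - (\<Sum>i\<in>S. c i * fourier_exp i x))))\<^sup>2)
      \<le> 2 * (LINT x|\<mu>. (cmod (h x - k x))\<^sup>2) + 2 * (LINT x|\<mu>. (cmod (k x - (\<Sum>i\<in>S. c i * fourier_exp i x)))\<^sup>2)"
    by (intro L2_add(2) L2_diff h kL L2_exponential_sum)
  also have "\<dots> < \<epsilon>" using k(2) S(3) by simp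
  finally show "\<exists>S c. finite S \<and> S \<subseteq> \<Lambda> \<and> (LINT x|\<mu>. (cmod (h x - (\<Sum>i\<in>S. c i * fourier_exp i x)))\<^sup>2) < \<epsilon>"
    using S by (intro exI[of _ S] exI[of _ c]) simp
qed

lemma approximable_add:
  assumes "approximable \<Lambda> h" "approximable \<Lambda> k"
  shows "approximable \<Lambda> (\<lambda>x. h x + k x)"
  unfolding approximable_def
proof (intro conjI allI impI)
  have L: "h \<in> L2_functions \<mu>" "k \<in> L2_functions \<mu>" using assms by (auto simp: approximable_def)
  then show "(\<lambda>x. h x + k x) \<in> L2_functions \<mu>" by (rule L2_add)
  fix \<epsilon> :: real assume e: "\<epsilon> > 0"
  obtain S c where S: "finite S" "S \<subseteq> \<Lambda>" "(LINT x|\<mu>. (cmod (h x - (\<Sum>i\<in>S. c i * fourier_exp i x)))\<^sup>2) < \<epsilon> / 4"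
    using assms(1) e unfolding approximable_def by (meson divide_pos_pos zero_less_numeral)
  obtain T d where T: "finite T" "T \<subseteq> \<Lambda>" "(LINT x|\<mu>. (cmod (k x - (\<Sum>i\<in>T. d i * fourier_exp i x)))\<^sup>2) < \<epsilon> / 4"
    using assms(2) e unfolding approximable_def by (meson divide_pos_pos zero_less_numeral)
  define b where "b i = (if i \<in> S then c i else 0) + (if i \<in> T then d i else 0)" for i
  have sums: "(\<Sum>i\<in>S \<union> T. b i * fourier_exp i x)
      = (\<Sum>i\<in>S. c i * fourier_exp i x) + (\<Sum>i\<in>T. d i * fourier_exp i x)" for x
  proof -
    have "(\<Sum>i\<in>S \<union> T. b i * fourier_exp i x) = (\<Sum>i\<in>S \<union> T. (if i \<in> S then c i else 0) * fourier_exp i x)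
        + (\<Sum>i\<in>S \<union> T. (if i \<in> T then d i else 0) * fourier_exp i x)"
      by (simp add: b_def distrib_right sum.distrib)
    also have "(\<Sum>i\<in>S \<union> T. (if i \<in> S then c i else 0) * fourier_exp i x) = (\<Sum>i\<in>S. c i * fourier_exp i x)"
      using S(1) T(1) by (intro sum.mono_neutral_cong_right) auto
    also have "(\<Sum>i\<in>S \<union> T. (if i \<in> T then d i else 0) * fourier_exp i x) = (\<Sum>i\<in>T. d i * fourier_exp i x)"
      using S(1) T(1) by (intro sum.mono_neutral_cong_right) auto
    finally show ?thesis .
  qed
  have "(LINT x|\<mu>. (cmod ((h x - (\<Sum>i\<in>S. c i * fourier_exp i x)) + (k x - (\<Sum>i\<in>T. d i * fourier_exp i x))))\<^sup>2)
      \<le> 2 * (LINT x|\<mu>. (cmod (h x - (\<Sum>i\<in>S. c i * fourier_exp i x)))\<^sup>2)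
        + 2 * (LINT x|\<mu>. (cmod (k x - (\<Sum>i\<in>T. d i * fourier_exp i x)))\<^sup>2)"
    by (intro L2_add(2) L2_diff L L2_exponential_sum)
  also have "\<dots> < \<epsilon>" using S(3) T(3) by simp
  finally show "\<exists>S c. finite S \<and> S \<subseteq> \<Lambda> \<and>
      (LINT x|\<mu>. (cmod (h x + k x - (\<Sum>i\<in>S. c i * fourier_exp i x)))\<^sup>2) < \<epsilon>"
    using S T by (intro exI[of _ "S \<union> T"] exI[of _ b]) (simp add: sums algebra_simps)
qed

lemma approximable_scale:
  assumes "approximable \<Lambda> h"
  shows "approximable \<Lambda> (\<lambda>x. a * h x)"
  unfolding approximable_def
proof (intro conjI allI impI)
  show "(\<lambda>x. a * h x) \<in> L2_functions \<mu>" using assms by (intro L2_scale) (simp add: approximable_def)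
  fix \<epsilon> :: real assume e: "\<epsilon> > 0"
  define \<delta> where "\<delta> = \<epsilon> / ((cmod a)\<^sup>2 + 1)"
  have "(cmod a)\<^sup>2 + 1 > 0" by (simp add: add_nonneg_pos)
  then have d: "\<delta> > 0" "((cmod a)\<^sup>2 + 1) * \<delta> = \<epsilon>" using e by (auto simp: \<delta>_def)
  obtain S c where S: "finite S" "S \<subseteq> \<Lambda>" "(LINT x|\<mu>. (cmod (h x - (\<Sum>i\<in>S. c i * fourier_exp i x)))\<^sup>2) < \<delta>"
    using assms d unfolding approximable_def by blast
  have "a * h x - (\<Sum>i\<in>S. (a * c i) * fourier_exp i x) = a * (h x - (\<Sum>i\<in>S. c i * fourier_exp i x))" for x
    by (simp add: right_diff_distrib sum_distrib_left mult_ac)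
  then have "(LINT x|\<mu>. (cmod (a * h x - (\<Sum>i\<in>S. (a * c i) * fourier_exp i x)))\<^sup>2)
      = (cmod a)\<^sup>2 * (LINT x|\<mu>. (cmod (h x - (\<Sum>i\<in>S. c i * fourier_exp i x)))\<^sup>2)"
    by (simp add: norm_mult power_mult_distrib)
  also have "\<dots> \<le> (cmod a)\<^sup>2 * \<delta>" using S(3) by (intro mult_left_mono) auto
  also have "\<dots> < \<epsilon>" using d by (simp add: algebra_simps)
  finally show "\<exists>S c. finite S \<and> S \<subseteq> \<Lambda> \<and>
      (LINT x|\<mu>. (cmod (a * h x - (\<Sum>i\<in>S. c i * fourier_exp i x)))\<^sup>2) < \<epsilon>"
    using S by (intro exI[of _ S] exI[of _ "\<lambda>i. a * c i"]) simp
qed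

lemma approximable_sum:
  assumes "finite I" "\<And>i. i \<in> I \<Longrightarrow> approximable \<Lambda> (h i)"
  shows "approximable \<Lambda> (\<lambda>x. \<Sum>i\<in>I. h i x)"
  using assms
proof (induction I rule: finite_induct)
  case empty
  have "approximable \<Lambda> (\<lambda>x. 0)"
    unfolding approximable_def by (auto intro!: L2_bounded[where B = 0] exI[of _ "{}"])
  then show ?case by simp
qed (auto intro: approximable_add)

definition exponential_sum :: "('a \<Rightarrow> complex) \<Rightarrow> bool" where
  "exponential_sum h \<longleftrightarrow> (\<exists>S c. finite S \<and> h = (\<lambda>x. \<Sum>i\<in>S. c i * fourier_exp i x))"

lemma exponential_sum_monomial: "exponential_sum (\<lambda>x. a * fourier_exp s x)"
  unfolding exponential_sum_def by (intro exI[of _ "{s}"] exI[of _ "\<lambda>_. a"]) simp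

lemma exponential_sum_add:
  assumes "exponential_sum h" "exponential_sum k"
  shows "exponential_sum (\<lambda>x. h x + k x)"
proof -
  obtain S c where S: "finite S" "h = (\<lambda>x. \<Sum>i\<in>S. c i * fourier_exp i x)"
    using assms(1) by (auto simp: exponential_sum_def)
  obtain T d where T: "finite T" "k = (\<lambda>x. \<Sum>i\<in>T. d i * fourier_exp i x)"
    using assms(2) by (auto simp: exponential_sum_def)
  have 1: "(\<Sum>i\<in>S \<union> T. (if i \<in> S then c i else 0) * fourier_exp i x) = (\<Sum>i\<in>S. c i * fourier_exp i x)" for x
    using S(1) T(1) by (intro sum.mono_neutral_cong_right) auto
  have 2: "(\<Sum>i\<in>S \<union> T. (if i \<in> T then d i else 0) * fourier_exp i x) = (\<Sum>i\<in>T. d i * fourier_exp i x)" for x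
    using S(1) T(1) by (intro sum.mono_neutral_cong_right) auto
  show ?thesis
    unfolding exponential_sum_def using S T
    by (intro exI[of _ "S \<union> T"] exI[of _ "\<lambda>i. (if i \<in> S then c i else 0) + (if i \<in> T then d i else 0)"])
       (simp add: distrib_right sum.distrib 1 2)
qed

lemma exponential_sum_sum:
  "finite I \<Longrightarrow> (\<And>i. i \<in> I \<Longrightarrow> exponential_sum (h i)) \<Longrightarrow> exponential_sum (\<lambda>x. \<Sum>i\<in>I. h i x)"
proof (induction I rule: finite_induct)
  case empty
  then show ?case using exponential_sum_monomial[of 0 0] by simp
qed (auto intro: exponential_sum_add)

lemma exponential_sum_mult:
  assumes "exponential_sum h" "exponential_sum k"
  shows "exponential_sum (\<lambda>x. h x * k x)"
proof -
  obtain S c where S: "finite S" "h = (\<lambda>x. \<Sum>i\<in>S. c i * fourier_exp i x)"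
    using assms(1) by (auto simp: exponential_sum_def)
  obtain T d where T: "finite T" "k = (\<lambda>x. \<Sum>i\<in>T. d i * fourier_exp i x)"
    using assms(2) by (auto simp: exponential_sum_def)
  have "exponential_sum (\<lambda>x. \<Sum>i\<in>S. \<Sum>j\<in>T. (c i * d j) * fourier_exp (i + j) x)"
    by (intro exponential_sum_sum S T exponential_sum_monomial)
  then show ?thesis by (simp add: S T sum_product fourier_exp_add mult_ac)
qed

lemma exponential_sum_approximates:
  fixes u :: "'a \<Rightarrow> real"
  assumes K: "compact K" and u: "continuous_on K u" and e: "\<epsilon> > 0"
  shows "\<exists>v. exponential_sum (\<lambda>x. complex_of_real (v x)) \<and> (\<forall>x\<in>K. \<bar>u x - v x\<bar> < \<epsilon>)"
proof (rule Stone_Weierstrass_HOL[where P = "\<lambda>v. exponential_sum (\<lambda>x. complex_of_real (v x))"])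
  show "compact K" "continuous_on K u" "0 < \<epsilon>" by fact+
  show "exponential_sum (\<lambda>x. complex_of_real a)" for a
    using exponential_sum_monomial[of "complex_of_real a" 0] by simp
  show "continuous_on K v" if v: "exponential_sum (\<lambda>x. complex_of_real (v x))" for v
  proof -
    obtain S c where "(\<lambda>x. complex_of_real (v x)) = (\<lambda>x. \<Sum>i\<in>S. c i * fourier_exp i x)"
      using v by (auto simp: exponential_sum_def)
    then have "v = (\<lambda>x. Re (\<Sum>i\<in>S. c i * fourier_exp i x))" by (metis Re_complex_of_real)
    then show ?thesis by (simp only:) (intro continuous_intros continuous_on_fourier_exp)
  qed
  show "exponential_sum (\<lambda>x. complex_of_real (v x + w x))"
    if "exponential_sum (\<lambda>x. complex_of_real (v x)) \<and> exponential_sum (\<lambda>x. complex_of_real (w x))" for v w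
    using that exponential_sum_add[of "\<lambda>x. complex_of_real (v x)" "\<lambda>x. complex_of_real (w x)"] by simp
  show "exponential_sum (\<lambda>x. complex_of_real (v x * w x))"
    if "exponential_sum (\<lambda>x. complex_of_real (v x)) \<and> exponential_sum (\<lambda>x. complex_of_real (w x))" for v w
    using that exponential_sum_mult[of "\<lambda>x. complex_of_real (v x)" "\<lambda>x. complex_of_real (w x)"] by simp
  fix x y :: 'a assume "x \<in> K \<and> y \<in> K \<and> x \<noteq> y"
  then have xy: "(x - y) \<bullet> (x - y) \<noteq> 0" by simp
  \<comment> \<open>This frequency turns by a quarter between the two points.\<close>
  define s where "s = (1 / (4 * ((x - y) \<bullet> (x - y)))) *\<^sub>R (x - y)"
  have "s \<bullet> (x - y) = 1 / 4" using xy by (simp add: s_def)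
  then have "fourier_exp s (x - y) = exp (- (\<i> * complex_of_real (pi / 2)))"
    unfolding fourier_exp_def by (simp only:) (simp add: mult_ac)
  also have "\<dots> \<noteq> 1"
  proof -
    have "exp (- (\<i> * complex_of_real (pi / 2))) = cnj (cis (pi / 2))" by (simp add: cis_conv_exp exp_cnj)
    then show ?thesis by (simp add: complex_eq_iff)
  qed
  finally have "fourier_exp s (x - y) \<noteq> 1" .
  moreover have "fourier_exp s x = fourier_exp s (x - y) * fourier_exp s y"
    using fourier_exp_add_right[of s "x - y" y] by simp
  moreover have "fourier_exp s y \<noteq> 0" by (metis norm_fourier_exp norm_zero zero_neq_one)
  ultimately have "fourier_exp s x \<noteq> fourier_exp s y" by simp
  then have "Re (fourier_exp s x) \<noteq> Re (fourier_exp s y) \<or> Im (fourier_exp s x) \<noteq> Im (fourier_exp s y)"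
    by (simp add: complex_eq_iff)
  moreover have "exponential_sum (\<lambda>x. complex_of_real (Re (fourier_exp s x)))"
  proof -
    have "complex_of_real (Re (fourier_exp s x)) = (1/2) * fourier_exp s x + (1/2) * fourier_exp (- s) x" for x
      by (simp add: fourier_exp_minus complex_eq_iff)
    then show ?thesis by (simp only:) (intro exponential_sum_add exponential_sum_monomial)
  qed
  moreover have "exponential_sum (\<lambda>x. complex_of_real (Im (fourier_exp s x)))"
  proof -
    have "complex_of_real (Im (fourier_exp s x)) = (- \<i> / 2) * fourier_exp s x + (\<i> / 2) * fourier_exp (- s) x" for x
      by (simp add: fourier_exp_minus complex_eq_iff)
    then show ?thesis by (simp only:) (intro exponential_sum_add exponential_sum_monomial)
  qed
  ultimately show "\<exists>v. exponential_sum (\<lambda>x. complex_of_real (v x)) \<and> v x \<noteq> v y"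
    by (elim disjE) (rule exI, erule conjI[rotated], assumption)+
qed

context
  fixes \<Lambda> :: "'a set"
  assumes exps: "\<And>s. approximable \<Lambda> (fourier_exp s)" and cs: "compactly_supported \<mu>"
begin

lemma approximable_exponential_sum: "exponential_sum h \<Longrightarrow> approximable \<Lambda> h"
  unfolding exponential_sum_def by (auto intro!: approximable_sum approximable_scale exps)

lemma approximable_continuous:
  fixes u :: "'a \<Rightarrow> real"
  assumes u: "continuous_on UNIV u" "\<And>x. \<bar>u x\<bar> \<le> 1"
  shows "approximable \<Lambda> (\<lambda>x. complex_of_real (u x))"
proof (rule approximable_limit)
  show L: "(\<lambda>x. complex_of_real (u x)) \<in> L2_functions \<mu>"
    using u by (intro L2_bounded[where B = 1] borel_measurable_continuous_onI continuous_intros) auto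
  fix \<epsilon> :: real assume e: "\<epsilon> > 0"
  obtain K where K: "compact K" "emeasure \<mu> (- K) = 0" using cs by (auto simp: compactly_supported_def)
  have "- K \<in> sets \<mu>" using K(1) by (simp add: compact_imp_closed sets_\<mu>)
  then have AE: "AE x in \<mu>. x \<in> K" using K(2) by (intro AE_I[of _ _ "- K"]) auto
  define \<delta> where "\<delta> = sqrt (\<epsilon> / 2)"
  have d: "\<delta> > 0" "\<delta>\<^sup>2 = \<epsilon> / 2" using e by (auto simp: \<delta>_def)
  obtain v where v: "exponential_sum (\<lambda>x. complex_of_real (v x))" "\<And>x. x \<in> K \<Longrightarrow> \<bar>u x - v x\<bar> < \<delta>"
    using exponential_sum_approximates[OF K(1) continuous_on_subset[OF u(1)] d(1)] by auto
  have app: "approximable \<Lambda> (\<lambda>x. complex_of_real (v x))" using approximable_exponential_sum v(1) .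
  have "(LINT x|\<mu>. (cmod (complex_of_real (u x) - complex_of_real (v x)))\<^sup>2) \<le> (LINT x|\<mu>. \<delta>\<^sup>2)"
  proof (intro integral_mono_AE)
    show "integrable \<mu> (\<lambda>x. (cmod (complex_of_real (u x) - complex_of_real (v x)))\<^sup>2)"
      using L app by (intro L2D(2) L2_diff) (simp_all add: approximable_def)
    show "AE x in \<mu>. (cmod (complex_of_real (u x) - complex_of_real (v x)))\<^sup>2 \<le> \<delta>\<^sup>2"
      using AE
    proof eventually_elim
      case (elim x)
      then have "cmod (complex_of_real (u x) - complex_of_real (v x)) \<le> \<delta>"
        using v(2)[of x] by (simp flip: of_real_diff)
      then show ?case by (intro power_mono) auto
    qed
  qed auto
  also have "\<dots> < \<epsilon>" using d e by (simp add: prob_space)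
  finally show "\<exists>k. approximable \<Lambda> k \<and> (LINT x|\<mu>. (cmod (complex_of_real (u x) - k x))\<^sup>2) < \<epsilon>"
    using app by blast
qed

lemma approximable_compact_indicator:
  assumes C: "compact C"
  shows "approximable \<Lambda> (\<lambda>x. complex_of_real (indicator C x))"
proof (cases "C = {}")
  case True
  then show ?thesis using approximable_sum[of "{}" \<Lambda> "\<lambda>_ _. 0"] by simp
next
  case False
  have Cb[measurable]: "C \<in> sets borel" using C by (simp add: compact_imp_closed)
  define u where "u n x = max 0 (1 - real n * infdist x C)" for n x
  have u_cont: "continuous_on UNIV (u n)" for n unfolding u_def by (intro continuous_intros)
  have u_bound: "\<bar>u n x\<bar> \<le> 1" for n x by (simp add: u_def infdist_nonneg)
  have u_meas[measurable]: "u n \<in> borel_measurable borel" for n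
    by (intro borel_measurable_continuous_onI u_cont)
  have u_lim: "(\<lambda>n. u n x) \<longlonglongrightarrow> indicator C x" for x
  proof (cases "x \<in> C")
    case True then show ?thesis by (simp add: u_def)
  next
    case nC: False
    then have pos: "infdist x C > 0"
      using in_closed_iff_infdist_zero[OF compact_imp_closed[OF C] False, of x] infdist_nonneg[of x C] by linarith
    obtain N :: nat where "1 / infdist x C < real N" using reals_Archimedean2 by blast
    then have N: "1 < real N * infdist x C" using pos by (simp add: field_simps)
    have "u n x = 0" if "n \<ge> N" for n
    proof -
      have "real N * infdist x C \<le> real n * infdist x C" using that pos by (intro mult_right_mono) auto
      then show ?thesis using N by (simp add: u_def)
    qed
    then have "eventually (\<lambda>n. 0 = u n x) sequentially" by (auto simp: eventually_sequentially)
    then show ?thesis using nC by (simp add: tendsto_eventually Lim_transform_eventually[OF tendsto_const])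
  qed
  show ?thesis
  proof (rule approximable_limit)
    show "(\<lambda>x. complex_of_real (indicator C x)) \<in> L2_functions \<mu>"
      by (intro L2_bounded[where B = 1]) (auto simp: indicator_def)
    fix \<epsilon> :: real assume e: "\<epsilon> > 0"
    have "(\<lambda>n. LINT x|\<mu>. (cmod (complex_of_real (indicator C x) - complex_of_real (u n x)))\<^sup>2) \<longlonglongrightarrow> (LINT x|\<mu>. 0)"
    proof (rule integral_dominated_convergence[where w = "\<lambda>_. 4"])
      have "(\<lambda>n. (cmod (complex_of_real (indicator C x) - complex_of_real (u n x)))\<^sup>2)
          \<longlonglongrightarrow> (cmod (complex_of_real (indicator C x) - complex_of_real (indicator C x)))\<^sup>2" for x
        by (intro tendsto_intros u_lim)
      then show "AE x in \<mu>. (\<lambda>n. (cmod (complex_of_real (indicator C x) - complex_of_real (u n x)))\<^sup>2) \<longlonglongrightarrow> 0"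
        by simp
      show "AE x in \<mu>. norm ((cmod (complex_of_real (indicator C x) - complex_of_real (u n x)))\<^sup>2) \<le> 4" for n
      proof (intro AE_I2)
        fix x
        have "cmod (complex_of_real (indicator C x) - complex_of_real (u n x)) \<le> 2"
          using u_bound[of n x] by (auto simp: indicator_def abs_if simp flip: of_real_diff split: if_splits)
        from power_mono[OF this, of 2] show "norm ((cmod (complex_of_real (indicator C x) - complex_of_real (u n x)))\<^sup>2) \<le> 4"
          by simp
      qed
    qed auto
    then have "eventually (\<lambda>n. (LINT x|\<mu>. (cmod (complex_of_real (indicator C x) - complex_of_real (u n x)))\<^sup>2) < \<epsilon>) sequentially"
      using e by (intro order_tendstoD(2)) auto
    then obtain n where "(LINT x|\<mu>. (cmod (complex_of_real (indicator C x) - complex_of_real (u n x)))\<^sup>2) < \<epsilon>"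
      by (auto simp: eventually_sequentially)
    then show "\<exists>k. approximable \<Lambda> k \<and> (LINT x|\<mu>. (cmod (complex_of_real (indicator C x) - k x))\<^sup>2) < \<epsilon>"
      using approximable_continuous[OF u_cont u_bound, of n] by blast
  qed
qed

lemma approximable_indicator:
  assumes A: "A \<in> sets borel"
  shows "approximable \<Lambda> (\<lambda>x. complex_of_real (indicator A x))"
proof (rule approximable_limit)
  note [measurable] = A
  show "(\<lambda>x. complex_of_real (indicator A x)) \<in> L2_functions \<mu>"
    by (intro L2_bounded[where B = 1]) (auto simp: indicator_def)
  fix \<epsilon> :: real assume e: "\<epsilon> > 0"
  have sup: "emeasure \<mu> A = (SUP K \<in> {K. K \<subseteq> A \<and> compact K}. emeasure \<mu> K)"
    by (rule inner_regular[OF sets_\<mu> _ A]) simp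
  have "\<exists>K. K \<subseteq> A \<and> compact K \<and> measure \<mu> A < measure \<mu> K + \<epsilon>"
  proof (cases "measure \<mu> A < \<epsilon>")
    case True
    then show ?thesis by (intro exI[of _ "{}"]) auto
  next
    case False
    have "ennreal (measure \<mu> A - \<epsilon>) < emeasure \<mu> A"
      using False e by (simp add: emeasure_eq_measure ennreal_less_iff)
    then obtain K where K: "K \<subseteq> A" "compact K" "ennreal (measure \<mu> A - \<epsilon>) < emeasure \<mu> K"
      unfolding sup by (auto simp: less_SUP_iff)
    then have "measure \<mu> A - \<epsilon> < measure \<mu> K"
      using False by (simp add: emeasure_eq_measure ennreal_less_iff)
    then show ?thesis using K by (intro exI[of _ K]) auto
  qed
  then obtain K where K: "K \<subseteq> A" "compact K" "measure \<mu> A < measure \<mu> K + \<epsilon>" by blast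
  have Kb: "K \<in> sets borel" using K(2) by (simp add: compact_imp_closed)
  have "(LINT x|\<mu>. (cmod (complex_of_real (indicator A x) - complex_of_real (indicator K x)))\<^sup>2)
      = (LINT x|\<mu>. indicator (A - K) x)"
    using K(1) by (intro Bochner_Integration.integral_cong refl) (auto simp: indicator_def)
  also have "\<dots> = measure \<mu> A - measure \<mu> K"
    using A Kb K(1) by (simp add: sets_\<mu> finite_measure_Diff)
  also have "\<dots> < \<epsilon>" using K(3) by simp
  finally show "\<exists>k. approximable \<Lambda> k \<and> (LINT x|\<mu>. (cmod (complex_of_real (indicator A x) - k x))\<^sup>2) < \<epsilon>"
    using approximable_compact_indicator[OF K(2)] by blast
qed

lemma approximable_L2:
  assumes h: "h \<in> L2_functions \<mu>"
  shows "approximable \<Lambda> h"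
proof (rule approximable_limit[OF h])
  fix \<epsilon> :: real assume e: "\<epsilon> > 0"
  note [measurable] = L2D(1)[OF h]
  have "h \<in> borel_measurable \<mu>" by measurable
  from borel_measurable_implies_sequence_metric[OF this, of 0] obtain s where
    s: "\<And>i. simple_function \<mu> (s i)" "\<And>x. (\<lambda>i. s i x) \<longlonglongrightarrow> h x" "\<And>i x. cmod (s i x) \<le> 2 * cmod (h x)"
    by auto
  note [measurable] = borel_measurable_simple_function[OF s(1)]
  have "(\<lambda>n. LINT x|\<mu>. (cmod (h x - s n x))\<^sup>2) \<longlonglongrightarrow> (LINT x|\<mu>. 0)"
  proof (rule integral_dominated_convergence[where w = "\<lambda>x. 9 * (cmod (h x))\<^sup>2"])
    show "integrable \<mu> (\<lambda>x. 9 * (cmod (h x))\<^sup>2)" using L2D(2)[OF h] by simp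
    have "(\<lambda>n. (cmod (h x - s n x))\<^sup>2) \<longlonglongrightarrow> (cmod (h x - h x))\<^sup>2" for x
      by (intro tendsto_intros s)
    then show "AE x in \<mu>. (\<lambda>n. (cmod (h x - s n x))\<^sup>2) \<longlonglongrightarrow> 0" by simp
    show "AE x in \<mu>. norm ((cmod (h x - s n x))\<^sup>2) \<le> 9 * (cmod (h x))\<^sup>2" for n
    proof (intro AE_I2)
      fix x
      have "cmod (h x - s n x) \<le> 3 * cmod (h x)"
        using norm_triangle_ineq4[of "h x" "s n x"] s(3)[of n x] by simp
      from power_mono[OF this, of 2] show "norm ((cmod (h x - s n x))\<^sup>2) \<le> 9 * (cmod (h x))\<^sup>2"
        by (simp add: power_mult_distrib)
    qed
  qed auto
  then have "eventually (\<lambda>n. (LINT x|\<mu>. (cmod (h x - s n x))\<^sup>2) < \<epsilon>) sequentially"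
    using e by (intro order_tendstoD(2)) auto
  then obtain n where n: "(LINT x|\<mu>. (cmod (h x - s n x))\<^sup>2) < \<epsilon>" by (auto simp: eventually_sequentially)
  have fin: "finite (range (s n))" using simple_functionD(1)[OF s(1), of n] by simp
  have sets: "s n -` {y} \<in> sets borel" for y
    using simple_functionD(2)[OF s(1), of n "{y}"] by (simp add: sets_\<mu>)
  have "s n x = (\<Sum>y\<in>range (s n). y * complex_of_real (indicator (s n -` {y}) x))" for x
  proof -
    have "(\<Sum>y\<in>range (s n). y * complex_of_real (indicator (s n -` {y}) x))
        = (\<Sum>y\<in>range (s n). if y = s n x then s n x else 0)"
      by (intro sum.cong) (auto simp: indicator_def)
    then show ?thesis using fin by simp
  qed
  then have "s n = (\<lambda>x. \<Sum>y\<in>range (s n). y * complex_of_real (indicator (s n -` {y}) x))" by (rule ext)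
  moreover have "approximable \<Lambda> (\<lambda>x. \<Sum>y\<in>range (s n). y * complex_of_real (indicator (s n -` {y}) x))"
    by (intro approximable_sum fin approximable_scale approximable_indicator sets)
  ultimately have "approximable \<Lambda> (s n)" by simp
  then show "\<exists>k. approximable \<Lambda> k \<and> (LINT x|\<mu>. (cmod (h x - k x))\<^sup>2) < \<epsilon>" using n by blast
qed

end

text \<open>The best coefficients are the Fourier coefficients; the last sum is the price for choosing others.\<close>
lemma exponential_distance:
  assumes S: "finite S" and orth: "\<And>s t. s \<in> S \<Longrightarrow> t \<in> S \<Longrightarrow> s \<noteq> t \<Longrightarrow> fourier_transform \<mu> (s - t) = 0"
  shows "(LINT x|\<mu>. (cmod (fourier_exp \<eta> x - (\<Sum>i\<in>S. c i * fourier_exp i x)))\<^sup>2)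
    = 1 - (\<Sum>i\<in>S. (cmod (fourier_transform \<mu> (\<eta> - i)))\<^sup>2) + (\<Sum>i\<in>S. (cmod (c i - fourier_transform \<mu> (\<eta> - i)))\<^sup>2)"
proof -
  let ?g = "fourier_transform \<mu>"
  have herm: "?g (i - \<eta>) = cnj (?g (\<eta> - i))" for i
    using positive_definiteD(1)[OF positive_definite_fourier_transform, of "\<eta> - i"] by simp
  have pt: "complex_of_real ((cmod (fourier_exp \<eta> x - (\<Sum>i\<in>S. c i * fourier_exp i x)))\<^sup>2)
      = 1 - (\<Sum>i\<in>S. cnj (c i) * fourier_exp (\<eta> - i) x) - (\<Sum>i\<in>S. c i * fourier_exp (i - \<eta>) x)
        + (\<Sum>i\<in>S. \<Sum>j\<in>S. c i * cnj (c j) * fourier_exp (i - j) x)" for x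
    unfolding complex_norm_square fourier_exp_diff
    by (simp add: cnj_sum algebra_simps sum_product sum_distrib_left) (rule sum.swap)
  have int: "integrable \<mu> (\<lambda>x. a * fourier_exp i x)" for a i by simp
  have "complex_of_real (LINT x|\<mu>. (cmod (fourier_exp \<eta> x - (\<Sum>i\<in>S. c i * fourier_exp i x)))\<^sup>2)
      = (LINT x|\<mu>. 1 - (\<Sum>i\<in>S. cnj (c i) * fourier_exp (\<eta> - i) x) - (\<Sum>i\<in>S. c i * fourier_exp (i - \<eta>) x)
        + (\<Sum>i\<in>S. \<Sum>j\<in>S. c i * cnj (c j) * fourier_exp (i - j) x))"
    unfolding integral_complex_of_real[symmetric] pt ..
  also have "\<dots> = 1 - (\<Sum>i\<in>S. cnj (c i) * ?g (\<eta> - i)) - (\<Sum>i\<in>S. c i * ?g (i - \<eta>))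
        + (\<Sum>i\<in>S. \<Sum>j\<in>S. c i * cnj (c j) * ?g (i - j))"
    unfolding fourier_transform_def
    by (simp add: Bochner_Integration.integral_sum prob_space)
  also have "(\<Sum>i\<in>S. \<Sum>j\<in>S. c i * cnj (c j) * ?g (i - j)) = (\<Sum>i\<in>S. c i * cnj (c i))"
  proof (intro sum.cong refl)
    fix i assume i: "i \<in> S"
    have "(\<Sum>j\<in>S. c i * cnj (c j) * ?g (i - j)) = (\<Sum>j\<in>S. if j = i then c i * cnj (c i) else 0)"
      using i orth by (intro sum.cong) (auto simp: fourier_transform_0)
    then show "(\<Sum>j\<in>S. c i * cnj (c j) * ?g (i - j)) = c i * cnj (c i)" using S i by simp
  qed
  also have "1 - (\<Sum>i\<in>S. cnj (c i) * ?g (\<eta> - i)) - (\<Sum>i\<in>S. c i * ?g (i - \<eta>)) + (\<Sum>i\<in>S. c i * cnj (c i))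
      = 1 - (\<Sum>i\<in>S. ?g (\<eta> - i) * cnj (?g (\<eta> - i))) + (\<Sum>i\<in>S. (c i - ?g (\<eta> - i)) * cnj (c i - ?g (\<eta> - i)))"
    unfolding herm by (simp add: algebra_simps sum.distrib sum_subtractf)
  also have "\<dots> = complex_of_real (1 - (\<Sum>i\<in>S. (cmod (?g (\<eta> - i)))\<^sup>2) + (\<Sum>i\<in>S. (cmod (c i - ?g (\<eta> - i)))\<^sup>2))"
    unfolding complex_norm_square[symmetric] by simp
  finally show ?thesis by (simp only: of_real_eq_iff)
qed

lemma norm_fourier_transform_swap: "cmod (fourier_transform \<mu> (- \<xi> - i)) = cmod (fourier_transform \<mu> (\<xi> + i))"
  using positive_definiteD(1)[OF positive_definite_fourier_transform, of "\<xi> + i"] by simp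

lemma fourier_exp_L2: "fourier_exp s \<in> L2_functions \<mu>"
  by (rule L2_bounded[where B = 1]) auto

text \<open>Completeness is equivalent to Parseval's identity for all exponentials, since these span a dense subspace.\<close>
theorem orthonormal_basis_iff_parseval:
  assumes cs: "compactly_supported \<mu>"
  shows "orthonormal_basis_L2 \<mu> \<Lambda> fourier_exp \<longleftrightarrow>
    (\<forall>x\<in>\<Lambda>. \<forall>y\<in>\<Lambda>. x \<noteq> y \<longrightarrow> fourier_transform \<mu> (x - y) = 0) \<and>
    (\<forall>\<xi> \<eta>. \<eta> > 0 \<longrightarrow> (\<exists>F\<subseteq>\<Lambda>. finite F \<and> (\<Sum>l\<in>F. (cmod (fourier_transform \<mu> (\<xi> + l)))\<^sup>2) > 1 - \<eta>))"
    (is "_ \<longleftrightarrow> ?orth \<and> ?complete")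
proof
  assume basis: "orthonormal_basis_L2 \<mu> \<Lambda> fourier_exp"
  have orth: ?orth
    using basis unfolding orthonormal_basis_L2_def integral_fourier_exp by simp
  have ?complete
  proof (intro allI impI)
    fix \<xi> :: 'a and \<eta> :: real assume "\<eta> > 0"
    then obtain S c where S: "finite S" "S \<subseteq> \<Lambda>"
      "(LINT x|\<mu>. (cmod (fourier_exp (- \<xi>) x - (\<Sum>i\<in>S. c i * fourier_exp i x)))\<^sup>2) < \<eta>"
      using basis fourier_exp_L2[of "- \<xi>"] unfolding orthonormal_basis_L2_def by blast
    have "0 \<le> (\<Sum>i\<in>S. (cmod (c i - fourier_transform \<mu> (- \<xi> - i)))\<^sup>2)" by (intro sum_nonneg) auto
    then have "1 - (\<Sum>i\<in>S. (cmod (fourier_transform \<mu> (- \<xi> - i)))\<^sup>2) < \<eta>"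
      using S exponential_distance[of S "- \<xi>" c] orth by (simp add: subset_iff)
    then show "\<exists>F\<subseteq>\<Lambda>. finite F \<and> (\<Sum>l\<in>F. (cmod (fourier_transform \<mu> (\<xi> + l)))\<^sup>2) > 1 - \<eta>"
      using S by (intro exI[of _ S]) (simp add: norm_fourier_transform_swap)
  qed
  with orth show "?orth \<and> ?complete" ..
next
  assume *: "?orth \<and> ?complete"
  have exps: "approximable \<Lambda> (fourier_exp s)" for s
    unfolding approximable_def
  proof (intro conjI fourier_exp_L2 allI impI)
    fix \<epsilon> :: real assume "\<epsilon> > 0"
    then obtain F where F: "F \<subseteq> \<Lambda>" "finite F" "(\<Sum>l\<in>F. (cmod (fourier_transform \<mu> (- s + l)))\<^sup>2) > 1 - \<epsilon>"
      using * by blast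
    have "(LINT x|\<mu>. (cmod (fourier_exp s x - (\<Sum>i\<in>F. fourier_transform \<mu> (s - i) * fourier_exp i x)))\<^sup>2)
        = 1 - (\<Sum>l\<in>F. (cmod (fourier_transform \<mu> (- s + l)))\<^sup>2)"
      using F conjunct1[OF *] exponential_distance[of F s "\<lambda>i. fourier_transform \<mu> (s - i)"]
        norm_fourier_transform_swap[of "- s"] by (simp add: subset_iff)
    then show "\<exists>S c. finite S \<and> S \<subseteq> \<Lambda> \<and> (LINT x|\<mu>. (cmod (fourier_exp s x - (\<Sum>i\<in>S. c i * fourier_exp i x)))\<^sup>2) < \<epsilon>"
      using F by (intro exI[of _ F] exI[of _ "\<lambda>i. fourier_transform \<mu> (s - i)"]) simp
  qed
  have "\<forall>i\<in>\<Lambda>. fourier_exp i \<in> L2_functions \<mu>" by (simp add: fourier_exp_L2)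
  moreover have "\<forall>i\<in>\<Lambda>. \<forall>j\<in>\<Lambda>. (LINT x|\<mu>. fourier_exp i x * cnj (fourier_exp j x)) = (if i = j then 1 else 0)"
    using conjunct1[OF *] by (simp add: integral_fourier_exp fourier_transform_0)
  moreover have "\<forall>f\<in>L2_functions \<mu>. \<forall>\<epsilon>>0. \<exists>S c. finite S \<and> S \<subseteq> \<Lambda> \<and>
      (LINT x|\<mu>. (cmod (f x - (\<Sum>i\<in>S. c i * fourier_exp i x)))\<^sup>2) < \<epsilon>"
  proof
    fix f assume "f \<in> L2_functions \<mu>"
    then have "approximable \<Lambda> f" by (rule approximable_L2[OF exps cs])
    then show "\<forall>\<epsilon>>0. \<exists>S c. finite S \<and> S \<subseteq> \<Lambda> \<and>
        (LINT x|\<mu>. (cmod (f x - (\<Sum>i\<in>S. c i * fourier_exp i x)))\<^sup>2) < \<epsilon>"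
      by (simp add: approximable_def)
  qed
  ultimately show "orthonormal_basis_L2 \<mu> \<Lambda> fourier_exp"
    unfolding orthonormal_basis_L2_def by (intro conjI)
qed

end

section \<open>Planar self-affine measures\<close>

context borel_prob
begin

text \<open>The mass of a sublevel set of \<open>N\<close> does not decrease under \<open>R \<mapsto> \<theta> * R + C\<close>. These maps contract to their
fixed point, starting from arbitrarily large \<open>R\<close>, where the mass tends to one.\<close>
lemma self_similar_bounded:
  fixes N :: "'a \<Rightarrow> real" and \<psi> :: "'a \<Rightarrow> 'a \<Rightarrow> 'a"
  assumes eq: "\<mu> = average_measure D (\<lambda>d. distr \<mu> borel (\<psi> d))" and D: "finite D" "D \<noteq> {}"
    and \<psi>: "\<And>d. d \<in> D \<Longrightarrow> \<psi> d \<in> borel_measurable borel" and N[measurable]: "N \<in> borel_measurable borel"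
    and \<theta>: "0 < \<theta>" "\<theta> < 1" and contr: "\<And>d x. d \<in> D \<Longrightarrow> N (\<psi> d x) \<le> \<theta> * N x + C"
  shows "\<exists>R. prob {x. N x \<le> R} = 1"
proof -
  define G where "G R = prob {x. N x \<le> R}" for R
  have sets: "{x. N x \<le> R} \<in> sets borel" for R by measurable
  have pull: "prob A = (\<Sum>d\<in>D. prob (\<psi> d -` A)) / real (card D)" if A: "A \<in> sets borel" for A
  proof -
    have "emeasure \<mu> A = emeasure (average_measure D (\<lambda>d. distr \<mu> borel (\<psi> d))) A"
      using arg_cong[OF eq, of "\<lambda>\<nu>. emeasure \<nu> A"] .
    also have "\<dots> = (\<Sum>d\<in>D. emeasure (distr \<mu> borel (\<psi> d)) A) / of_nat (card D)"
      using A by (intro emeasure_average_measure) auto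
    also have "(\<Sum>d\<in>D. emeasure (distr \<mu> borel (\<psi> d)) A) = (\<Sum>d\<in>D. ennreal (prob (\<psi> d -` A)))"
      using \<psi> A by (intro sum.cong refl) (simp add: emeasure_distr emeasure_eq_measure measurable_cong_sets[OF sets_\<mu> refl])
    also have "\<dots> / of_nat (card D) = ennreal ((\<Sum>d\<in>D. prob (\<psi> d -` A)) / real (card D))"
      using D by (simp add: sum_nonneg divide_ennreal[symmetric] ennreal_of_nat_eq_real_of_nat card_gt_0_iff)
    finally show ?thesis by (simp add: emeasure_eq_measure sum_nonneg)
  qed
  have step: "G R \<le> G (\<theta> * R + C)" for R
  proof -
    have "real (card D) * G R = (\<Sum>d\<in>D. G R)" by simp
    also have "\<dots> \<le> (\<Sum>d\<in>D. prob (\<psi> d -` {x. N x \<le> \<theta> * R + C}))"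
    proof (intro sum_mono)
      fix d assume d: "d \<in> D"
      have "\<psi> d -` {x. N x \<le> \<theta> * R + C} \<in> sets \<mu>"
        using measurable_sets[OF \<psi>[OF d] sets] by (simp add: sets_\<mu>)
      moreover have "{x. N x \<le> R} \<subseteq> \<psi> d -` {x. N x \<le> \<theta> * R + C}"
      proof
        fix x assume "x \<in> {x. N x \<le> R}"
        then have "\<theta> * N x \<le> \<theta> * R" using \<theta> by simp
        then show "x \<in> \<psi> d -` {x. N x \<le> \<theta> * R + C}" using contr[OF d, of x] by simp
      qed
      ultimately show "G R \<le> prob (\<psi> d -` {x. N x \<le> \<theta> * R + C})"
        unfolding G_def by (intro finite_measure_mono)
    qed
    also have "\<dots> = real (card D) * G (\<theta> * R + C)"
      unfolding G_def using pull[OF sets, of "\<theta> * R + C"] D by (simp add: card_gt_0_iff)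
    finally show ?thesis using D by (simp add: card_gt_0_iff)
  qed
  define R0 where "R0 = C / (1 - \<theta>)"
  have fix_R0: "\<theta> * R0 + C = R0" using \<theta> by (simp add: R0_def field_simps)
  have down: "G (R0 + (1 / \<theta>) ^ n) \<le> G (R0 + 1)" for n
  proof (induction n)
    case (Suc n)
    have "\<theta> * (R0 + (1 / \<theta>) ^ Suc n) + C = R0 + (1 / \<theta>) ^ n"
      using fix_R0 \<theta> by (simp add: algebra_simps)
    then show ?case using step[of "R0 + (1 / \<theta>) ^ Suc n"] Suc by simp
  qed simp
  have th: "1 / \<theta> > 1" using \<theta> by simp
  have "(\<lambda>n. prob {x. N x \<le> R0 + (1 / \<theta>) ^ n}) \<longlonglongrightarrow> prob (\<Union>n. {x. N x \<le> R0 + (1 / \<theta>) ^ n})"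
  proof (rule finite_Lim_measure_incseq)
    show "range (\<lambda>n. {x. N x \<le> R0 + (1 / \<theta>) ^ n}) \<subseteq> events" using sets by (auto simp: sets_\<mu>)
    have "(1 / \<theta>) ^ m \<le> (1 / \<theta>) ^ n" if "m \<le> n" for m n
      using th that by (intro power_increasing) auto
    then show "incseq (\<lambda>n. {x. N x \<le> R0 + (1 / \<theta>) ^ n})" by (fastforce simp: incseq_def)
  qed
  also have "(\<Union>n. {x. N x \<le> R0 + (1 / \<theta>) ^ n}) = UNIV"
  proof -
    have "\<exists>n. N x \<le> R0 + (1 / \<theta>) ^ n" for x
      using real_arch_pow[OF th, of "N x - R0"] by (auto intro: less_imp_le simp: algebra_simps)
    then show ?thesis by auto
  qed
  finally have "(\<lambda>n. G (R0 + (1 / \<theta>) ^ n)) \<longlonglongrightarrow> 1" by (simp add: G_def)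
  then have "1 \<le> G (R0 + 1)" using down by (intro LIMSEQ_le_const2[of _ 1]) auto
  then have "G (R0 + 1) = 1" using prob_le_1 by (intro antisym) (auto simp: G_def)
  then show ?thesis by (auto simp: G_def)
qed

end

lemma vector_2_nth [simp]: "(vector [x, y] :: 'a::zero ^ 2) $ 1 = x" "(vector [x, y] :: 'a::zero ^ 2) $ 2 = y"
  by (simp_all add: vector_def)

lemma vec2_eq_iff: "(x :: 'a ^ 2) = y \<longleftrightarrow> x $ 1 = y $ 1 \<and> x $ 2 = y $ 2"
  by (simp add: vec_eq_iff forall_2)

lemma inner_vec2: "x \<bullet> (y :: real ^ 2) = x $ 1 * y $ 1 + x $ 2 * y $ 2"
  by (simp add: inner_vec_def sum_2)

text \<open>The transpose of the matrix with rows \<open>(r1, c)\<close> and \<open>(0, r2)\<close> has the eigenvectors \<open>(1, \<kappa>)\<close> and \<open>(0, 1)\<close> with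
\<open>\<kappa> = c / (r1 - r2)\<close>. This map multiplies the first one by \<open>s\<close> and the second one by \<open>t\<close>.\<close>
definition eigen_scale :: "real \<Rightarrow> real \<Rightarrow> real \<Rightarrow> real ^ 2 \<Rightarrow> real ^ 2" where
  "eigen_scale \<kappa> s t x = vector [s * x $ 1, \<kappa> * (s * x $ 1) + t * (x $ 2 - \<kappa> * x $ 1)]"

lemma eigen_scale_nth [simp]:
  "eigen_scale \<kappa> s t x $ 1 = s * x $ 1"
  "eigen_scale \<kappa> s t x $ 2 = \<kappa> * (s * x $ 1) + t * (x $ 2 - \<kappa> * x $ 1)"
  by (simp_all add: eigen_scale_def)

lemma eigen_scale_compose: "eigen_scale \<kappa> s t (eigen_scale \<kappa> s' t' x) = eigen_scale \<kappa> (s * s') (t * t') x"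
  by (simp add: vec2_eq_iff algebra_simps)

lemma eigen_scale_1: "eigen_scale \<kappa> 1 1 x = x"
  by (simp add: vec2_eq_iff)

lemma linear_eigen_scale: "linear (eigen_scale \<kappa> s t)"
  by (rule linearI) (simp_all add: vec2_eq_iff algebra_simps)

lemma inj_eigen_scale: "s \<noteq> 0 \<Longrightarrow> t \<noteq> 0 \<Longrightarrow> inj (eigen_scale \<kappa> s t)"
  by (rule injI) (auto simp: vec2_eq_iff)

lemma real_vec_nth [simp]: "real_vec v $ i = real_of_int (v $ i)"
  by (simp add: real_vec_def)

lemma fourier_exp_integer:
  assumes "x \<bullet> y \<in> \<int>"
  shows "fourier_exp x y = 1"
proof -
  obtain k where k: "x \<bullet> y = of_int k" using assms by (auto elim: Ints_cases)
  have "fourier_exp x y = exp (2 * of_int (- k) * complex_of_real pi * \<i>)"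
    by (simp add: fourier_exp_def k mult_ac)
  then show ?thesis using exp_integer_2pi[of "of_int (- k)"] by simp
qed

lemma norm_one_plus_fourier_exp: "cmod (1 + fourier_exp x y) = 2 * \<bar>cos (pi * (x \<bullet> y))\<bar>"
proof -
  define t where "t = pi * (x \<bullet> y)"
  have "fourier_exp x y = cis (- 2 * t)" by (simp add: fourier_exp_def cis_conv_exp t_def mult_ac)
  then have "(cmod (1 + fourier_exp x y))\<^sup>2 = (1 + cos (2 * t))\<^sup>2 + (sin (2 * t))\<^sup>2"
    by (simp add: cmod_power2)
  also have "\<dots> = 2 + 2 * cos (2 * t)"
    using sin_cos_squared_add[of "2 * t"] by (simp add: power2_eq_square algebra_simps)
  also have "\<dots> = (2 * \<bar>cos t\<bar>)\<^sup>2" by (simp add: cos_double_cos power_mult_distrib)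
  finally have "cmod (1 + fourier_exp x y) = 2 * \<bar>cos t\<bar>" by (rule power2_eq_imp_eq) auto
  then show ?thesis by (simp add: t_def)
qed

lemma cos_far_from_integers:
  assumes "0 \<le> \<epsilon>" "\<epsilon> \<le> 1 / 2" "\<And>n::int. \<bar>t - of_int n\<bar> \<ge> \<epsilon>"
  shows "\<bar>cos (pi * t)\<bar> \<le> cos (pi * \<epsilon>)"
proof -
  define s where "s = t - of_int (round t)"
  have s: "\<bar>s\<bar> \<le> 1 / 2" "\<epsilon> \<le> \<bar>s\<bar>"
    using of_int_round_abs_le[of t] assms(3)[of "round t"] by (auto simp: s_def abs_minus_commute)
  have "cos (pi * t) = cos (pi * s + pi * of_int (round t))" by (simp add: s_def algebra_simps)
  also have "\<dots> = cos (pi * s) * cos (pi * of_int (round t))"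
    by (simp add: cos_add sin_zero_iff_int2 mult.commute)
  finally have "\<bar>cos (pi * t)\<bar> = \<bar>cos (pi * s)\<bar>"
    by (simp add: abs_mult cos_int_times_real mult.commute)
  also have "\<dots> = cos (pi * \<bar>s\<bar>)"
  proof -
    have "pi * \<bar>s\<bar> \<le> pi * (1 / 2)" using s by (intro mult_left_mono) auto
    then have "0 \<le> cos (pi * \<bar>s\<bar>)" by (intro cos_ge_zero) (auto simp: mult_nonneg_nonneg intro: order_trans[of _ 0])
    moreover have "cos (pi * \<bar>s\<bar>) = cos (pi * s)" by (simp add: abs_if)
    ultimately show ?thesis by simp
  qed
  also have "\<dots> \<le> cos (pi * \<epsilon>)"
    using s assms by (intro cos_monotone_0_pi_le mult_left_mono) auto
  finally show ?thesis .
qed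

lemma affine_map_measurable: "affine_map M d \<in> borel_measurable borel"
  unfolding affine_map_def
  by (intro borel_measurable_continuous_onI continuous_intros linear_continuous_on_compose[OF _ matrix_vector_mul_linear])

lemma matrix_inv_upper_triangular:
  fixes \<rho>1 \<rho>2 c :: real
  assumes "\<rho>1 \<noteq> 0" "\<rho>2 \<noteq> 0"
  shows "matrix_inv (vector [vector [inverse \<rho>1, c], vector [0, inverse \<rho>2]] :: real ^ 2 ^ 2)
    = vector [vector [\<rho>1, - c * \<rho>1 * \<rho>2], vector [0, \<rho>2]]"
proof -
  let ?M = "vector [vector [inverse \<rho>1, c], vector [0, inverse \<rho>2]] :: real ^ 2 ^ 2"
  let ?N = "vector [vector [\<rho>1, - c * \<rho>1 * \<rho>2], vector [0, \<rho>2]] :: real ^ 2 ^ 2"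
  have MN: "?M ** ?N = mat 1" "?N ** ?M = mat 1"
    using assms by (simp_all add: matrix_matrix_mult_def vec_eq_iff forall_2 sum_2 mat_def)
  then have "\<exists>A'. ?M ** A' = mat 1 \<and> A' ** ?M = mat 1" by blast
  from someI_ex[OF this] have "matrix_inv ?M ** ?M = mat 1" unfolding matrix_inv_def by blast
  then have "(matrix_inv ?M ** ?M) ** ?N = ?N" by (simp add: matrix_mul_lid)
  then show ?thesis unfolding matrix_mul_assoc[symmetric] MN(1) by (simp add: matrix_mul_rid)
qed

lemma unit_root_sum:
  fixes p :: nat and n :: int
  assumes "p > 0"
  defines "E \<equiv> \<lambda>t::int. exp (- 2 * complex_of_real pi * \<i> * of_int t / of_nat p)"
  shows "(\<Sum>j<p. E (int j * n)) = (if int p dvd n then of_nat p else 0)"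
proof -
  have Epow: "E (int j * n) = E n ^ j" for j
    by (simp add: E_def flip: exp_of_nat_mult) (simp add: field_simps)
  have E1: "E n = 1 \<longleftrightarrow> int p dvd n"
  proof -
    have "E n = 1 \<longleftrightarrow> (\<exists>k::int. - 2 * pi * of_int n / of_nat p = of_int (2 * k) * pi)"
      unfolding E_def exp_eq_1 by simp
    also have "\<dots> \<longleftrightarrow> (\<exists>k::int. n = - k * int p)"
    proof (intro ex_cong1)
      fix k :: int
      have "- 2 * pi * of_int n / of_nat p = of_int (2 * k) * pi
          \<longleftrightarrow> pi * real_of_int n = pi * real_of_int (- k * int p)"
        using assms(1) by (auto simp: field_simps)
      also have "\<dots> \<longleftrightarrow> real_of_int n = real_of_int (- k * int p)"
        by (simp only: mult_cancel_left pi_neq_zero simp_thms)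
      finally have "- 2 * pi * of_int n / of_nat p = of_int (2 * k) * pi
          \<longleftrightarrow> real_of_int n = real_of_int (- k * int p)" .
      then show "- 2 * pi * of_int n / of_nat p = of_int (2 * k) * pi \<longleftrightarrow> n = - k * int p"
        by (simp only: of_int_eq_iff)
    qed
    also have "\<dots> \<longleftrightarrow> int p dvd n"
    proof
      assume "int p dvd n"
      then obtain k where "n = int p * k" ..
      then show "\<exists>k. n = - k * int p" by (intro exI[of _ "- k"]) simp
    qed auto
    finally show ?thesis .
  qed
  have Ep: "E n ^ p = 1"
  proof -
    have "E n ^ p = exp (2 * of_int (- n) * complex_of_real pi * \<i>)"
      using assms(1) by (simp add: E_def mult_ac flip: exp_of_nat_mult)
    then show ?thesis using exp_integer_2pi[of "of_int (- n)"] by simp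
  qed
  show ?thesis
  proof (cases "int p dvd n")
    case True
    then show ?thesis using E1 by (simp add: Epow)
  next
    case False
    then have "E n \<noteq> 1" using E1 by simp
    then show ?thesis using False Ep by (simp add: Epow sum_gp_strict)
  qed
qed

text \<open>Expand the square; the sum over \<open>j\<close> is orthogonality of the characters modulo \<open>p\<close>.\<close>
lemma unit_root_parseval:
  fixes p :: nat and T :: "nat \<Rightarrow> int" and u :: "nat \<Rightarrow> complex"
  assumes "p > 0"
  defines "E \<equiv> \<lambda>t::int. exp (- 2 * complex_of_real pi * \<i> * of_int t / of_nat p)"
  shows "(\<Sum>j<p. complex_of_real ((cmod (\<Sum>i<p. u i * E (int j * T i)))\<^sup>2))
    = of_nat p * (\<Sum>i<p. \<Sum>i'<p. if int p dvd T i - T i' then u i * cnj (u i') else 0)"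
proof -
  have mult: "E s * cnj (E t) = E (s - t)" for s t
    by (simp add: E_def exp_cnj diff_divide_distrib algebra_simps flip: exp_add)
  have "(\<Sum>j<p. complex_of_real ((cmod (\<Sum>i<p. u i * E (int j * T i)))\<^sup>2))
      = (\<Sum>j<p. \<Sum>i<p. \<Sum>i'<p. u i * cnj (u i') * E (int j * (T i - T i')))"
  proof (intro sum.cong refl)
    fix j
    have "complex_of_real ((cmod (\<Sum>i<p. u i * E (int j * T i)))\<^sup>2)
        = (\<Sum>i<p. \<Sum>i'<p. (u i * E (int j * T i)) * cnj (u i' * E (int j * T i')))"
      unfolding complex_norm_square cnj_sum sum_product ..
    also have "\<dots> = (\<Sum>i<p. \<Sum>i'<p. u i * cnj (u i') * E (int j * (T i - T i')))"
      by (intro sum.cong refl) (simp add: right_diff_distrib flip: mult)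
    finally show "complex_of_real ((cmod (\<Sum>i<p. u i * E (int j * T i)))\<^sup>2)
        = (\<Sum>i<p. \<Sum>i'<p. u i * cnj (u i') * E (int j * (T i - T i')))" .
  qed
  also have "\<dots> = (\<Sum>i<p. \<Sum>j<p. \<Sum>i'<p. u i * cnj (u i') * E (int j * (T i - T i')))"
    by (rule sum.swap)
  also have "\<dots> = (\<Sum>i<p. \<Sum>i'<p. \<Sum>j<p. u i * cnj (u i') * E (int j * (T i - T i')))"
    by (intro sum.cong refl sum.swap)
  also have "\<dots> = (\<Sum>i<p. \<Sum>i'<p. u i * cnj (u i') * (\<Sum>j<p. E (int j * (T i - T i'))))"
    by (simp add: sum_distrib_left)
  also have "\<dots> = (\<Sum>i<p. \<Sum>i'<p. of_nat p * (if int p dvd T i - T i' then u i * cnj (u i') else 0))"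
  proof -
    have "(\<Sum>j<p. E (int j * n)) = (if int p dvd n then of_nat p else 0)" for n
      unfolding E_def by (rule unit_root_sum[OF assms(1)])
    then show ?thesis by (intro sum.cong refl) simp
  qed
  finally show ?thesis by (simp add: sum_distrib_left)
qed

text \<open>The data of the theorem; \<open>\<kappa>\<close> is its slope, and \<open>p ^ l\<close> is the exact power of \<open>p\<close> in the
denominator of \<open>\<kappa>\<close>.\<close>
locale planar_system =
  fixes p l :: nat and \<rho>1 \<rho>2 c :: real and M :: "real ^ 2 ^ 2"
    and d :: "nat \<Rightarrow> int ^ 2" and D :: "(real ^ 2) set" and d11 :: int
    and a :: "int ^ 2" and \<mu> :: "(real ^ 2) measure" and \<kappa> :: real and c1 c2 :: int
  assumes prime_p: "prime p"
    and rho1: "\<rho>1 \<in> {0<..<1}" and rho2: "\<rho>2 \<in> {0<..<1}" and rho_ne: "\<rho>1 \<noteq> \<rho>2"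
    and M_eq: "M = vector [vector [inverse \<rho>1, c], vector [0, inverse \<rho>2]]"
    and d_inj: "inj_on d {..<p}" and D_eq: "D = (\<lambda>i. real_vec (d i)) ` {..<p}"
    and d_0: "d 0 = 0" and d_1: "d 1 = vector [d11, 0]" and d11_nz: "d11 \<noteq> 0"
    and a_res: "a \<in> residue_vectors p"
    and zeros: "zero_set (fourier_transform (delta_measure D)) =
           (\<Union>j\<in>{1..p - 1}. {(real j / real p) *\<^sub>R real_vec a + real_vec k | k. True})"
    and self_affine: "self_affine_measure M D \<mu>"
    and \<kappa>_eq: "\<kappa> = c / (inverse \<rho>1 - inverse \<rho>2)"
    and \<kappa>_E: "\<kappa> \<in> E_set p a"
    and \<kappa>_frac: "\<kappa> = real_of_int c1 / real_of_int c2" and c12: "coprime c1 c2"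
    and c2_form: "\<exists>m. c2 = int p ^ l * m \<and> \<not> int p dvd m"
begin

abbreviation r1 :: real where "r1 \<equiv> inverse \<rho>1"
abbreviation r2 :: real where "r2 \<equiv> inverse \<rho>2"
abbreviation f :: "real ^ 2 \<Rightarrow> complex" where "f \<equiv> fourier_transform (delta_measure D)"
abbreviation g :: "real ^ 2 \<Rightarrow> complex" where "g \<equiv> fourier_transform \<mu>"
abbreviation P :: "nat \<Rightarrow> real ^ 2 \<Rightarrow> real ^ 2" where "P n \<equiv> eigen_scale \<kappa> (\<rho>1 ^ n) (\<rho>2 ^ n)"
abbreviation U :: "nat \<Rightarrow> real ^ 2 \<Rightarrow> real ^ 2" where "U n \<equiv> eigen_scale \<kappa> (r1 ^ n) (r2 ^ n)"

lemma rho: "0 < \<rho>1" "\<rho>1 < 1" "0 < \<rho>2" "\<rho>2 < 1"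
  using rho1 rho2 by auto

lemma r_gt_1: "r1 > 1" "r2 > 1"
  using rho by (auto simp: one_less_inverse_iff)

lemma p_ge_2: "p \<ge> 2"
  using prime_p by (rule prime_ge_2_nat)

lemma real_vec_inj: "real_vec x = real_vec y \<longleftrightarrow> x = y"
  by (simp add: vec_eq_iff)

lemma D_props: "finite D" "D \<noteq> {}" "card D = p" "inj_on (\<lambda>i. real_vec (d i)) {..<p}"
proof -
  show inj: "inj_on (\<lambda>i. real_vec (d i)) {..<p}"
    using d_inj by (auto simp: inj_on_def real_vec_inj)
  show "finite D" "card D = p" unfolding D_eq using card_image[OF inj] by auto
  show "D \<noteq> {}" unfolding D_eq using p_ge_2 by (simp add: lessThan_empty_iff)
qed

lemma zero_in_D: "0 \<in> D"
proof -
  have "real_vec (d 0) \<in> D" unfolding D_eq using p_ge_2 by (intro imageI) simp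
  then show ?thesis by (simp add: d_0 real_vec_def zero_vec_def)
qed

lemma d1_in_D: "real_vec (d 1) \<in> D"
  unfolding D_eq using p_ge_2 by (intro imageI) simp

lemma f_eq: "f x = (\<Sum>v\<in>D. fourier_exp x v) / of_nat (card D)"
  by (rule fourier_transform_delta_measure[OF D_props(1,2)])

lemma f_zero_iff: "f x = 0 \<longleftrightarrow> (\<exists>j\<in>{1..p - 1}. \<exists>k. x = (real j / real p) *\<^sub>R real_vec a + real_vec k)"
proof -
  have "f x = 0 \<longleftrightarrow> x \<in> zero_set f" by (simp add: zero_set_def)
  then show ?thesis unfolding zeros by auto
qed

lemma f_period: "f (x + real_vec k) = f x"
proof -
  have "fourier_exp (x + real_vec k) v = fourier_exp x v" if v: "v \<in> D" for v
  proof -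
    obtain i where "v = real_vec (d i)" using v by (auto simp: D_eq)
    then have "real_vec k \<bullet> v \<in> \<int>" by (simp add: inner_vec2)
    then show ?thesis by (simp add: fourier_exp_add fourier_exp_integer)
  qed
  then show ?thesis by (simp add: f_eq)
qed

lemma \<mu>_prob: "borel_prob \<mu>" and \<mu>_eq: "\<mu> = average_measure D (\<lambda>v. distr \<mu> borel (affine_map M v))"
  using self_affine by (auto simp: self_affine_measure_def borel_prob_def borel_prob_axioms_def)

sublocale borel_prob \<mu> by (rule \<mu>_prob)

lemma \<kappa>_rel: "\<kappa> * (\<rho>2 - \<rho>1) = c * \<rho>1 * \<rho>2"
proof -
  have "inverse \<rho>1 - inverse \<rho>2 = (\<rho>2 - \<rho>1) / (\<rho>1 * \<rho>2)" using rho by (simp add: field_simps)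
  then show ?thesis using rho rho_ne by (simp add: \<kappa>_eq)
qed

lemma affine_map_nth:
  "affine_map M v x $ 1 = \<rho>1 * (x $ 1 + v $ 1) - c * \<rho>1 * \<rho>2 * (x $ 2 + v $ 2)"
  "affine_map M v x $ 2 = \<rho>2 * (x $ 2 + v $ 2)"
proof -
  have "\<rho>1 \<noteq> 0" "\<rho>2 \<noteq> 0" using rho by auto
  note inv = matrix_inv_upper_triangular[OF this, of c]
  show "affine_map M v x $ 1 = \<rho>1 * (x $ 1 + v $ 1) - c * \<rho>1 * \<rho>2 * (x $ 2 + v $ 2)"
    "affine_map M v x $ 2 = \<rho>2 * (x $ 2 + v $ 2)"
    unfolding affine_map_def M_eq inv by (simp_all add: matrix_vector_mult_def sum_2)
qed

lemma inner_affine_map: "x \<bullet> affine_map M v y = P 1 x \<bullet> (y + v)"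
proof -
  have "P 1 x \<bullet> (y + v) - x \<bullet> affine_map M v y = x $ 1 * (y $ 2 + v $ 2) * (c * \<rho>1 * \<rho>2 - \<kappa> * (\<rho>2 - \<rho>1))"
    by (simp add: inner_vec2 affine_map_nth algebra_simps)
  then show ?thesis by (simp add: \<kappa>_rel)
qed

lemma g_refine: "g x = f (P 1 x) * g (P 1 x)"
proof -
  have pull: "(LINT y|distr \<mu> borel (affine_map M v). fourier_exp x y) = fourier_exp (P 1 x) v * g (P 1 x)" for v
  proof -
    have "affine_map M v \<in> measurable \<mu> borel"
      using affine_map_measurable[of M v] by (simp add: measurable_cong_sets[OF sets_\<mu> refl])
    then have "(LINT y|distr \<mu> borel (affine_map M v). fourier_exp x y)
        = (LINT y|\<mu>. fourier_exp x (affine_map M v y))"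
      by (intro integral_distr) auto
    also have "\<dots> = (LINT y|\<mu>. fourier_exp (P 1 x) v * fourier_exp (P 1 x) y)"
    proof (rule Bochner_Integration.integral_cong[OF refl])
      fix y
      have "fourier_exp x (affine_map M v y) = fourier_exp (P 1 x) (y + v)"
        unfolding fourier_exp_def inner_affine_map ..
      then show "fourier_exp x (affine_map M v y) = fourier_exp (P 1 x) v * fourier_exp (P 1 x) y"
        by (simp add: fourier_exp_add_right mult.commute)
    qed
    finally show ?thesis by (simp add: fourier_transform_def)
  qed
  have "g x = (LINT y|average_measure D (\<lambda>v. distr \<mu> borel (affine_map M v)). fourier_exp x y)"
    unfolding fourier_transform_def using arg_cong[OF \<mu>_eq, of "\<lambda>\<nu>. LINT y|\<nu>. fourier_exp x y"] .
  also have "\<dots> = (\<Sum>v\<in>D. LINT y|distr \<mu> borel (affine_map M v). fourier_exp x y) / of_nat (card D)"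
  proof (rule integral_average_measure[OF D_props(1,2), where B = 1])
    show "prob_space (distr \<mu> borel (affine_map M v))" for v
      using affine_map_measurable[of M v]
      by (intro prob_space_distr) (simp add: measurable_cong_sets[OF sets_\<mu> refl])
  qed auto
  also have "\<dots> = f (P 1 x) * g (P 1 x)"
    by (simp add: pull f_eq sum_distrib_right)
  finally show ?thesis .
qed

text \<open>Along each of two independent linear functionals, the maps of the system act as a contraction followed by a
bounded translation.\<close>
lemma compactly_supported_\<mu>: "compactly_supported \<mu>"
proof -
  have [measurable]: "(\<lambda>x::real ^ 2. \<bar>x $ 1 + \<kappa> * x $ 2\<bar>) \<in> borel_measurable borel"
    "(\<lambda>x::real ^ 2. \<bar>x $ 2\<bar>) \<in> borel_measurable borel"
    by (intro borel_measurable_continuous_onI continuous_intros)+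
  \<comment> \<open>The two functionals are the eigenvectors of the transposed inverse of \<open>M\<close>.\<close>
  have "\<exists>R. prob {x. \<bar>x $ 1 + \<kappa> * x $ 2\<bar> \<le> R} = 1"
  proof (rule self_similar_bounded[OF \<mu>_eq D_props(1,2) affine_map_measurable])
    fix v x assume v: "v \<in> D"
    have "affine_map M v x $ 1 + \<kappa> * affine_map M v x $ 2
        = \<rho>1 * (x $ 1 + \<kappa> * x $ 2) + \<rho>1 * (v $ 1 + \<kappa> * v $ 2) + (\<kappa> * (\<rho>2 - \<rho>1) - c * \<rho>1 * \<rho>2) * (x $ 2 + v $ 2)"
      by (simp add: affine_map_nth algebra_simps)
    also have "\<dots> = \<rho>1 * (x $ 1 + \<kappa> * x $ 2) + \<rho>1 * (v $ 1 + \<kappa> * v $ 2)" by (simp add: \<kappa>_rel)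
    also have "\<bar>\<dots>\<bar> \<le> \<rho>1 * \<bar>x $ 1 + \<kappa> * x $ 2\<bar> + \<rho>1 * \<bar>v $ 1 + \<kappa> * v $ 2\<bar>"
      using rho by (intro order_trans[OF abs_triangle_ineq]) (simp add: abs_mult)
    also have "\<rho>1 * \<bar>v $ 1 + \<kappa> * v $ 2\<bar> \<le> (\<Sum>v\<in>D. \<rho>1 * \<bar>v $ 1 + \<kappa> * v $ 2\<bar>)"
      using rho v D_props(1) by (intro member_le_sum) auto
    finally show "\<bar>affine_map M v x $ 1 + \<kappa> * affine_map M v x $ 2\<bar>
      \<le> \<rho>1 * \<bar>x $ 1 + \<kappa> * x $ 2\<bar> + (\<Sum>v\<in>D. \<rho>1 * \<bar>v $ 1 + \<kappa> * v $ 2\<bar>)" by simp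
  qed (use rho in auto)
  then obtain R1 where R1: "prob {x. \<bar>x $ 1 + \<kappa> * x $ 2\<bar> \<le> R1} = 1" by blast
  have "\<exists>R. prob {x. \<bar>x $ 2\<bar> \<le> R} = 1"
  proof (rule self_similar_bounded[OF \<mu>_eq D_props(1,2) affine_map_measurable])
    fix v x assume v: "v \<in> D"
    have "\<bar>affine_map M v x $ 2\<bar> = \<bar>\<rho>2 * x $ 2 + \<rho>2 * v $ 2\<bar>"
      by (simp add: affine_map_nth algebra_simps)
    also have "\<dots> \<le> \<rho>2 * \<bar>x $ 2\<bar> + \<rho>2 * \<bar>v $ 2\<bar>"
      using rho by (intro order_trans[OF abs_triangle_ineq]) (simp add: abs_mult)
    also have "\<rho>2 * \<bar>v $ 2\<bar> \<le> (\<Sum>v\<in>D. \<rho>2 * \<bar>v $ 2\<bar>)"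
      using rho v D_props(1) by (intro member_le_sum) auto
    finally show "\<bar>affine_map M v x $ 2\<bar> \<le> \<rho>2 * \<bar>x $ 2\<bar> + (\<Sum>v\<in>D. \<rho>2 * \<bar>v $ 2\<bar>)" by simp
  qed (use rho in auto)
  then obtain R2 where R2: "prob {x. \<bar>x $ 2\<bar> \<le> R2} = 1" by blast
  define K where "K = {x::real ^ 2. \<bar>x $ 1 + \<kappa> * x $ 2\<bar> \<le> R1} \<inter> {x. \<bar>x $ 2\<bar> \<le> R2}"
  have "closed K" unfolding K_def
    by (intro closed_Int closed_Collect_le continuous_intros)
  moreover have "bounded K"
  proof (rule boundedI)
    fix x assume x: "x \<in> K"
    have "\<bar>x $ 1\<bar> \<le> \<bar>x $ 1 + \<kappa> * x $ 2\<bar> + \<bar>\<kappa> * x $ 2\<bar>" by linarith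
    also have "\<bar>\<kappa> * x $ 2\<bar> \<le> \<bar>\<kappa>\<bar> * R2" unfolding abs_mult using x by (intro mult_left_mono) (auto simp: K_def)
    finally have "\<bar>x $ 1\<bar> \<le> R1 + \<bar>\<kappa>\<bar> * R2" using x by (simp add: K_def)
    moreover have "norm x \<le> \<bar>x $ 1\<bar> + \<bar>x $ 2\<bar>" using norm_le_l1_cart[of x] by (simp add: sum_2)
    ultimately show "norm x \<le> R1 + \<bar>\<kappa>\<bar> * R2 + R2" using x by (simp add: K_def)
  qed
  ultimately have "compact K" by (simp add: compact_eq_bounded_closed)
  moreover have "AE x in \<mu>. x \<in> {x. \<bar>x $ 1 + \<kappa> * x $ 2\<bar> \<le> R1}"
    using R1 by (subst (asm) prob_eq_1) (auto simp: sets_\<mu>)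
  moreover have "AE x in \<mu>. x \<in> {x. \<bar>x $ 2\<bar> \<le> R2}"
    using R2 by (subst (asm) prob_eq_1) (auto simp: sets_\<mu>)
  ultimately have "compact K" "AE x in \<mu>. x \<in> K" by (auto simp: K_def)
  moreover from this(2) have "emeasure \<mu> {x \<in> space \<mu>. x \<notin> K} = 0"
    by (intro emeasure_eq_0_AE) auto
  moreover have "{x \<in> space \<mu>. x \<notin> K} = - K" by auto
  ultimately show ?thesis unfolding compactly_supported_def by auto
qed

sublocale refinable D f g P
proof (rule refinable.intro)
  show "linear (P n)" for n by (rule linear_eigen_scale)
  show "P 0 x = x" for x by (simp add: eigen_scale_1)
  show "P m (P n x) = P (m + n) x" for m n x by (simp add: eigen_scale_compose power_add)
  show "inj (P n)" for n using rho by (intro inj_eigen_scale) auto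
  show "(\<lambda>n. P n x) \<longlonglongrightarrow> 0" for x
  proof (rule vec_tendstoI)
    have z: "(\<lambda>n. \<rho>1 ^ n) \<longlonglongrightarrow> 0" "(\<lambda>n. \<rho>2 ^ n) \<longlonglongrightarrow> 0"
      using rho by (auto intro: LIMSEQ_realpow_zero)
    have 1: "(\<lambda>n. P n x $ 1) \<longlonglongrightarrow> 0" using tendsto_mult_left_zero[OF z(1)] by simp
    have 2: "(\<lambda>n. P n x $ 2) \<longlonglongrightarrow> \<kappa> * (0 * x $ 1) + 0 * (x $ 2 - \<kappa> * x $ 1)"
      unfolding eigen_scale_nth by (intro tendsto_intros z)
    fix i :: 2
    have "i = 1 \<or> i = 2" by (rule exhaust_2)
    then show "(\<lambda>n. P n x $ i) \<longlonglongrightarrow> 0 $ i" using 1 2 by (elim disjE) auto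
  qed
qed (rule D_props f_eq g_refine fourier_transform_0 continuous_fourier_transform
      positive_definite_fourier_transform)+

end

section \<open>Necessity\<close>

context planar_system
begin

lemma p_pos: "p > 0" "real p > 0"
  using p_ge_2 by auto

lemma c2_nz: "c2 \<noteq> 0"
  using c2_form p_pos by auto

lemma a_not_dvd: "\<not> int p dvd a $ i"
proof
  assume "int p dvd a $ i"
  moreover have "1 \<le> a $ i" "a $ i \<le> int p - 1" using a_res by (auto simp: residue_vectors_def)
  ultimately show False using zdvd_imp_le[of "int p" "a $ i"] by linarith
qed

lemma prime_int_p: "prime (int p)"
  using prime_p by simp

lemma prime_dvd_mult_int: "int p dvd x * y \<longleftrightarrow> int p dvd x \<or> int p dvd y"
  using prime_dvd_mult_iff[OF prime_int_p] .

lemma small_not_dvd: "j \<in> {1..p - 1} \<Longrightarrow> \<not> int p dvd int j"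
  using p_ge_2 zdvd_imp_le[of "int p" "int j"] by (auto)

text \<open>A fraction in lowest terms is determined up to sign, so the condition in \<open>E_set\<close> holds for \<open>c1\<close> and \<open>c2\<close>. The
exceptional slope \<open>0 = 0 / 1\<close> satisfies it as well, since \<open>p\<close> does not divide the second coordinate of \<open>a\<close>.\<close>
lemma slope_not_dvd: "\<not> int p dvd c2 * a $ 2 - c1 * a $ 1"
proof (cases "\<kappa> = 0")
  case True
  then have "c1 = 0" using \<kappa>_frac c2_nz by simp
  moreover from this have "\<bar>c2\<bar> = 1" using c12 by simp
  then have "c2 = 1 \<or> c2 = - 1" by linarith
  ultimately show ?thesis using a_not_dvd[of 2] by auto
next
  case False
  then obtain h k where hk: "\<kappa> = real_of_int h / real_of_int k" "k \<noteq> 0" "coprime h k"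
    "\<not> int p dvd k * a $ 2 - h * a $ 1"
    using \<kappa>_E by (auto simp: E_set_def)
  have "real_of_int (h * c2) = real_of_int (c1 * k)"
    using hk(1,2) \<kappa>_frac c2_nz by (simp add: field_simps)
  then have eq: "h * c2 = c1 * k" by (simp only: of_int_eq_iff)
  have "k dvd h * c2" unfolding eq by simp
  then have "k dvd c2" using hk(3) by (simp add: coprime_commute coprime_dvd_mult_right_iff)
  then obtain e where e: "c2 = k * e" ..
  then have "c1 = h * e" using eq hk(2) by (simp add: mult_ac)
  have "c2 * a $ 2 - c1 * a $ 1 = e * (k * a $ 2 - h * a $ 1)"
    unfolding e \<open>c1 = h * e\<close> by (simp add: algebra_simps)
  moreover have "is_unit e" using c12 unfolding e \<open>c1 = h * e\<close> by (simp add: coprime_def)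
  ultimately show ?thesis using hk(4) by (simp only: dvd_mult_unit_iff' not_False_eq_True)
qed

lemma inner_d1: "x \<bullet> real_vec (d 1) = x $ 1 * real_of_int d11"
  unfolding d_1 by (simp add: inner_vec2)

text \<open>Two linear functionals diagonalise \<open>P\<close>. On the zeros of \<open>f\<close> both take integer values prime
  to \<open>p\<close>: for the first one because \<open>p\<close> does not divide the first coordinate of \<open>a\<close>, for the second
  one because of the hypothesis on the slope.\<close>

definition \<phi>1 :: "real ^ 2 \<Rightarrow> real" where "\<phi>1 x = real p * x $ 1"
definition \<phi>2 :: "real ^ 2 \<Rightarrow> real" where "\<phi>2 x = real p * (c2 * x $ 2 - c1 * x $ 1)"

lemma c2_\<kappa>: "real_of_int c2 * \<kappa> = real_of_int c1"
  using \<kappa>_frac c2_nz by simp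

lemma \<phi>_zero_form:
  assumes "f x = 0"
  shows "\<exists>\<alpha>. \<not> int p dvd \<alpha> \<and> \<phi>1 x = real_of_int \<alpha>" "\<exists>\<alpha>. \<not> int p dvd \<alpha> \<and> \<phi>2 x = real_of_int \<alpha>"
proof -
  obtain j k where j: "j \<in> {1..p - 1}" and x: "x = (real j / real p) *\<^sub>R real_vec a + real_vec k"
    using assms f_zero_iff by blast
  have "\<phi>1 x = real_of_int (int j * a $ 1 + int p * k $ 1)"
    using p_pos by (simp add: \<phi>1_def x field_simps)
  moreover have "\<not> int p dvd int j * a $ 1 + int p * k $ 1"
    using small_not_dvd[OF j] a_not_dvd[of 1] by (simp add: dvd_add_left_iff prime_dvd_mult_int)
  ultimately show "\<exists>\<alpha>. \<not> int p dvd \<alpha> \<and> \<phi>1 x = real_of_int \<alpha>" by blast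
  have "\<phi>2 x = real_of_int (int j * (c2 * a $ 2 - c1 * a $ 1) + int p * (c2 * k $ 2 - c1 * k $ 1))"
    using p_pos by (simp add: \<phi>2_def x field_simps)
  moreover have "\<not> int p dvd int j * (c2 * a $ 2 - c1 * a $ 1) + int p * (c2 * k $ 2 - c1 * k $ 1)"
    using small_not_dvd[OF j] slope_not_dvd by (simp add: dvd_add_left_iff prime_dvd_mult_int)
  ultimately show "\<exists>\<alpha>. \<not> int p dvd \<alpha> \<and> \<phi>2 x = real_of_int \<alpha>" by blast
qed

lemma \<phi>_linear: "linear \<phi>1" "linear \<phi>2"
  by (rule linearI; simp add: \<phi>1_def \<phi>2_def algebra_simps)+

lemma \<phi>_P: "\<phi>1 (P n x) = \<phi>1 x / r1 ^ n" "\<phi>2 (P n x) = \<phi>2 x / r2 ^ n"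
proof -
  show "\<phi>1 (P n x) = \<phi>1 x / r1 ^ n" by (simp add: \<phi>1_def power_inverse divide_inverse)
  have "\<phi>2 y = real p * (c2 * (y $ 2 - \<kappa> * y $ 1))" for y
    by (simp add: \<phi>2_def right_diff_distrib c2_\<kappa> flip: mult.assoc)
  then show "\<phi>2 (P n x) = \<phi>2 x / r2 ^ n" by (simp add: power_inverse divide_inverse)
qed

text \<open>All terms are unimodular, and \<open>0\<close> is a digit: only the two digits \<open>0\<close> and \<open>v\<close> are kept apart.\<close>
lemma norm_f_le:
  assumes "v \<in> D" "v \<noteq> 0"
  shows "real p * cmod (f x) \<le> real p - 2 + 2 * \<bar>cos (pi * (x \<bullet> v))\<bar>"
proof -
  have sub: "{0, v} \<subseteq> D" using assms zero_in_D by auto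
  have cv: "card {0, v} = 2" using assms by auto
  have "(\<Sum>u\<in>D. fourier_exp x u) = (\<Sum>u\<in>D - {0, v}. fourier_exp x u) + (\<Sum>u\<in>{0, v}. fourier_exp x u)"
    by (rule sum.subset_diff[OF sub D_props(1)])
  also have "(\<Sum>u\<in>{0, v}. fourier_exp x u) = 1 + fourier_exp x v" using assms(2) by auto
  finally have "cmod (\<Sum>u\<in>D. fourier_exp x u) \<le> cmod (\<Sum>u\<in>D - {0, v}. fourier_exp x u) + cmod (1 + fourier_exp x v)"
    using norm_triangle_ineq by metis
  also have "cmod (\<Sum>u\<in>D - {0, v}. fourier_exp x u) \<le> real (card (D - {0, v}))"
    using norm_sum[of "\<lambda>u. fourier_exp x u" "D - {0, v}"] by simp
  also have "card (D - {0, v}) = p - 2" using sub cv D_props by (simp add: card_Diff_subset)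
  finally have "cmod (\<Sum>u\<in>D. fourier_exp x u) \<le> real p - 2 + 2 * \<bar>cos (pi * (x \<bullet> v))\<bar>"
    using p_ge_2 by (simp add: norm_one_plus_fourier_exp of_nat_diff)
  then show ?thesis using p_pos by (simp add: f_eq D_props(3) norm_divide)
qed

lemma near_integer_digit:
  assumes "\<epsilon> > 0"
  shows "\<exists>\<theta><1. \<forall>x. cmod (f x) > \<theta> \<longrightarrow> (\<forall>v\<in>D. \<exists>n::int. \<bar>x \<bullet> v - real_of_int n\<bar> < \<epsilon>)"
proof -
  define e where "e = min \<epsilon> (1 / 2)"
  have e: "0 < e" "e \<le> 1 / 2" "e \<le> \<epsilon>" using assms by (auto simp: e_def)
  define \<theta> where "\<theta> = (real p - 2 + 2 * cos (pi * e)) / real p"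
  have "cos (pi * e) < cos 0" using e by (intro cos_monotone_0_pi) auto
  then have "\<theta> < 1" using p_pos by (simp add: \<theta>_def)
  moreover have "\<exists>n::int. \<bar>x \<bullet> v - real_of_int n\<bar> < \<epsilon>" if x: "cmod (f x) > \<theta>" and v: "v \<in> D" for x v
  proof (cases "v = 0")
    case True
    then show ?thesis using assms by (intro exI[of _ 0]) simp
  next
    case False
    show ?thesis
    proof (rule ccontr)
      assume "\<nexists>n::int. \<bar>x \<bullet> v - real_of_int n\<bar> < \<epsilon>"
      then have "e \<le> \<bar>x \<bullet> v - real_of_int n\<bar>" for n using e(3) by (meson not_less order_trans)
      then have "\<bar>cos (pi * (x \<bullet> v))\<bar> \<le> cos (pi * e)" using e by (intro cos_far_from_integers) auto
      then have "real p * cmod (f x) \<le> real p - 2 + 2 * cos (pi * e)" using norm_f_le[OF v False, of x] by linarith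
      then have "cmod (f x) \<le> \<theta>" using p_pos by (simp add: \<theta>_def field_simps)
      then show False using x by simp
    qed
  qed
  ultimately show ?thesis by blast
qed

text \<open>If all digits were on the first axis, \<open>f\<close> would not depend on the second coordinate, and its
  zeros would fill lines.\<close>

lemma exists_off_axis: "\<exists>i<p. d i $ 2 \<noteq> 0"
proof (rule ccontr)
  assume "\<not> ?thesis"
  then have ax: "v $ 2 = 0" if "v \<in> D" for v using that by (auto simp: D_eq)
  define x y where "x = (real 1 / real p) *\<^sub>R real_vec a + real_vec 0"
    and "y = x + vector [0, 1 / (2 * real p)]"
  have "f x = 0" unfolding f_zero_iff x_def using p_ge_2 by (intro bexI[of _ 1] exI[of _ 0]) auto
  moreover have "f y = f x"
    unfolding f_eq using ax by (intro arg_cong2[of _ _ _ _ "(/)"] sum.cong refl)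
      (auto simp: fourier_exp_def inner_vec2 y_def)
  ultimately obtain j k where "y = (real j / real p) *\<^sub>R real_vec a + real_vec k"
    using f_zero_iff by metis
  then have "2 * real p * (y $ 2) = 2 * real p * (real j / real p * a $ 2 + k $ 2)" by simp
  moreover have "2 * real p * (y $ 2) = real_of_int (2 * a $ 2 + 1)"
    using p_pos by (simp add: y_def x_def distrib_left)
  moreover have "2 * real p * (real j / real p * a $ 2 + k $ 2) = real_of_int (2 * (int j * a $ 2 + int p * k $ 2))"
    using p_pos by (simp add: distrib_left)
  ultimately have "real_of_int (2 * a $ 2 + 1) = real_of_int (2 * (int j * a $ 2 + int p * k $ 2))" by simp
  then have "2 * a $ 2 + 1 = 2 * (int j * a $ 2 + int p * k $ 2)" by (simp only: of_int_eq_iff)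
  then show False by presburger
qed

lemma near_integer_\<phi>1:
  assumes "\<epsilon> > 0"
  shows "\<exists>\<theta><1. \<forall>x. cmod (f x) > \<theta> \<longrightarrow> (\<exists>n::int. \<bar>real_of_int d11 * \<phi>1 x - real_of_int n\<bar> < \<epsilon>)"
proof -
  obtain \<theta> where t: "\<theta> < 1" "\<And>x. cmod (f x) > \<theta> \<Longrightarrow> \<forall>v\<in>D. \<exists>n::int. \<bar>x \<bullet> v - real_of_int n\<bar> < \<epsilon> / real p"
    using near_integer_digit[of "\<epsilon> / real p"] assms p_pos by auto
  have "\<exists>n::int. \<bar>real_of_int d11 * \<phi>1 x - real_of_int n\<bar> < \<epsilon>" if x: "cmod (f x) > \<theta>" for x
  proof -
    obtain n :: int where "\<bar>x \<bullet> real_vec (d 1) - real_of_int n\<bar> < \<epsilon> / real p" using t(2)[OF x] d1_in_D by blast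
    then have "real p * \<bar>x $ 1 * d11 - real_of_int n\<bar> < \<epsilon>"
      using p_pos unfolding inner_d1 by (simp add: field_simps)
    moreover have "real_of_int d11 * \<phi>1 x - real_of_int (int p * n) = real p * (x $ 1 * d11 - real_of_int n)"
      by (simp add: \<phi>1_def algebra_simps)
    then have "\<bar>real_of_int d11 * \<phi>1 x - real_of_int (int p * n)\<bar> = real p * \<bar>x $ 1 * d11 - real_of_int n\<bar>"
      by (simp only: abs_mult abs_of_nat)
    ultimately have "\<bar>real_of_int d11 * \<phi>1 x - real_of_int (int p * n)\<bar> < \<epsilon>" by (simp only:)
    then show ?thesis by blast
  qed
  with t(1) show ?thesis by blast
qed

text \<open>Up to integer factors, \<open>\<phi>2 x\<close> is an integral combination of the inner products of \<open>x\<close> with a digit off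
the first axis and with the digit on the first axis.\<close>
lemma near_integer_\<phi>2:
  assumes i: "i < p" and "\<epsilon> > 0"
  shows "\<exists>\<theta><1. \<forall>x. cmod (f x) > \<theta> \<longrightarrow>
    (\<exists>n::int. \<bar>real_of_int (d11 * d i $ 2) * \<phi>2 x - real_of_int n\<bar> < \<epsilon>)"
proof -
  define A B where "A = int p * c2 * d11" and "B = int p * (c2 * d i $ 1 + c1 * d i $ 2)"
  define e where "e = \<epsilon> / (\<bar>A\<bar> + \<bar>B\<bar> + 1)"
  have den: "real_of_int (\<bar>A\<bar> + \<bar>B\<bar> + 1) > 0" by linarith
  then have e: "e > 0" using assms by (simp add: e_def)
  obtain \<theta> where t: "\<theta> < 1" "\<And>x. cmod (f x) > \<theta> \<Longrightarrow> \<forall>v\<in>D. \<exists>n::int. \<bar>x \<bullet> v - real_of_int n\<bar> < e"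
    using near_integer_digit[OF e] by blast
  have "\<exists>n::int. \<bar>real_of_int (d11 * d i $ 2) * \<phi>2 x - real_of_int n\<bar> < \<epsilon>" if x: "cmod (f x) > \<theta>" for x
  proof -
    obtain n :: int where n: "\<bar>x \<bullet> real_vec (d 1) - real_of_int n\<bar> < e" using t(2)[OF x] d1_in_D by blast
    have "real_vec (d i) \<in> D" using i by (simp add: D_eq)
    then obtain m :: int where m: "\<bar>x \<bullet> real_vec (d i) - real_of_int m\<bar> < e" using t(2)[OF x] by blast
    have "real_of_int (d11 * d i $ 2) * \<phi>2 x - real_of_int (A * m - B * n)
        = A * (x \<bullet> real_vec (d i) - m) - B * (x \<bullet> real_vec (d 1) - n)"
      unfolding inner_d1 by (simp add: \<phi>2_def A_def B_def inner_vec2 algebra_simps)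
    also have "\<bar>\<dots>\<bar> \<le> \<bar>A\<bar> * \<bar>x \<bullet> real_vec (d i) - m\<bar> + \<bar>B\<bar> * \<bar>x \<bullet> real_vec (d 1) - n\<bar>"
      by (rule order_trans[OF abs_triangle_ineq4]) (simp add: abs_mult)
    also have "\<dots> \<le> \<bar>A\<bar> * e + \<bar>B\<bar> * e"
      using m n by (intro add_mono mult_left_mono) auto
    also have "\<dots> < real_of_int (\<bar>A\<bar> + \<bar>B\<bar> + 1) * e" using e by (simp add: algebra_simps)
    also have "\<dots> = \<epsilon>" using den by (simp add: e_def)
    finally show ?thesis by blast
  qed
  with t(1) show ?thesis by blast
qed

lemma small_strict:
  assumes "\<epsilon> > 0"
  shows "\<exists>\<eta>. norm \<eta> < \<epsilon> \<and> (\<forall>n. cmod (f (P n \<eta>)) < 1)"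
proof -
  define t where "t = min (\<epsilon> / 2) (1 / (2 * \<bar>real_of_int d11\<bar>))"
  have t: "0 < t" "t < \<epsilon>" "t * \<bar>real_of_int d11\<bar> \<le> 1 / 2"
  proof -
    show "0 < t" "t < \<epsilon>" using assms d11_nz by (auto simp: t_def)
    have "t \<le> 1 / (2 * \<bar>real_of_int d11\<bar>)" by (simp add: t_def)
    then have "t * \<bar>real_of_int d11\<bar> \<le> 1 / (2 * \<bar>real_of_int d11\<bar>) * \<bar>real_of_int d11\<bar>"
      by (rule mult_right_mono) simp
    then show "t * \<bar>real_of_int d11\<bar> \<le> 1 / 2" using d11_nz by simp
  qed
  define \<eta> :: "real ^ 2" where "\<eta> = vector [t, 0]"
  have "norm \<eta> \<le> \<bar>\<eta> $ 1\<bar> + \<bar>\<eta> $ 2\<bar>" using norm_le_l1_cart[of \<eta>] by (simp add: sum_2)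
  then have "norm \<eta> < \<epsilon>" using t by (simp add: \<eta>_def)
  moreover have "cmod (f (P n \<eta>)) < 1" for n
  proof -
    define s where "s = \<bar>P n \<eta> \<bullet> real_vec (d 1)\<bar>"
    have s_eq: "s = \<rho>1 ^ n * (t * \<bar>real_of_int d11\<bar>)"
      using rho t unfolding s_def inner_d1 by (simp add: \<eta>_def abs_mult)
    have "\<rho>1 ^ n \<le> 1" using rho by (simp add: power_le_one)
    then have "s \<le> 1 * (1 / 2)" unfolding s_eq using rho t by (intro mult_mono) auto
    moreover have "0 < s" unfolding s_eq using rho t d11_nz by simp
    ultimately have "0 < pi * s" "pi * s < pi" by auto
    then have "cos (pi * s) < 1" "- 1 < cos (pi * s)"
      using cos_monotone_0_pi[of 0 "pi * s"] cos_monotone_0_pi[of "pi * s" pi] by auto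
    moreover have "cos (pi * s) = cos (pi * (P n \<eta> \<bullet> real_vec (d 1)))"
      by (simp add: s_def abs_if)
    ultimately have "\<bar>cos (pi * (P n \<eta> \<bullet> real_vec (d 1)))\<bar> < 1" by linarith
    moreover have "real_vec (d 1) \<noteq> 0"
      using d11_nz unfolding d_1 by (auto simp: vec2_eq_iff)
    ultimately have "real p * cmod (f (P n \<eta>)) < real p * 1"
      using norm_f_le[OF d1_in_D, of "P n \<eta>"] by linarith
    then show ?thesis using p_pos by simp
  qed
  ultimately show ?thesis by blast
qed

text \<open>Both ratios are integral multiples of \<open>p\<close> by the functionals \<open>\<phi>1\<close> and \<open>\<phi>2\<close>. For the divisibility of their
difference, take a pair of level two, whose difference is the square of the transposed matrix applied to a
zero \<open>u\<close> of \<open>f\<close>, and link it through a third point by two pairs of level one. Then the transposed matrix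
applied to \<open>u\<close> is an integer vector, and its second coordinate contains the term
\<open>\<kappa> * (r1 - r2) * \<alpha> / p\<close> with \<open>\<alpha>\<close> prime to \<open>p\<close>.\<close>
lemma necessity:
  assumes "spectral_measure \<mu>"
  shows "r1 \<in> int_multiples (int p)" "r2 \<in> int_multiples (int p)"
    "r1 - r2 \<in> int_multiples (int p ^ (l + 1))"
proof -
  obtain \<Lambda> where basis: "orthonormal_basis_L2 \<mu> \<Lambda> fourier_exp"
    using assms by (auto simp: spectral_measure_def)
  note pars = basis[unfolded orthonormal_basis_iff_parseval[OF compactly_supported_\<mu>]]
  have spec: "refinable_spectrum D f g P \<Lambda>"
  proof (rule refinable_spectrum.intro[OF refinable_axioms], rule refinable_spectrum_axioms.intro)
    show "g (x - y) = 0" if "x \<in> \<Lambda>" "y \<in> \<Lambda>" "x \<noteq> y" for x y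
      using conjunct1[OF pars] that by blast
    show "\<exists>F\<subseteq>\<Lambda>. finite F \<and> (\<Sum>l\<in>F. (cmod (g (\<xi> + l)))\<^sup>2) > 1 - \<epsilon>" if "\<epsilon> > 0" for \<xi> \<epsilon>
      using conjunct2[OF pars] that by blast
  qed (rule small_strict)
  obtain i where i: "i < p" "d i $ 2 \<noteq> 0" using exists_off_axis by blast
  interpret L1: refinable_spectrum_functional D f g P \<Lambda> p r1 "real_of_int d11" \<phi>1
  proof (rule refinable_spectrum_functional.intro[OF spec], rule refinable_spectrum_functional_axioms.intro)
    have "1 \<le> \<bar>d11\<bar>" using d11_nz by linarith
    then show "1 \<le> \<bar>real_of_int d11\<bar>" by linarith
  qed (rule prime_p r_gt_1 \<phi>_linear \<phi>_P \<phi>_zero_form near_integer_\<phi>1, assumption?)+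
  interpret L2: refinable_spectrum_functional D f g P \<Lambda> p r2 "real_of_int (d11 * d i $ 2)" \<phi>2
  proof (rule refinable_spectrum_functional.intro[OF spec], rule refinable_spectrum_functional_axioms.intro)
    have "d11 * d i $ 2 \<noteq> 0" using d11_nz i by simp
    then have "1 \<le> \<bar>d11 * d i $ 2\<bar>" by linarith
    then show "1 \<le> \<bar>real_of_int (d11 * d i $ 2)\<bar>" by linarith
  qed (rule prime_p r_gt_1 \<phi>_linear \<phi>_P \<phi>_zero_form near_integer_\<phi>2[OF i(1)], assumption?)+
  obtain b1 where b1: "r1 = real_of_int (int p * b1)" using L1.r_multiple_of_p by blast
  obtain b2 where b2: "r2 = real_of_int (int p * b2)" using L2.r_multiple_of_p by blast
  show "r1 \<in> int_multiples (int p)" "r2 \<in> int_multiples (int p)"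
    using b1 b2 by (auto simp: int_multiples_def)
  show "r1 - r2 \<in> int_multiples (int p ^ (l + 1))"
  proof -
    obtain x y where xy: "x \<in> \<Lambda>" "y \<in> \<Lambda>" "x \<noteq> y" "f (P 2 (x - y)) = 0"
      using L1.level_occurs[of 2] by auto
    define u where "u = P 2 (x - y)"
    have U1: "P 1 (x - y) = U 1 u"
    proof -
      have "r1 * \<rho>1\<^sup>2 = \<rho>1" "r2 * \<rho>2\<^sup>2 = \<rho>2" using rho by (simp_all add: power2_eq_square flip: mult.assoc)
      then show ?thesis by (simp add: u_def eigen_scale_compose)
    qed
    obtain j0 k0 where j0: "j0 \<in> {1..p - 1}" and u: "u = (real j0 / real p) *\<^sub>R real_vec a + real_vec k0"
      using xy(4) f_zero_iff unfolding u_def by blast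
    define \<alpha> \<beta> where "\<alpha> = int j0 * a $ 1 + int p * k0 $ 1" and "\<beta> = int j0 * a $ 2 + int p * k0 $ 2"
    have u12: "u $ 1 = real_of_int \<alpha> / real p" "u $ 2 = real_of_int \<beta> / real p"
      using p_pos by (simp_all add: u \<alpha>_def \<beta>_def field_simps)
    have \<alpha>: "\<not> int p dvd \<alpha>"
      using small_not_dvd[OF j0] a_not_dvd[of 1] by (simp add: \<alpha>_def dvd_add_left_iff prime_dvd_mult_int)
    have U1_1: "U 1 u $ 1 = real_of_int (b1 * \<alpha>)"
      using p_pos by (simp add: u12 b1 del: inverse_eq_iff_eq)
    \<comment> \<open>Level two excludes level one, since multiplication by the multiple \<open>r1\<close> of \<open>p\<close> makes the
      first coordinate an integer.\<close>
    have "f (P 1 (x - y)) \<noteq> 0"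
    proof
      assume "f (P 1 (x - y)) = 0"
      then obtain \<gamma> where "\<not> int p dvd \<gamma>" "\<phi>1 (U 1 u) = real_of_int \<gamma>" using \<phi>_zero_form(1) U1 by metis
      moreover have "\<phi>1 (U 1 u) = real_of_int (int p * (b1 * \<alpha>))" by (simp only: \<phi>1_def U1_1) simp
      ultimately show False by (metis dvd_triv_left of_int_eq_iff)
    qed
    then obtain w where w: "w \<in> \<Lambda>" "f (P 1 (x - w)) = 0" "f (P 1 (y - w)) = 0"
      using L1.levels_force_rational_ratio(2)[OF xy(1-3)] by blast
    obtain j1 k1 where j1: "j1 \<in> {1..p - 1}" and v1: "P 1 (x - w) = (real j1 / real p) *\<^sub>R real_vec a + real_vec k1"
      using w(2) f_zero_iff by blast
    obtain j2 k2 where j2: "j2 \<in> {1..p - 1}" and v2: "P 1 (y - w) = (real j2 / real p) *\<^sub>R real_vec a + real_vec k2"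
      using w(3) f_zero_iff by blast
    have "U 1 u = P 1 (x - w) - P 1 (y - w)"
      unfolding U1[symmetric] by (simp add: linear_diff[OF linear_eigen_scale, symmetric])
    then have Uu: "U 1 u $ e = (real j1 - real j2) / real p * a $ e + real_of_int (k1 $ e - k2 $ e)" for e
      unfolding v1 v2 by (simp add: diff_divide_distrib left_diff_distrib)
    have "real_of_int (b1 * \<alpha>) = (real j1 - real j2) / real p * a $ 1 + real_of_int (k1 $ 1 - k2 $ 1)"
      using Uu[of 1] unfolding U1_1 .
    then have "real_of_int (int p * (b1 * \<alpha> - (k1 $ 1 - k2 $ 1))) = real_of_int ((int j1 - int j2) * a $ 1)"
      using p_pos by (simp add: field_simps)
    then have "int p dvd (int j1 - int j2) * a $ 1" by (metis dvd_triv_left of_int_eq_iff)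
    then have "int p dvd int j1 - int j2" using a_not_dvd[of 1] by (simp add: prime_dvd_mult_int)
    moreover have "\<bar>int j1 - int j2\<bar> < int p" using j1 j2 p_ge_2 by auto
    ultimately have "int j1 - int j2 = 0"
      using dvd_imp_le_int[of "int j1 - int j2" "int p"] by (cases "int j1 - int j2 = 0") auto
    then have Uu2: "U 1 u $ 2 = real_of_int (k1 $ 2 - k2 $ 2)" using Uu[of 2] by simp
    obtain m where m: "c2 = int p ^ l * m" "\<not> int p dvd m" using c2_form by blast
    have "U 1 u $ 2 = \<kappa> * (r1 - r2) * (real_of_int \<alpha> / real p) + r2 * (real_of_int \<beta> / real p)"
      by (simp add: u12 algebra_simps)
    also have "r2 * (real_of_int \<beta> / real p) = real_of_int (b2 * \<beta>)" unfolding b2 using p_pos by simp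
    finally have "\<kappa> * (r1 - r2) * (real_of_int \<alpha> / real p) = real_of_int (k1 $ 2 - k2 $ 2 - b2 * \<beta>)"
      unfolding Uu2 by simp
    then have "real_of_int c2 * real p * (\<kappa> * (r1 - r2) * (real_of_int \<alpha> / real p))
        = real_of_int (c2 * int p * (k1 $ 2 - k2 $ 2 - b2 * \<beta>))" by simp
    moreover have "real_of_int c2 * real p * (\<kappa> * (r1 - r2) * (real_of_int \<alpha> / real p))
        = real_of_int c1 * (r1 - r2) * real_of_int \<alpha>"
      using p_pos by (simp add: c2_\<kappa>[symmetric])
    ultimately have "real_of_int (c1 * (int p * b1 - int p * b2) * \<alpha>) = real_of_int (c2 * int p * (k1 $ 2 - k2 $ 2 - b2 * \<beta>))"
      unfolding b1 b2 by simp
    then have "c1 * (int p * b1 - int p * b2) * \<alpha> = int p ^ (l + 1) * (m * (k1 $ 2 - k2 $ 2 - b2 * \<beta>))"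
      unfolding m(1) of_int_eq_iff by simp
    then have dvd: "int p ^ (l + 1) dvd c1 * (int p * b1 - int p * b2) * \<alpha>" by simp
    have "int p ^ (l + 1) dvd int p * b1 - int p * b2"
    proof (cases "l = 0")
      case True
      then show ?thesis by (simp flip: right_diff_distrib)
    next
      case False
      then have "int p dvd c2" unfolding m(1) by simp
      then have "\<not> int p dvd c1" using c12 prime_int_p by (meson not_coprimeI not_prime_unit)
      then have "coprime (int p ^ (l + 1)) c1" "coprime (int p ^ (l + 1)) \<alpha>"
        using \<alpha> prime_int_p by (auto intro!: prime_imp_coprime)
      then show ?thesis using dvd by (simp add: coprime_dvd_mult_left_iff coprime_dvd_mult_right_iff)
    qed
    then obtain k where "int p * b1 - int p * b2 = int p ^ (l + 1) * k" ..
    then have "r1 - r2 = real_of_int (int p ^ (l + 1) * k)" unfolding b1 b2 by (metis of_int_diff)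
    then show ?thesis by (auto simp: int_multiples_def)
  qed
qed

end

section \<open>Sufficiency\<close>

context planar_system
begin

definition pairing :: "nat \<Rightarrow> int" where
  "pairing i = a $ 1 * d i $ 1 + a $ 2 * d i $ 2"

abbreviation root :: "int \<Rightarrow> complex" where
  "root t \<equiv> exp (- 2 * complex_of_real pi * \<i> * of_int t / of_nat p)"

lemma f_shift:
  "f (x + (real_of_int n / real p) *\<^sub>R real_vec a)
    = (\<Sum>i<p. fourier_exp x (real_vec (d i)) * root (n * pairing i)) / of_nat p"
proof -
  have "fourier_exp ((real_of_int n / real p) *\<^sub>R real_vec a) (real_vec (d i)) = root (n * pairing i)" for i
  proof -
    have "((real_of_int n / real p) *\<^sub>R real_vec a) \<bullet> real_vec (d i) = real_of_int (n * pairing i) / real p"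
      by (simp add: inner_vec2 pairing_def distrib_left add_divide_distrib mult.assoc)
    then show ?thesis unfolding fourier_exp_def by (simp only:) simp
  qed
  moreover have "(\<Sum>v\<in>D. h v) = (\<Sum>i<p. h (real_vec (d i)))" for h :: "real ^ 2 \<Rightarrow> complex"
    unfolding D_eq by (simp add: sum.reindex[OF D_props(4)])
  ultimately show ?thesis
    unfolding f_eq D_props(3) by (simp only: fourier_exp_add)
qed

lemma f_multiple_of_a:
  assumes "\<not> int p dvd n"
  shows "f ((real_of_int n / real p) *\<^sub>R real_vec a) = 0"
proof -
  define j where "j = nat (n mod int p)"
  have "0 \<le> n mod int p" "n mod int p < int p" "n mod int p \<noteq> 0"
    using p_pos assms by (auto simp: dvd_eq_mod_eq_0)
  then have j: "j \<in> {1..p - 1}" "int j = n mod int p" by (auto simp: j_def)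
  have "n = int p * (n div int p) + int j" by (simp add: j(2))
  then have "real_of_int n = real_of_int (int p * (n div int p) + int j)" by presburger
  then have n: "real_of_int n = real p * real_of_int (n div int p) + real j" by simp
  have "(real_of_int n / real p) *\<^sub>R real_vec a
      = (real j / real p) *\<^sub>R real_vec a + real_vec (\<chi> i. (n div int p) * a $ i)"
    using p_pos unfolding n by (simp add: vec2_eq_iff field_simps)
  then show ?thesis using f_zero_iff j(1) by blast
qed

text \<open>The zeros of \<open>f\<close> along the multiples of \<open>a\<close> say that the values of the pairing with \<open>a\<close> are
  equidistributed, hence distinct, modulo \<open>p\<close>.\<close>

lemma pairing_inj:
  assumes "i < p" "i' < p" "int p dvd pairing i - pairing i'"
  shows "i = i'"
proof (rule ccontr)
  assume ne: "i \<noteq> i'"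
  let ?h = "\<lambda>i i'. if int p dvd pairing i - pairing i' then 1 else 0 :: real"
  have "(\<Sum>j<p. complex_of_real ((cmod (\<Sum>i<p. 1 * root (int j * pairing i)))\<^sup>2))
      = of_nat p * (\<Sum>i<p. \<Sum>i'<p. if int p dvd pairing i - pairing i' then 1 * cnj 1 else 0)"
    by (rule unit_root_parseval[OF p_pos(1)])
  also have "(\<Sum>i<p. \<Sum>i'<p. if int p dvd pairing i - pairing i' then 1 * cnj 1 else 0)
      = complex_of_real (\<Sum>i<p. \<Sum>i'<p. ?h i i')"
    by (simp add: if_distrib[of complex_of_real] cong: if_cong)
  finally have "complex_of_real (\<Sum>j<p. (cmod (\<Sum>i<p. root (int j * pairing i)))\<^sup>2)
      = complex_of_real (real p * (\<Sum>i<p. \<Sum>i'<p. ?h i i'))" by simp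
  then have eq: "(\<Sum>j<p. (cmod (\<Sum>i<p. root (int j * pairing i)))\<^sup>2) = real p * (\<Sum>i<p. \<Sum>i'<p. ?h i i')"
    by (simp only: of_real_eq_iff)
  have "(\<Sum>i<p. root (int j * pairing i)) = 0" if j: "j \<in> {..<p} - {0}" for j
  proof -
    have "j \<in> {1..p - 1}" using j by auto
    then have "f (0 + (real_of_int (int j) / real p) *\<^sub>R real_vec a) = 0"
      using f_multiple_of_a[of "int j"] small_not_dvd by simp
    then show ?thesis unfolding f_shift using p_pos by simp
  qed
  then have "(\<Sum>j<p. (cmod (\<Sum>i<p. root (int j * pairing i)))\<^sup>2) = (\<Sum>j<p. if j = 0 then (real p)\<^sup>2 else 0)"
    by (intro sum.cong refl) (auto)
  also have "\<dots> = real p * real p" using p_pos by (simp add: power2_eq_square)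
  finally have total: "(\<Sum>i<p. \<Sum>i'<p. ?h i i') = real p" using eq p_pos by simp
  have "real p + 1 = (\<Sum>k<p. \<Sum>k'<p. (if k' = k then 1 else 0) + (if k' = i' then (if k = i then 1 else 0) else 0))"
    using assms by (simp add: sum.distrib)
  also have "\<dots> \<le> (\<Sum>i<p. \<Sum>i'<p. ?h i i')" using assms(3) ne by (intro sum_mono) auto
  finally show False using total by simp
qed

lemma power_level_unique:
  fixes b \<alpha> \<beta> :: int
  assumes "b \<noteq> 0" "(int p * b) ^ m * \<alpha> = (int p * b) ^ n * \<beta>" "\<not> int p dvd \<alpha>" "\<not> int p dvd \<beta>"
  shows "m = n"
proof -
  have *: "\<not> m < n" if "(int p * b) ^ m * \<alpha> = (int p * b) ^ n * \<beta>" "\<not> int p dvd \<alpha>" for m n \<alpha> \<beta>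
  proof
    assume "m < n"
    then have "(int p * b) ^ n = (int p * b) ^ m * ((int p * b) * (int p * b) ^ (n - m - 1))"
      by (simp flip: power_add power_Suc)
    then have "(int p * b) ^ m * \<alpha> = (int p * b) ^ m * (int p * (b * (int p * b) ^ (n - m - 1) * \<beta>))"
      using that(1) by (simp add: mult_ac)
    then have "\<alpha> = int p * (b * (int p * b) ^ (n - m - 1) * \<beta>)"
      using assms(1) p_pos by simp
    then show False using that(2) by (metis dvd_triv_left)
  qed
  show ?thesis using *[of m \<alpha> n \<beta>] *[of n \<beta> m \<alpha>] assms by linarith
qed

context
  fixes b1 b2 b3 m :: int
  assumes b1: "r1 = real_of_int (int p * b1)" and b2: "r2 = real_of_int (int p * b2)"
    and b3: "r1 - r2 = real_of_int (int p ^ (l + 1) * b3)"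
    and m: "c2 = int p ^ l * m" "\<not> int p dvd m"
begin

text \<open>The digits are the multiples \<open>j * m\<close> of \<open>a / p\<close> for \<open>j < p\<close>; the factor \<open>m\<close> absorbs the part of the denominator of \<open>\<kappa>\<close> that is prime
to \<open>p\<close>. The periods \<open>\<Gamma>\<close> are \<open>m\<int> \<times> \<int>\<close>, and \<open>\<Omega>\<close> is the same lattice divided by \<open>p\<close>.\<close>
definition \<Gamma> :: "(real ^ 2) set" where
  "\<Gamma> = {real_vec k | k. m dvd k $ 1}"

definition \<Omega> :: "(real ^ 2) set" where
  "\<Omega> = {v. \<exists>n1 n2. v $ 1 = real_of_int (m * n1) / real p \<and> v $ 2 = real_of_int n2 / real p}"

lemma m_nz: "m \<noteq> 0"
  using m by auto

lemma b_pos: "b1 > 0" "b2 > 0"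
proof -
  have "0 < real_of_int (int p * b1)" "0 < real_of_int (int p * b2)" using r_gt_1 b1 b2 by linarith+
  then show "b1 > 0" "b2 > 0" using p_pos by (simp_all add: zero_less_mult_iff)
qed

text \<open>The second coordinate contains \<open>\<kappa> * (r1 ^ i - r2 ^ i) * m * n1 / p\<close>, whose denominator \<open>p ^ (l + 1)\<close> is cancelled
by the hypothesis on \<open>r1 - r2\<close>.\<close>
lemma U_integral:
  assumes "i \<ge> 1" "v \<in> \<Omega>"
  shows "\<exists>k. U i v = real_vec k"
proof -
  obtain n1 n2 where v: "v $ 1 = real_of_int (m * n1) / real p" "v $ 2 = real_of_int n2 / real p"
    using assms(2) by (auto simp: \<Omega>_def)
  obtain j where i: "i = Suc j" using assms(1) by (cases i) auto
  have "int p * b1 - int p * b2 dvd (int p * b1) ^ i - (int p * b2) ^ i" by (simp add: power_diff_sumr2)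
  moreover have "real_of_int (int p * b1 - int p * b2) = real_of_int (int p ^ (l + 1) * b3)"
    using b1 b2 b3 by (metis of_int_diff)
  then have "int p * b1 - int p * b2 = int p ^ (l + 1) * b3" by (simp only: of_int_eq_iff)
  ultimately obtain t where "(int p * b1) ^ i - (int p * b2) ^ i = int p ^ (l + 1) * b3 * t" by (metis dvdE)
  then have "real_of_int ((int p * b1) ^ i - (int p * b2) ^ i) = real_of_int (int p ^ (l + 1) * b3 * t)" by simp
  then have t: "r1 ^ i - r2 ^ i = real_of_int (int p ^ (l + 1) * b3 * t)" unfolding b1 b2 by simp
  have "U i v $ 1 = real_of_int (b1 * (int p * b1) ^ j * m * n1)"
    using p_pos by (simp only: eigen_scale_nth v b1 i power_Suc) simp
  moreover have "U i v $ 2 = \<kappa> * (r1 ^ i - r2 ^ i) * v $ 1 + r2 ^ i * v $ 2"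
    by (simp add: algebra_simps)
  moreover have "r2 ^ i * v $ 2 = real_of_int (b2 * (int p * b2) ^ j * n2)"
    using p_pos by (simp only: v b2 i power_Suc) simp
  moreover have "\<kappa> * (r1 ^ i - r2 ^ i) * v $ 1 = (real_of_int c2 * \<kappa>) * real_of_int (b3 * t * n1)"
    unfolding t v m(1) using p_pos by simp
  ultimately have "U i v $ 1 = real_of_int (b1 * (int p * b1) ^ j * m * n1)"
    "U i v $ 2 = real_of_int (c1 * (b3 * t * n1) + b2 * (int p * b2) ^ j * n2)"
    by (simp_all only: c2_\<kappa> of_int_add of_int_mult)
  then have "U i v = real_vec (vector [b1 * (int p * b1) ^ j * m * n1, c1 * (b3 * t * n1) + b2 * (int p * b2) ^ j * n2])"
    unfolding vec2_eq_iff real_vec_nth vector_2_nth by simp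
  then show ?thesis by blast
qed

lemma g_zero_levels:
  assumes "g x = 0"
  shows "\<exists>n\<ge>1. \<exists>\<alpha> \<beta>. \<not> int p dvd \<alpha> \<and> \<not> int p dvd \<beta> \<and>
    \<phi>1 x = real_of_int ((int p * b1) ^ n * \<alpha>) \<and> \<phi>2 x = real_of_int ((int p * b2) ^ n * \<beta>)"
proof -
  obtain n where n: "n \<ge> 1" "f (P n x) = 0" using assms g_zero_iff by blast
  obtain \<alpha> where \<alpha>: "\<not> int p dvd \<alpha>" "\<phi>1 x / r1 ^ n = real_of_int \<alpha>" using \<phi>_zero_form(1)[OF n(2)] \<phi>_P(1) by metis
  obtain \<beta> where \<beta>: "\<not> int p dvd \<beta>" "\<phi>2 x / r2 ^ n = real_of_int \<beta>" using \<phi>_zero_form(2)[OF n(2)] \<phi>_P(2) by metis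
  have "r1 ^ n \<noteq> 0" "r2 ^ n \<noteq> 0" using rho by auto
  then have "\<phi>1 x = real_of_int \<alpha> * r1 ^ n" "\<phi>2 x = real_of_int \<beta> * r2 ^ n"
    using \<alpha>(2) \<beta>(2) by (metis nonzero_divide_eq_eq)+
  then have "\<phi>1 x = real_of_int ((int p * b1) ^ n * \<alpha>)" "\<phi>2 x = real_of_int ((int p * b2) ^ n * \<beta>)"
    unfolding b1 b2 by simp_all
  then show ?thesis using n(1) \<alpha>(1) \<beta>(1) by blast
qed

text \<open>Suppose that \<open>g\<close> vanishes on all of \<open>y + \<Gamma>\<close>. The first coordinate determines the level of a zero, and it can be
moved to have a large level \<open>n\<close>. Then \<open>\<phi>2\<close> is divisible by \<open>p ^ n\<close> at two points of \<open>y + \<Gamma>\<close> that differ by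
\<open>1\<close> in the second coordinate only, so \<open>p ^ n\<close> divides \<open>p * c2\<close>, which contains only \<open>p ^ (l + 1)\<close>.\<close>
lemma g_nonvanishing: "\<exists>k\<in>\<Gamma>. g (y + k) \<noteq> 0"
proof (rule ccontr)
  assume "\<not> ?thesis"
  then have zero: "g (y + real_vec k) = 0" if "m dvd k $ 1" for k using that by (auto simp: \<Gamma>_def)
  have "g y = 0" using zero[of 0] by (simp add: real_vec_def flip: zero_vec_def)
  then obtain n \<alpha> where n: "n \<ge> 1" "\<phi>1 y = real_of_int ((int p * b1) ^ n * \<alpha>)" using g_zero_levels by blast
  define X where "X = b1 * (int p * b1) ^ (n - 1) * \<alpha>"
  have "(int p * b1) ^ n * \<alpha> = int p * X" unfolding X_def using n(1) by (cases n) auto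
  then have y1: "y $ 1 = real_of_int X" using n(2) p_pos by (simp add: \<phi>1_def)
  \<comment> \<open>Move along \<open>\<Gamma>\<close> to a nonzero first coordinate divisible by a high power of \<open>p\<close>; this forces
    the level of the zero to be high.\<close>
  define e where "e = nat ((int p * b1) ^ (l + 1))"
  have pb: "int p * b1 > 0" using b_pos p_pos by simp
  have "(int p * b1) ^ (l + 1) = int e" using pb by (simp add: e_def)
  also have "\<dots> < int (2 ^ e)" by (simp only: of_nat_less_iff) (rule less_exp)
  also have "\<dots> \<le> int (p ^ e)" using p_ge_2 by (simp only: of_nat_le_iff) (rule power_mono, auto)
  finally have e: "(int p * b1) ^ (l + 1) < int p ^ e" by simp
  have "coprime (int p ^ e) m" using m(2) prime_int_p by (simp add: prime_imp_coprime)
  then have "coprime m (int p ^ e)" by (simp add: coprime_commute)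
  then obtain u v where uv: "u * m + v * int p ^ e = 1"
    using bezout_int[of m "int p ^ e"] by (auto simp: coprime_iff_gcd_eq_1)
  define t where "t = (if X * v = 0 then 1 else 0 :: int)"
  define k1 where "k1 = - X * u * m + t * m * int p ^ e"
  have "X + k1 = X * (1 - u * m) + t * m * int p ^ e" by (simp add: k1_def algebra_simps)
  also have "1 - u * m = v * int p ^ e" using uv by simp
  finally have Xk: "X + k1 = int p ^ e * (X * v + t * m)" by (simp add: algebra_simps)
  have nz: "X + k1 \<noteq> 0" unfolding Xk using m_nz p_pos by (auto simp: t_def)
  have mk: "m dvd k1" by (simp add: k1_def)
  have \<phi>1k: "\<phi>1 (y + real_vec (vector [k1, z])) = real_of_int (int p * (X + k1))" for z
    by (simp add: \<phi>1_def y1)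
  have "g (y + real_vec (vector [k1, 0])) = 0" using zero mk by simp
  then obtain n0 \<alpha>0 \<beta>0 where z0: "\<not> int p dvd \<alpha>0"
    "\<phi>1 (y + real_vec (vector [k1, 0])) = real_of_int ((int p * b1) ^ n0 * \<alpha>0)"
    "\<phi>2 (y + real_vec (vector [k1, 0])) = real_of_int ((int p * b2) ^ n0 * \<beta>0)"
    using g_zero_levels by blast
  have "g (y + real_vec (vector [k1, 1])) = 0" using zero mk by simp
  then obtain n1 \<alpha>1 \<beta>1 where z1: "\<not> int p dvd \<alpha>1"
    "\<phi>1 (y + real_vec (vector [k1, 1])) = real_of_int ((int p * b1) ^ n1 * \<alpha>1)"
    "\<phi>2 (y + real_vec (vector [k1, 1])) = real_of_int ((int p * b2) ^ n1 * \<beta>1)"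
    using g_zero_levels by blast
  have e0: "int p * (X + k1) = (int p * b1) ^ n0 * \<alpha>0" using z0(2) unfolding \<phi>1k of_int_eq_iff .
  have e1: "int p * (X + k1) = (int p * b1) ^ n1 * \<alpha>1" using z1(2) unfolding \<phi>1k of_int_eq_iff .
  have n01: "n0 = n1" using power_level_unique[of b1 n0 \<alpha>0 n1 \<alpha>1] e0 e1 z0(1) z1(1) b_pos by simp
  have n0: "n0 \<ge> l + 2"
  proof (rule ccontr)
    assume "\<not> n0 \<ge> l + 2"
    then have "(int p * b1) ^ n0 \<le> (int p * b1) ^ (l + 1)" using pb by (intro power_increasing) auto
    moreover have "int p ^ e dvd (int p * b1) ^ n0 * \<alpha>0" unfolding e0[symmetric] Xk by simp
    then have "int p ^ e dvd (int p * b1) ^ n0"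
      using z0(1) prime_int_p by (simp add: prime_imp_coprime coprime_dvd_mult_left_iff)
    then have "int p ^ e \<le> (int p * b1) ^ n0" using pb by (intro zdvd_imp_le) auto
    ultimately show False using e by linarith
  qed
  have "\<phi>2 (y + real_vec (vector [k1, 1])) - \<phi>2 (y + real_vec (vector [k1, 0])) = real_of_int (int p * c2)"
    by (simp add: \<phi>2_def algebra_simps)
  then have "real_of_int ((int p * b2) ^ n0 * (\<beta>1 - \<beta>0)) = real_of_int (int p * c2)"
    unfolding z1(3) z0(3) n01 by (simp add: algebra_simps)
  then have "(int p * b2) ^ n0 * (\<beta>1 - \<beta>0) = int p * c2" by (simp only: of_int_eq_iff)
  then have "int p ^ n0 * (b2 ^ n0 * (\<beta>1 - \<beta>0)) = int p ^ (l + 1) * m"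
    by (simp add: m(1) power_mult_distrib mult_ac)
  then have "int p ^ n0 dvd int p ^ (l + 1) * m" by (metis dvd_triv_left)
  moreover have "int p ^ (l + 1) * int p dvd int p ^ n0" using le_imp_power_dvd[OF n0, of "int p"] by (simp add: mult_ac)
  ultimately have "int p ^ (l + 1) * int p dvd int p ^ (l + 1) * m" by (rule dvd_trans[rotated])
  then show False using m(2) p_pos by simp
qed

lemma \<Gamma>_cover:
  "\<exists>k\<in>\<Gamma>. y + k \<in> cbox 0 (vector [\<bar>real_of_int m\<bar>, 1])"
proof -
  define k :: "int ^ 2" where "k = vector [- \<lfloor>y $ 1 / \<bar>m\<bar>\<rfloor> * \<bar>m\<bar>, - \<lfloor>y $ 2\<rfloor>]"
  have "real_vec k \<in> \<Gamma>" by (auto simp: \<Gamma>_def k_def)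
  moreover have "y + real_vec k \<in> cbox 0 (vector [\<bar>real_of_int m\<bar>, 1])"
  proof -
    have pos: "\<bar>real_of_int m\<bar> > 0" using m_nz by simp
    define q where "q = y $ 1 / \<bar>real_of_int m\<bar>"
    have yq: "y $ 1 = q * \<bar>real_of_int m\<bar>" using pos by (simp add: q_def)
    have "0 \<le> (q - real_of_int \<lfloor>q\<rfloor>) * \<bar>real_of_int m\<bar>" "(q - real_of_int \<lfloor>q\<rfloor>) * \<bar>real_of_int m\<bar> \<le> 1 * \<bar>real_of_int m\<bar>"
      using pos by (intro mult_nonneg_nonneg mult_right_mono; linarith)+
    moreover have "(y + real_vec k) $ 1 = (q - real_of_int \<lfloor>q\<rfloor>) * \<bar>real_of_int m\<bar>"
      by (simp add: k_def yq[symmetric] q_def[symmetric] left_diff_distrib)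
    moreover have "(y + real_vec k) $ 2 = y $ 2 - real_of_int \<lfloor>y $ 2\<rfloor>" by (simp add: k_def)
    moreover have "0 \<le> y $ 2 - real_of_int \<lfloor>y $ 2\<rfloor>" "y $ 2 - real_of_int \<lfloor>y $ 2\<rfloor> \<le> 1" by linarith+
    ultimately show ?thesis by (simp add: mem_box_cart forall_2)
  qed
  ultimately show ?thesis by blast
qed

lemma sufficiency: "spectral_measure \<mu>"
proof -
  define s where "s j = (real_of_int (int j * m) / real p) *\<^sub>R real_vec a" for j :: nat
  interpret tower: digit_tower D f g P U \<Gamma> \<Omega> s p
  proof (rule digit_tower.intro[OF refinable_axioms], rule digit_tower_axioms.intro)
    show "linear (U n)" for n by (rule linear_eigen_scale)
    show "P i (U n x) = U (n - i) x" if "i \<le> n" for i n x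
    proof -
      have "\<rho>1 ^ i * r1 ^ n = r1 ^ (n - i)" "\<rho>2 ^ i * r2 ^ n = r2 ^ (n - i)"
        using that rho by (simp_all add: power_diff power_inverse divide_inverse)
      then show ?thesis by (simp add: eigen_scale_compose)
    qed
    show "U 0 x = x" for x by (simp add: eigen_scale_1)
    show "f (x + k) = f x" if "k \<in> \<Gamma>" for k x using that f_period by (auto simp: \<Gamma>_def)
    show "f (x + U i v) = f x" if "i \<ge> 1" "v \<in> \<Omega>" for i v x
      using U_integral[OF that] f_period by metis
    show "s j + k \<in> \<Omega>" if jk: "j < p" "k \<in> \<Gamma>" for j k
    proof -
      obtain k' where "k = real_vec k'" "m dvd k' $ 1" using jk(2) by (auto simp: \<Gamma>_def)
      then obtain q where k': "k = real_vec k'" "k' $ 1 = m * q" by (auto elim: dvdE)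
      have "(s j + k) $ 1 = real_of_int (m * (int j * a $ 1 + int p * q)) / real p"
        "(s j + k) $ 2 = real_of_int (int j * m * a $ 2 + int p * k' $ 2) / real p"
        using p_pos by (simp_all add: s_def k' field_simps)
      then show ?thesis unfolding \<Omega>_def by blast
    qed
    show "s 0 = 0" by (simp add: s_def)
    show "p > 0" by (rule p_pos)
    show "f (s i - s j) = 0" if "i < p" "j < p" "i \<noteq> j" for i j
    proof -
      have "\<bar>int i - int j\<bar> < int p" "int i - int j \<noteq> 0" using that by auto
      then have "\<not> int p dvd int i - int j" using dvd_imp_le_int[of "int i - int j" "int p"] by auto
      then have nd: "\<not> int p dvd (int i - int j) * m" using m(2) by (simp add: prime_dvd_mult_int)
      have eq: "s i - s j = (real_of_int ((int i - int j) * m) / real p) *\<^sub>R real_vec a"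
        by (simp add: s_def left_diff_distrib diff_divide_distrib scaleR_left_diff_distrib)
      show ?thesis unfolding eq by (rule f_multiple_of_a[OF nd])
    qed
    show "(\<Sum>j<p. (cmod (f (x + s j)))\<^sup>2) = 1" for x
    proof -
      define u where "u i = fourier_exp x (real_vec (d i))" for i
      have iff: "int p dvd m * pairing i - m * pairing i' \<longleftrightarrow> i = i'" if "i < p" "i' < p" for i i'
        using pairing_inj[OF that] m(2) by (auto simp: prime_dvd_mult_int simp flip: right_diff_distrib)
      have "(\<Sum>j<p. complex_of_real ((cmod (\<Sum>i<p. u i * root (int j * (m * pairing i))))\<^sup>2))
          = of_nat p * (\<Sum>i<p. \<Sum>i'<p. if int p dvd m * pairing i - m * pairing i' then u i * cnj (u i') else 0)"
        by (rule unit_root_parseval[OF p_pos(1)])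
      also have "(\<Sum>i<p. \<Sum>i'<p. if int p dvd m * pairing i - m * pairing i' then u i * cnj (u i') else 0)
          = (\<Sum>i<p. \<Sum>i'<p. if i = i' then 1 else 0)"
        using iff by (intro sum.cong refl) (auto simp: u_def)
      finally have "complex_of_real (\<Sum>j<p. (cmod (\<Sum>i<p. u i * root (int j * (m * pairing i))))\<^sup>2)
          = complex_of_real (real p * real p)" by simp
      then have eq: "(\<Sum>j<p. (cmod (\<Sum>i<p. u i * root (int j * (m * pairing i))))\<^sup>2) = real p * real p"
        by (simp only: of_real_eq_iff)
      have "f (x + s j) = (\<Sum>i<p. u i * root (int j * (m * pairing i))) / of_nat p" for j
        unfolding s_def f_shift u_def by (simp add: mult.assoc)
      then have "(cmod (f (x + s j)))\<^sup>2
          = (cmod (\<Sum>i<p. u i * root (int j * (m * pairing i))))\<^sup>2 / (real p)\<^sup>2" for j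
        by (simp only: norm_divide norm_of_nat power_divide)
      then have "(\<Sum>j<p. (cmod (f (x + s j)))\<^sup>2)
          = (\<Sum>j<p. (cmod (\<Sum>i<p. u i * root (int j * (m * pairing i))))\<^sup>2) / (real p)\<^sup>2"
        by (simp only: sum_divide_distrib)
      also have "\<dots> = 1" unfolding eq using p_pos by (simp add: power2_eq_square)
      finally show ?thesis .
    qed
    show "\<exists>\<epsilon>>0. \<exists>\<delta>>0. \<forall>y. \<exists>k\<in>\<Gamma>. \<forall>w. norm w < \<delta> \<longrightarrow> \<epsilon> \<le> cmod (g (y + k + w))"
    proof (rule uniform_nonvanishing[OF continuous_fourier_transform compact_cbox \<Gamma>_cover])
      fix k k' assume "k \<in> \<Gamma>" "k' \<in> \<Gamma>"
      then obtain q q' where "k = real_vec q" "m dvd q $ 1" "k' = real_vec q'" "m dvd q' $ 1" by (auto simp: \<Gamma>_def)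
      then have "k + k' = real_vec (q + q')" "m dvd (q + q') $ 1" by (auto simp: vec2_eq_iff)
      then show "k + k' \<in> \<Gamma>" by (auto simp: \<Gamma>_def)
    qed (rule g_nonvanishing)
  qed
  obtain \<Lambda> where "countable \<Lambda>" and \<Lambda>: "(\<forall>x\<in>\<Lambda>. \<forall>y\<in>\<Lambda>. x \<noteq> y \<longrightarrow> g (x - y) = 0) \<and>
    (\<forall>\<xi> \<eta>. \<eta> > 0 \<longrightarrow> (\<exists>F\<subseteq>\<Lambda>. finite F \<and> (\<Sum>l\<in>F. (cmod (g (\<xi> + l)))\<^sup>2) > 1 - \<eta>))"
    using tower.exists_complete_set by blast
  have "orthonormal_basis_L2 \<mu> \<Lambda> fourier_exp"
    unfolding orthonormal_basis_iff_parseval[OF compactly_supported_\<mu>] by (rule \<Lambda>)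
  then show ?thesis
    unfolding spectral_measure_def
    using prob_space_axioms sets_\<mu> compactly_supported_\<mu> \<open>countable \<Lambda>\<close> by blast
qed

end

theorem spectral_iff:
  "spectral_measure \<mu> \<longleftrightarrow> r1 \<in> int_multiples (int p) \<and> r2 \<in> int_multiples (int p) \<and>
     r1 - r2 \<in> int_multiples (int p ^ (l + 1))"
proof
  assume "spectral_measure \<mu>"
  then show "r1 \<in> int_multiples (int p) \<and> r2 \<in> int_multiples (int p) \<and>
     r1 - r2 \<in> int_multiples (int p ^ (l + 1))" using necessity by blast
next
  assume *: "r1 \<in> int_multiples (int p) \<and> r2 \<in> int_multiples (int p) \<and>
     r1 - r2 \<in> int_multiples (int p ^ (l + 1))"
  then obtain b1 b2 b3 where "r1 = real_of_int (int p * b1)" "r2 = real_of_int (int p * b2)"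
    "r1 - r2 = real_of_int (int p ^ (l + 1) * b3)"
    unfolding int_multiples_def by blast
  moreover obtain m where "c2 = int p ^ l * m" "\<not> int p dvd m" using c2_form by blast
  ultimately show "spectral_measure \<mu>" by (rule sufficiency)
qed

end

theorem theorem1p6:
  fixes p l :: nat and \<rho>1 \<rho>2 c :: real and M :: "real ^ 2 ^ 2"
    and d :: "nat \<Rightarrow> int ^ 2" and D :: "(real ^ 2) set" and d11 :: int
    and a :: "int ^ 2" and \<mu> :: "(real ^ 2) measure" and c'' :: real and c1 c2 :: int
  assumes "prime p"
    and "\<rho>1 \<in> {0<..<1}" and "\<rho>2 \<in> {0<..<1}" and "\<rho>1 \<noteq> \<rho>2"
    and "M = vector [vector [inverse \<rho>1, c], vector [0, inverse \<rho>2]]"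
    and "inj_on d {..<p}" and "D = (\<lambda>i. real_vec (d i)) ` {..<p}"
    and "d 0 = 0" and "d 1 = vector [d11, 0]" and "d11 \<noteq> 0"
    and "a \<in> residue_vectors p"
    and "zero_set (fourier_transform (delta_measure D)) =
           (\<Union>j\<in>{1..p - 1}. {(real j / real p) *\<^sub>R real_vec a + real_vec k | k. True})"
    and "self_affine_measure M D \<mu>"
    and "c'' = c / (inverse \<rho>1 - inverse \<rho>2)"
    and "c'' \<in> E_set p a"
    and "c'' = real_of_int c1 / real_of_int c2" and "coprime c1 c2"
    and "\<exists>m. c2 = int p ^ l * m \<and> \<not> int p dvd m"
  shows "spectral_measure \<mu> \<longleftrightarrow>
           inverse \<rho>1 \<in> int_multiples (int p) \<and> inverse \<rho>2 \<in> int_multiples (int p) \<and>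
           inverse \<rho>1 - inverse \<rho>2 \<in> int_multiples (int p ^ (l + 1))"
proof -
  interpret planar_system p l \<rho>1 \<rho>2 c M d D d11 a \<mu> c'' c1 c2
    by (rule planar_system.intro) (rule assms)+
  show ?thesis by (rule spectral_iff)
qed

end
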